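(* Let $\mathcal{C}$ be a modular fusion category over $\mathbb{C}$, and let $X$ be a simple object of $\mathcal{C}$ such that $\mathcal{C}=\langle X\rangle$. Then $\dim(X)^2\mid \dfrac{\dim(\mathcal{C})}{|U(\mathcal{C})|}$, i.e. $\dfrac{\dim(\mathcal{C})}{|U(\mathcal{C})|\dim(X)^2}$ is an algebraic integer.
   Context: All categories are over $\mathbb{C}$. $\mathbb{A}\subset\mathbb{C}$ is the ring of algebraic integers; for $\alpha,\beta\in\mathbb{C}$ with $\beta\neq 0$, $\beta\mid\alpha$ means $\alpha/\beta\in\mathbb{A}$. A modular fusion category is a braided spherical fusion category with non-degenerate $S$-matrix. $\dim(X)$ is the quantum dimension with respect to the given spherical structure, and $\dim(\mathcal{C})=\sum_{Y\in\mathrm{Irr}(\mathcal{C})}\dim(Y)^2$ is the global dimension. $\langle X\rangle$ is the fusion subcategory generated by $X$ (its simple objects are the simple constituents of tensor powers $X^{\otimes m}$). $U(\mathcal{C})$ is the universal grading group of $\mathcal{C}$. *)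

theory Defs
  imports "HOL-Algebra.Coset" "HOL-Algebra.Module" "HOL-Computational_Algebra.Polynomial"
begin

section \<open>Complex-linear abelian categories\<close>

text \<open>
  Objects are the elements of \<^typ>\<open>'o\<close>, arrows the elements of \<^typ>\<open>'m\<close>; every arrow has
  a source and a target, so that distinct hom-sets are disjoint.  Operations on arrows are total;
  they are only constrained where the usual typing conditions hold.
\<close>

record ('o, 'm) lin_cat =
  src :: "'m \<Rightarrow> 'o"
  tgt :: "'m \<Rightarrow> 'o"
  idm :: "'o \<Rightarrow> 'm"
  cmp :: "'m \<Rightarrow> 'm \<Rightarrow> 'm"  (infixl "\<cdot>\<index>" 60)
  zerom :: "'o \<Rightarrow> 'o \<Rightarrow> 'm"
  plusm :: "'m \<Rightarrow> 'm \<Rightarrow> 'm"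
  scale :: "complex \<Rightarrow> 'm \<Rightarrow> 'm"

definition complex_ring :: "complex ring" where
  "complex_ring = \<lparr>carrier = UNIV, monoid.mult = (*), one = 1, ring.zero = 0, add = (+)\<rparr>"

context
  fixes C :: "('o, 'm, 'z) lin_cat_scheme" (structure)
begin

definition Hom :: "'o \<Rightarrow> 'o \<Rightarrow> 'm set" where
  "Hom X Y = {f. src C f = X \<and> tgt C f = Y}"

text \<open>The multiplication and unit of the record underlying a module play no role.\<close>

definition hom_space :: "'o \<Rightarrow> 'o \<Rightarrow> (complex, 'm) module" where
  "hom_space X Y = \<lparr>carrier = Hom X Y, monoid.mult = undefined, one = undefined,
     ring.zero = zerom C X Y, add = plusm C, module.smult = scale C\<rparr>"

definition inverse_arrows :: "'m \<Rightarrow> 'm \<Rightarrow> bool" where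
  "inverse_arrows f g \<longleftrightarrow> src C g = tgt C f \<and> tgt C g = src C f \<and>
     g \<cdot> f = idm C (src C f) \<and> f \<cdot> g = idm C (tgt C f)"

definition iso_arrow :: "'m \<Rightarrow> bool" where
  "iso_arrow f \<longleftrightarrow> (\<exists>g. inverse_arrows f g)"

definition inv_arrow :: "'m \<Rightarrow> 'm" where
  "inv_arrow f = (THE g. inverse_arrows f g)"

definition isomorphic :: "'o \<Rightarrow> 'o \<Rightarrow> bool" where
  "isomorphic X Y \<longleftrightarrow> (\<exists>f\<in>Hom X Y. iso_arrow f)"

definition monic :: "'m \<Rightarrow> bool" where
  "monic f \<longleftrightarrow> (\<forall>g h. tgt C g = src C f \<and> tgt C h = src C f \<and> src C g = src C h \<and>
     f \<cdot> g = f \<cdot> h \<longrightarrow> g = h)"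

definition epic :: "'m \<Rightarrow> bool" where
  "epic f \<longleftrightarrow> (\<forall>g h. src C g = tgt C f \<and> src C h = tgt C f \<and> tgt C g = tgt C h \<and>
     g \<cdot> f = h \<cdot> f \<longrightarrow> g = h)"

definition is_kernel :: "'m \<Rightarrow> 'm \<Rightarrow> bool" where
  "is_kernel k f \<longleftrightarrow> tgt C k = src C f \<and> f \<cdot> k = zerom C (src C k) (tgt C f) \<and>
     (\<forall>h. tgt C h = src C f \<and> f \<cdot> h = zerom C (src C h) (tgt C f) \<longrightarrow>
       (\<exists>!u. u \<in> Hom (src C h) (src C k) \<and> k \<cdot> u = h))"

definition is_cokernel :: "'m \<Rightarrow> 'm \<Rightarrow> bool" where
  "is_cokernel q f \<longleftrightarrow> src C q = tgt C f \<and> q \<cdot> f = zerom C (src C f) (tgt C q) \<and>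
     (\<forall>h. src C h = tgt C f \<and> h \<cdot> f = zerom C (src C f) (tgt C h) \<longrightarrow>
       (\<exists>!u. u \<in> Hom (tgt C q) (tgt C h) \<and> u \<cdot> q = h))"

definition zero_object :: "'o \<Rightarrow> bool" where
  "zero_object Z \<longleftrightarrow> (\<forall>X. (\<exists>!f. f \<in> Hom Z X) \<and> (\<exists>!f. f \<in> Hom X Z))"

text \<open>For the empty list this says that \<open>X\<close> is a zero object.\<close>

definition direct_sum :: "'o \<Rightarrow> 'o list \<Rightarrow> bool" where
  "direct_sum X Ss \<longleftrightarrow> (\<exists>i p.
     (\<forall>k<length Ss. i k \<in> Hom (Ss ! k) X \<and> p k \<in> Hom X (Ss ! k)) \<and>
     (\<forall>j<length Ss. \<forall>k<length Ss.
        p j \<cdot> i k = (if j = k then idm C (Ss ! k) else zerom C (Ss ! k) (Ss ! j))) \<and>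
     finsum (hom_space X X) (\<lambda>k. i k \<cdot> p k) {..<length Ss} = idm C X)"

definition simple_obj :: "'o \<Rightarrow> bool" where
  "simple_obj X \<longleftrightarrow> \<not> zero_object X \<and>
     (\<forall>f. monic f \<and> tgt C f = X \<longrightarrow> zero_object (src C f) \<or> iso_arrow f)"

definition constituent :: "'o \<Rightarrow> 'o \<Rightarrow> bool" where
  "constituent S X \<longleftrightarrow> simple_obj S \<and> (\<exists>f\<in>Hom S X. monic f)"

definition Irr :: "'o set set" where
  "Irr = Collect simple_obj // {(X, Y). simple_obj X \<and> simple_obj Y \<and> isomorphic X Y}"

definition rep :: "'o set \<Rightarrow> 'o" where
  "rep K = (SOME X. X \<in> K)"

end

locale linear_category =
  fixes C :: "('o, 'm, 'z) lin_cat_scheme" (structure)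
  assumes id_Hom: "idm C X \<in> Hom C X X"
    and cmp_Hom: "\<lbrakk>f \<in> Hom C X Y; g \<in> Hom C Y Z\<rbrakk> \<Longrightarrow> g \<cdot> f \<in> Hom C X Z"
    and id_left: "idm C (tgt C f) \<cdot> f = f"
    and id_right: "f \<cdot> idm C (src C f) = f"
    and cmp_assoc: "\<lbrakk>f \<in> Hom C W X; g \<in> Hom C X Y; h \<in> Hom C Y Z\<rbrakk> \<Longrightarrow> h \<cdot> (g \<cdot> f) = (h \<cdot> g) \<cdot> f"
    and hom_module: "Module.module complex_ring (hom_space C X Y)"
    and cmp_plus_left: "\<lbrakk>f \<in> Hom C X Y; g \<in> Hom C Y Z; h \<in> Hom C Y Z\<rbrakk> \<Longrightarrow>
      plusm C g h \<cdot> f = plusm C (g \<cdot> f) (h \<cdot> f)"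
    and cmp_plus_right: "\<lbrakk>f \<in> Hom C X Y; g \<in> Hom C X Y; h \<in> Hom C Y Z\<rbrakk> \<Longrightarrow>
      h \<cdot> plusm C f g = plusm C (h \<cdot> f) (h \<cdot> g)"
    and cmp_scale_left: "\<lbrakk>f \<in> Hom C X Y; g \<in> Hom C Y Z\<rbrakk> \<Longrightarrow> scale C a g \<cdot> f = scale C a (g \<cdot> f)"
    and cmp_scale_right: "\<lbrakk>f \<in> Hom C X Y; g \<in> Hom C Y Z\<rbrakk> \<Longrightarrow> g \<cdot> scale C a f = scale C a (g \<cdot> f)"

locale abelian_linear_category = linear_category +
  assumes ex_zero_object: "\<exists>Z. zero_object C Z"
    and ex_direct_sum: "\<exists>Z. direct_sum C Z [X, Y]"
    and ex_kernel: "\<exists>k. is_kernel C k f"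
    and ex_cokernel: "\<exists>q. is_cokernel C q f"
    and monic_normal: "monic C f \<Longrightarrow> \<exists>g. is_kernel C f g"
    and epic_normal: "epic C f \<Longrightarrow> \<exists>g. is_cokernel C f g"


section \<open>Fusion categories\<close>

record ('o, 'm) mon_cat = "('o, 'm) lin_cat" +
  tenO :: "'o \<Rightarrow> 'o \<Rightarrow> 'o"  (infixl "\<otimes>\<^sub>o\<index>" 70)
  tenM :: "'m \<Rightarrow> 'm \<Rightarrow> 'm"  (infixl "\<otimes>\<^sub>m\<index>" 70)
  unitO :: "'o"  ("\<one>\<^sub>o\<index>")
  assoc :: "'o \<Rightarrow> 'o \<Rightarrow> 'o \<Rightarrow> 'm"
  lunit :: "'o \<Rightarrow> 'm"
  runit :: "'o \<Rightarrow> 'm"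

locale linear_monoidal_category = abelian_linear_category C
  for C :: "('o, 'm, 'z) mon_cat_scheme" (structure) +
  assumes ten_Hom: "\<lbrakk>f \<in> Hom C X X'; g \<in> Hom C Y Y'\<rbrakk> \<Longrightarrow> f \<otimes>\<^sub>m g \<in> Hom C (X \<otimes>\<^sub>o Y) (X' \<otimes>\<^sub>o Y')"
    and ten_id: "idm C X \<otimes>\<^sub>m idm C Y = idm C (X \<otimes>\<^sub>o Y)"
    and ten_cmp: "\<lbrakk>f \<in> Hom C X X'; f' \<in> Hom C X' X''; g \<in> Hom C Y Y'; g' \<in> Hom C Y' Y''\<rbrakk> \<Longrightarrow>
      (f' \<cdot> f) \<otimes>\<^sub>m (g' \<cdot> g) = (f' \<otimes>\<^sub>m g') \<cdot> (f \<otimes>\<^sub>m g)"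
    and ten_plus_left: "\<lbrakk>f \<in> Hom C X Y; g \<in> Hom C X Y\<rbrakk> \<Longrightarrow>
      plusm C f g \<otimes>\<^sub>m h = plusm C (f \<otimes>\<^sub>m h) (g \<otimes>\<^sub>m h)"
    and ten_plus_right: "\<lbrakk>f \<in> Hom C X Y; g \<in> Hom C X Y\<rbrakk> \<Longrightarrow>
      h \<otimes>\<^sub>m plusm C f g = plusm C (h \<otimes>\<^sub>m f) (h \<otimes>\<^sub>m g)"
    and ten_scale_left: "scale C a f \<otimes>\<^sub>m g = scale C a (f \<otimes>\<^sub>m g)"
    and ten_scale_right: "f \<otimes>\<^sub>m scale C a g = scale C a (f \<otimes>\<^sub>m g)"
    and assoc_Hom: "assoc C X Y Z \<in> Hom C ((X \<otimes>\<^sub>o Y) \<otimes>\<^sub>o Z) (X \<otimes>\<^sub>o (Y \<otimes>\<^sub>o Z))"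
    and assoc_iso: "iso_arrow C (assoc C X Y Z)"
    and assoc_natural: "\<lbrakk>f \<in> Hom C X X'; g \<in> Hom C Y Y'; h \<in> Hom C Z Z'\<rbrakk> \<Longrightarrow>
      assoc C X' Y' Z' \<cdot> ((f \<otimes>\<^sub>m g) \<otimes>\<^sub>m h) = (f \<otimes>\<^sub>m (g \<otimes>\<^sub>m h)) \<cdot> assoc C X Y Z"
    and lunit_Hom: "lunit C X \<in> Hom C (\<one>\<^sub>o \<otimes>\<^sub>o X) X"
    and lunit_iso: "iso_arrow C (lunit C X)"
    and lunit_natural: "f \<in> Hom C X Y \<Longrightarrow> lunit C Y \<cdot> (idm C \<one>\<^sub>o \<otimes>\<^sub>m f) = f \<cdot> lunit C X"
    and runit_Hom: "runit C X \<in> Hom C (X \<otimes>\<^sub>o \<one>\<^sub>o) X"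
    and runit_iso: "iso_arrow C (runit C X)"
    and runit_natural: "f \<in> Hom C X Y \<Longrightarrow> runit C Y \<cdot> (f \<otimes>\<^sub>m idm C \<one>\<^sub>o) = f \<cdot> runit C X"
    and pentagon: "assoc C W X (Y \<otimes>\<^sub>o Z) \<cdot> assoc C (W \<otimes>\<^sub>o X) Y Z =
      (idm C W \<otimes>\<^sub>m assoc C X Y Z) \<cdot> assoc C W (X \<otimes>\<^sub>o Y) Z \<cdot> (assoc C W X Y \<otimes>\<^sub>m idm C Z)"
    and triangle: "(idm C X \<otimes>\<^sub>m lunit C Y) \<cdot> assoc C X \<one>\<^sub>o Y = runit C X \<otimes>\<^sub>m idm C Y"

text \<open>A choice of left duals is part of the structure, since the functor \<open>X \<mapsto> X\<^sup>*\<^sup>*\<close> of a pivotal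
  structure refers to one.\<close>

record ('o, 'm) rigid_cat = "('o, 'm) mon_cat" +
  dualO :: "'o \<Rightarrow> 'o"
  ev :: "'o \<Rightarrow> 'm"
  coev :: "'o \<Rightarrow> 'm"

definition left_dual :: "('o, 'm, 'z) mon_cat_scheme \<Rightarrow> 'o \<Rightarrow> 'o \<Rightarrow> 'm \<Rightarrow> 'm \<Rightarrow> bool" where
  "left_dual C X D e c \<longleftrightarrow>
     e \<in> Hom C (D \<otimes>\<^sub>o\<^bsub>C\<^esub> X) \<one>\<^sub>o\<^bsub>C\<^esub> \<and> c \<in> Hom C \<one>\<^sub>o\<^bsub>C\<^esub> (X \<otimes>\<^sub>o\<^bsub>C\<^esub> D) \<and>
     runit C X \<cdot>\<^bsub>C\<^esub> (idm C X \<otimes>\<^sub>m\<^bsub>C\<^esub> e) \<cdot>\<^bsub>C\<^esub> assoc C X D X \<cdot>\<^bsub>C\<^esub> (c \<otimes>\<^sub>m\<^bsub>C\<^esub> idm C X)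
       \<cdot>\<^bsub>C\<^esub> inv_arrow C (lunit C X) = idm C X \<and>
     lunit C D \<cdot>\<^bsub>C\<^esub> (e \<otimes>\<^sub>m\<^bsub>C\<^esub> idm C D) \<cdot>\<^bsub>C\<^esub> inv_arrow C (assoc C D X D) \<cdot>\<^bsub>C\<^esub> (idm C D \<otimes>\<^sub>m\<^bsub>C\<^esub> c)
       \<cdot>\<^bsub>C\<^esub> inv_arrow C (runit C D) = idm C D"

locale fusion_category = linear_monoidal_category C
  for C :: "('o, 'm, 'z) rigid_cat_scheme" (structure) +
  assumes hom_finite_dim: "\<exists>B. finite B \<and> B \<subseteq> Hom C X Y \<and>
      (\<forall>f\<in>Hom C X Y. \<exists>a. f = finsum (hom_space C X Y) (\<lambda>b. scale C (a b) b) B)"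
    and semisimple: "\<exists>Ss. (\<forall>S\<in>set Ss. simple_obj C S) \<and> direct_sum C X Ss"
    and finite_Irr: "finite (Irr C)"
    and unit_End: "bij_betw (\<lambda>a. scale C a (idm C \<one>\<^sub>o)) UNIV (Hom C \<one>\<^sub>o \<one>\<^sub>o)"
    and dual: "left_dual C X (dualO C X) (ev C X) (coev C X)"
    and ex_right_dual: "\<exists>D e c. left_dual C D X e c"


section \<open>Generated subcategories and the universal grading group\<close>

primrec tensor_list :: "('o, 'm, 'z) mon_cat_scheme \<Rightarrow> 'o list \<Rightarrow> 'o" where
  "tensor_list C [] = \<one>\<^sub>o\<^bsub>C\<^esub>"
| "tensor_list C (X # Xs) = X \<otimes>\<^sub>o\<^bsub>C\<^esub> tensor_list C Xs"

text \<open>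
  The objects of the full fusion subcategory generated by a set \<open>A\<close> of objects.  Closure under
  duals need not be imposed: in a fusion category the dual of a simple object \<open>S\<close> is a constituent
  of some tensor power of \<open>S\<close>.
\<close>

definition generated :: "('o, 'm, 'z) mon_cat_scheme \<Rightarrow> 'o set \<Rightarrow> 'o set" where
  "generated C A = {Z. \<exists>Ss. direct_sum C Z Ss \<and>
     (\<forall>S\<in>set Ss. \<exists>Xs. set Xs \<subseteq> A \<and> constituent C S (tensor_list C Xs))}"

definition adjoint_subcat :: "('o, 'm, 'z) rigid_cat_scheme \<Rightarrow> 'o set" where
  "adjoint_subcat C = generated C {X \<otimes>\<^sub>o\<^bsub>C\<^esub> dualO C X | X. simple_obj C X}"

text \<open>
  The universal grading in the construction of Gelaki and Nikshych: the category decomposes as a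
  bimodule category over its adjoint subcategory into indecomposable components, and the universal
  grading group is the set of these components with the product induced by the tensor product.
  A component is represented by the set of all simple objects it contains.
\<close>

definition same_component :: "('o, 'm, 'z) rigid_cat_scheme \<Rightarrow> ('o \<times> 'o) set" where
  "same_component C = {(Y, Z). simple_obj C Y \<and>
     (\<exists>A\<in>adjoint_subcat C. \<exists>B\<in>adjoint_subcat C. constituent C Z ((A \<otimes>\<^sub>o\<^bsub>C\<^esub> Y) \<otimes>\<^sub>o\<^bsub>C\<^esub> B))}"

definition universal_grading_group :: "('o, 'm, 'z) rigid_cat_scheme \<Rightarrow> 'o set monoid" where
  "universal_grading_group C =
     \<lparr>carrier = Collect (simple_obj C) // same_component C,
      monoid.mult = (\<lambda>K L. {Z. \<exists>X\<in>K. \<exists>Y\<in>L. constituent C Z (X \<otimes>\<^sub>o\<^bsub>C\<^esub> Y)}),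
      one = {Z\<in>adjoint_subcat C. simple_obj C Z}\<rparr>"


section \<open>Spherical, braided and modular structure\<close>

record ('o, 'm) piv_cat = "('o, 'm) rigid_cat" +
  piv :: "'o \<Rightarrow> 'm"

context
  fixes C :: "('o, 'm, 'z) rigid_cat_scheme" (structure)
begin

text \<open>The arrow \<open>Z \<rightarrow> W\<^sup>*\<close> corresponding to a pairing \<open>e : Z \<otimes> W \<rightarrow> \<one>\<close>.\<close>

definition mate :: "'o \<Rightarrow> 'o \<Rightarrow> 'm \<Rightarrow> 'm" where
  "mate Z W e = lunit C (dualO C W) \<cdot> (e \<otimes>\<^sub>m idm C (dualO C W)) \<cdot> inv_arrow C (assoc C Z W (dualO C W))
     \<cdot> (idm C Z \<otimes>\<^sub>m coev C W) \<cdot> inv_arrow C (runit C Z)"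

definition dualM :: "'m \<Rightarrow> 'm" where
  "dualM f = mate (dualO C (tgt C f)) (src C f) (ev C (tgt C f) \<cdot> (idm C (dualO C (tgt C f)) \<otimes>\<^sub>m f))"

text \<open>The canonical isomorphism \<open>Y\<^sup>* \<otimes> X\<^sup>* \<rightarrow> (X \<otimes> Y)\<^sup>*\<close>.\<close>

definition dual_ten :: "'o \<Rightarrow> 'o \<Rightarrow> 'm" where
  "dual_ten X Y = mate (dualO C Y \<otimes>\<^sub>o dualO C X) (X \<otimes>\<^sub>o Y)
     (ev C Y \<cdot> (idm C (dualO C Y) \<otimes>\<^sub>m
        (lunit C Y \<cdot> (ev C X \<otimes>\<^sub>m idm C Y) \<cdot> inv_arrow C (assoc C (dualO C X) X Y)))
      \<cdot> assoc C (dualO C Y) (dualO C X) (X \<otimes>\<^sub>o Y))"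

text \<open>The tensor structure \<open>X\<^sup>*\<^sup>* \<otimes> Y\<^sup>*\<^sup>* \<rightarrow> (X \<otimes> Y)\<^sup>*\<^sup>*\<close> of the double dual functor.\<close>

definition ddual_ten :: "'o \<Rightarrow> 'o \<Rightarrow> 'm" where
  "ddual_ten X Y = dualM (inv_arrow C (dual_ten X Y)) \<cdot> dual_ten (dualO C Y) (dualO C X)"

text \<open>The complex number that an endomorphism of the unit object is.\<close>

definition scalar :: "'m \<Rightarrow> complex" where
  "scalar f = (THE a. f = scale C a (idm C \<one>\<^sub>o))"

end

context
  fixes C :: "('o, 'm, 'z) piv_cat_scheme" (structure)
begin

definition qtrace :: "'o \<Rightarrow> 'm \<Rightarrow> complex" where
  "qtrace X f = scalar C
     (ev C (dualO C X) \<cdot> ((piv C X \<cdot> f) \<otimes>\<^sub>m idm C (dualO C X)) \<cdot> coev C X)"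

definition qdim :: "'o \<Rightarrow> complex" where
  "qdim X = qtrace X (idm C X)"

definition global_dim :: complex where
  "global_dim = (\<Sum>K\<in>Irr C. (qdim (rep K))\<^sup>2)"

end

locale spherical_fusion_category = fusion_category C
  for C :: "('o, 'm, 'z) piv_cat_scheme" (structure) +
  assumes piv_Hom: "piv C X \<in> Hom C X (dualO C (dualO C X))"
    and piv_iso: "iso_arrow C (piv C X)"
    and piv_natural: "f \<in> Hom C X Y \<Longrightarrow> piv C Y \<cdot> f = dualM C (dualM C f) \<cdot> piv C X"
    and piv_monoidal: "piv C (X \<otimes>\<^sub>o Y) = ddual_ten C X Y \<cdot> (piv C X \<otimes>\<^sub>m piv C Y)"
    and spherical: "qdim C (dualO C X) = qdim C X"

record ('o, 'm) braided_piv_cat = "('o, 'm) piv_cat" +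
  braid :: "'o \<Rightarrow> 'o \<Rightarrow> 'm"

definition S_matrix :: "('o, 'm, 'z) braided_piv_cat_scheme \<Rightarrow> 'o set \<Rightarrow> 'o set \<Rightarrow> complex" where
  "S_matrix C K L = qtrace C (rep K \<otimes>\<^sub>o\<^bsub>C\<^esub> rep L)
     (braid C (rep L) (rep K) \<cdot>\<^bsub>C\<^esub> braid C (rep K) (rep L))"

definition invertible_on :: "'i set \<Rightarrow> ('i \<Rightarrow> 'i \<Rightarrow> complex) \<Rightarrow> bool" where
  "invertible_on I M \<longleftrightarrow> (\<exists>N. \<forall>i\<in>I. \<forall>j\<in>I.
     (\<Sum>k\<in>I. M i k * N k j) = of_bool (i = j) \<and> (\<Sum>k\<in>I. N i k * M k j) = of_bool (i = j))"

locale modular_fusion_category = spherical_fusion_category C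
  for C :: "('o, 'm, 'z) braided_piv_cat_scheme" (structure) +
  assumes braid_Hom: "braid C X Y \<in> Hom C (X \<otimes>\<^sub>o Y) (Y \<otimes>\<^sub>o X)"
    and braid_iso: "iso_arrow C (braid C X Y)"
    and braid_natural: "\<lbrakk>f \<in> Hom C X X'; g \<in> Hom C Y Y'\<rbrakk> \<Longrightarrow>
      braid C X' Y' \<cdot> (f \<otimes>\<^sub>m g) = (g \<otimes>\<^sub>m f) \<cdot> braid C X Y"
    and hexagon1: "assoc C Y Z X \<cdot> braid C X (Y \<otimes>\<^sub>o Z) \<cdot> assoc C X Y Z =
      (idm C Y \<otimes>\<^sub>m braid C X Z) \<cdot> assoc C Y X Z \<cdot> (braid C X Y \<otimes>\<^sub>m idm C Z)"
    and hexagon2: "inv_arrow C (assoc C Z X Y) \<cdot> braid C (X \<otimes>\<^sub>o Y) Z \<cdot> inv_arrow C (assoc C X Y Z) =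
      (braid C X Z \<otimes>\<^sub>m idm C Y) \<cdot> inv_arrow C (assoc C X Z Y) \<cdot> (idm C X \<otimes>\<^sub>m braid C Y Z)"
    and S_nondegenerate: "invertible_on (Irr C) (S_matrix C)"


section \<open>Divisibility by algebraic integers\<close>

definition alg_dvd :: "complex \<Rightarrow> complex \<Rightarrow> bool" where
  "alg_dvd b a \<longleftrightarrow> b \<noteq> 0 \<and> algebraic_int (a / b)"

end

theory Submission
  imports Defs "Jordan_Normal_Form.Char_Poly"
begin

text \<open>For a simple object $A$ and any object $Y$ let $\lambda_A(Y)$ be the scalar by which a loop coloured
  $Y$ around a strand coloured $A$ acts, so that $S_{A,Y} = \dim(A)\,\lambda_A(Y)$.  A loop coloured
  $Y \otimes Z$ is two parallel loops, hence each $\lambda_A$ is a character of the fusion ring; as the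
  S-matrix is invertible, the $\lambda_A$ separate the elements of that ring and are all its characters.

  Write $f(Y) = \lambda_X(Y)\,\lambda_X(Y^*)$.  The element $\sum_Y Y \otimes Y^*$ of the fusion ring
  tensored with itself absorbs multiplication by any $Z$ equally on either side; this gives the
  orthogonality of characters, and with the symmetry of $S$ the value
  $\sum_Y f(Y) = \dim(\mathcal{C}) / \dim(X)^2$ (lemma \<open>pairing_lam_self\<close>).

  Now let $X$ generate.  Then the universal grading group has the order $n$, the period of $X$: every
  simple $Y$ lies in tensor powers $X^{\otimes k}$ for exactly one residue $k = \deg Y$ modulo $n$, and
  two simple objects of equal degree lie in a common power $X^{\otimes m}$, whence their quotient lies in
  $X^{\otimes m} \otimes (X^*)^{\otimes m} = (X \otimes X^*)^{\otimes m}$, an object of the adjoint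
  subcategory (lemmas \<open>same_degree_adj\<close>, \<open>order_universal_grading_group\<close>).

  Let $\zeta$ be a primitive $n$-th root of unity.  Since $\deg$ is a grading, $\zeta^{\deg}\lambda_A$ is
  a character, so it is $\lambda_{\sigma A}$ for a permutation $\sigma$ of the simple objects with
  $\sigma^n = 1$ (in effect, tensoring with an invertible object).  The
  symmetry of $S$ shows $f \circ \sigma = f$.  If $\sigma^k A = A$ with $0 < k < n$, then
  $\lambda_A(X) = \zeta^k\lambda_A(X)$ because $\deg X = 1$, so $\lambda_A(X) = 0$ and $f(A) = 0$: all
  orbits on which $f$ does not vanish have exactly $n$ elements.  Hence
  $\dim(\mathcal{C}) / (n \dim(X)^2)$ is the sum of $f$ over representatives of these orbits.  It is the
  value of $\lambda_X$ at an element of the fusion ring, hence an eigenvalue of an integer matrix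
  (lemmas \<open>grading_divides\<close>, \<open>lam_algebraic\<close>).

  What remains is to extract this fusion ring with its characters from the category.  The diagrammatic
  part (multiplicativity of $\lambda_A$ and of traces) is done in a strict monoidal category of words of
  objects, in which all associators have disappeared.  The linear part rests on Schur's lemma and on
  multiplicities counted as dimensions of Hom spaces, with Frobenius reciprocity
  $\mathrm{Hom}(W, Z \otimes Y) \cong \mathrm{Hom}(Z^* \otimes W, Y)$.\<close>

section \<open>String diagrams in a strict monoidal category\<close>

text \<open>A strict monoidal category whose objects are words, with $u \triangleright f \triangleleft v =
  \mathrm{id}_u \otimes f \otimes \mathrm{id}_v$ in place of the tensor product of arrows.  A string
  diagram is then a composite of layers, each with a single node, and the only law that reorders the
  layers is \<open>interchange\<close>: nodes at different places may pass each other.\<close>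

locale whiskered_category =
  fixes arr :: "'a \<Rightarrow> bool"
    and dom cod :: "'a \<Rightarrow> 'x list"
    and comp :: "'a \<Rightarrow> 'a \<Rightarrow> 'a"  (infixr "\<star>" 60)
    and idt :: "'x list \<Rightarrow> 'a"
    and whisk :: "'x list \<Rightarrow> 'a \<Rightarrow> 'x list \<Rightarrow> 'a"  ("_ \<triangleright> _ \<triangleleft> _" [76, 75, 76] 75)
  assumes arr_idt [simp]: "arr (idt u)"
    and dom_idt [simp]: "dom (idt u) = u"
    and cod_idt [simp]: "cod (idt u) = u"
    and arr_comp [simp]: "\<lbrakk>arr f; arr g; dom g = cod f\<rbrakk> \<Longrightarrow> arr (g \<star> f)"
    and dom_comp [simp]: "dom (g \<star> f) = dom f"
    and cod_comp [simp]: "cod (g \<star> f) = cod g"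
    and arr_whisk [simp]: "arr f \<Longrightarrow> arr (u \<triangleright> f \<triangleleft> v)"
    and dom_whisk [simp]: "dom (u \<triangleright> f \<triangleleft> v) = u @ dom f @ v"
    and cod_whisk [simp]: "cod (u \<triangleright> f \<triangleleft> v) = u @ cod f @ v"
    and comp_assoc [simp]: "\<lbrakk>arr f; arr g; arr h; dom g = cod f; dom h = cod g\<rbrakk> \<Longrightarrow>
      (h \<star> g) \<star> f = h \<star> (g \<star> f)"
    and idt_left [simp]: "\<lbrakk>arr f; cod f = u\<rbrakk> \<Longrightarrow> idt u \<star> f = f"
    and idt_right [simp]: "\<lbrakk>arr f; dom f = u\<rbrakk> \<Longrightarrow> f \<star> idt u = f"
    and whisk_comp [simp]: "\<lbrakk>arr f; arr g; dom g = cod f\<rbrakk> \<Longrightarrow>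
      u \<triangleright> (g \<star> f) \<triangleleft> v = (u \<triangleright> g \<triangleleft> v) \<star> (u \<triangleright> f \<triangleleft> v)"
    and whisk_whisk [simp]: "u \<triangleright> (u' \<triangleright> f \<triangleleft> v') \<triangleleft> v = (u @ u') \<triangleright> f \<triangleleft> (v' @ v)"
    and whisk_Nil [simp]: "[] \<triangleright> f \<triangleleft> [] = f"
    and whisk_idt [simp]: "u \<triangleright> idt x \<triangleleft> v = idt (u @ x @ v)"
    and interchange: "\<lbrakk>arr f; arr g\<rbrakk> \<Longrightarrow>
      (u \<triangleright> f \<triangleleft> (v @ cod g @ w)) \<star> ((u @ dom f @ v) \<triangleright> g \<triangleleft> w) =
      ((u @ cod f @ v) \<triangleright> g \<triangleleft> w) \<star> (u \<triangleright> f \<triangleleft> (v @ dom g @ w))"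
begin

definition hom :: "'x list \<Rightarrow> 'x list \<Rightarrow> 'a set" where
  "hom x y = {f. arr f \<and> dom f = x \<and> cod f = y}"

lemma homI: "\<lbrakk>arr f; dom f = x; cod f = y\<rbrakk> \<Longrightarrow> f \<in> hom x y"
  by (simp add: hom_def)

lemma homD: "f \<in> hom x y \<Longrightarrow> arr f" "f \<in> hom x y \<Longrightarrow> dom f = x" "f \<in> hom x y \<Longrightarrow> cod f = y"
  by (auto simp: hom_def)

text \<open>Composites are kept nested to the right, so an equation between composites of two layers is used in the
  form with a further factor below it.\<close>

lemma reduce:
  assumes "g \<star> f = r" "arr g" "arr f" "dom g = cod f" "arr h" "dom f = cod h"
  shows "g \<star> (f \<star> h) = r \<star> h"
  using assms comp_assoc[of h f g] by simp

lemma whisk_eq: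
  assumes "g \<star> f = r" "arr g" "arr f" "dom g = cod f"
  shows "(u \<triangleright> g \<triangleleft> v) \<star> (u \<triangleright> f \<triangleleft> v) = u \<triangleright> r \<triangleleft> v"
  using assms whisk_comp[of f g u v] by simp

lemma whisk_reduce:
  assumes "g \<star> f = r" "arr g" "arr f" "dom g = cod f" "arr h" "cod h = u @ dom f @ v"
  shows "(u \<triangleright> g \<triangleleft> v) \<star> ((u \<triangleright> f \<triangleleft> v) \<star> h) = (u \<triangleright> r \<triangleleft> v) \<star> h"
  using assms by (intro reduce whisk_eq) auto

lemma interchange_reduce:
  assumes "arr f" "arr g" "arr h" "cod h = u @ dom f @ v @ dom g @ w"
  shows "(u \<triangleright> f \<triangleleft> (v @ cod g @ w)) \<star> (((u @ dom f @ v) \<triangleright> g \<triangleleft> w) \<star> h) =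
      ((u @ cod f @ v) \<triangleright> g \<triangleleft> w) \<star> ((u \<triangleright> f \<triangleleft> (v @ dom g @ w)) \<star> h)"
  using assms interchange[of f g u v w] reduce[of "u \<triangleright> f \<triangleleft> (v @ cod g @ w)" "(u @ dom f @ v) \<triangleright> g \<triangleleft> w" _ h]
  by simp

definition dual_pair :: "'x list \<Rightarrow> 'x list \<Rightarrow> 'a \<Rightarrow> 'a \<Rightarrow> bool" where
  "dual_pair u v e c \<longleftrightarrow> e \<in> hom (v @ u) [] \<and> c \<in> hom [] (u @ v) \<and>
     (u \<triangleright> e \<triangleleft> []) \<star> ([] \<triangleright> c \<triangleleft> u) = idt u \<and> ([] \<triangleright> e \<triangleleft> v) \<star> (v \<triangleright> c \<triangleleft> []) = idt v"

text \<open>The arrow $z \to v$ obtained from a pairing $k : z\,u \to 1$ by bending the strand $u$ up.\<close>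

definition mate :: "'x list \<Rightarrow> 'x list \<Rightarrow> 'a \<Rightarrow> 'a \<Rightarrow> 'a" where
  "mate z v c k = ([] \<triangleright> k \<triangleleft> v) \<star> (z \<triangleright> c \<triangleleft> [])"

context
  fixes u v e c
  assumes dp: "dual_pair u v e c"
begin

lemma dual_hom: "e \<in> hom (v @ u) []" "c \<in> hom [] (u @ v)"
  using dp by (auto simp: dual_pair_def)

lemma dual_arr: "arr e" "arr c" "dom e = v @ u" "cod e = []" "dom c = []" "cod c = u @ v"
  using homD[OF dual_hom(1)] homD[OF dual_hom(2)] by auto

lemma zig: "(u \<triangleright> e \<triangleleft> []) \<star> ([] \<triangleright> c \<triangleleft> u) = idt u"
  and zag: "([] \<triangleright> e \<triangleleft> v) \<star> (v \<triangleright> c \<triangleleft> []) = idt v"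
  using dp by (auto simp: dual_pair_def)

lemma mate_hom: "k \<in> hom (z @ u) [] \<Longrightarrow> mate z v c k \<in> hom z v"
  unfolding mate_def using homD[of k] dual_arr by (intro homI) auto

text \<open>With \<open>mate_unique\<close>, bending is a bijection between arrows $z \to v$ and pairings of $z$ with
  $u$; this is one zigzag equation for each direction.  Hence arrows into a dual are equal as soon as
  they have the same evaluation.\<close>

lemma mate_eval:
  assumes "k \<in> hom (z @ u) []"
  shows "e \<star> ([] \<triangleright> mate z v c k \<triangleleft> u) = k"
proof -
  note [simp] = dual_arr homD[OF assms]
  have "e \<star> ([] \<triangleright> mate z v c k \<triangleleft> u) = e \<star> (([] \<triangleright> k \<triangleleft> (v @ u)) \<star> (z \<triangleright> c \<triangleleft> u))"
    using assms by (simp add: mate_def)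
  also have "\<dots> = k \<star> ((z @ u) \<triangleright> e \<triangleleft> []) \<star> (z \<triangleright> c \<triangleleft> u)"
    using assms interchange_reduce[of k e "z \<triangleright> c \<triangleleft> u" "[]" "[]" "[]"] by simp
  also have "\<dots> = k"
    using assms whisk_eq[OF zig, of z "[]"] by simp
  finally show ?thesis .
qed

lemma mate_unique:
  assumes "m \<in> hom z v"
  shows "mate z v c (e \<star> ([] \<triangleright> m \<triangleleft> u)) = m"
proof -
  note [simp] = dual_arr homD[OF assms]
  have "mate z v c (e \<star> ([] \<triangleright> m \<triangleleft> u)) = ([] \<triangleright> e \<triangleleft> v) \<star> ([] \<triangleright> m \<triangleleft> (u @ v)) \<star> (z \<triangleright> c \<triangleleft> [])"
    using assms by (simp add: mate_def)
  also have "\<dots> = ([] \<triangleright> e \<triangleleft> v) \<star> (v \<triangleright> c \<triangleleft> []) \<star> m"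
    using assms interchange[of m c "[]" "[]" "[]"] by simp
  also have "\<dots> = m"
    using reduce[OF zag, of m] by simp
  finally show ?thesis .
qed

lemma eval_cancel:
  assumes "m \<in> hom z v" "m' \<in> hom z v" "e \<star> ([] \<triangleright> m \<triangleleft> u) = e \<star> ([] \<triangleright> m' \<triangleleft> u)"
  shows "m = m'"
  using mate_unique assms by metis

end

definition nested_ev :: "'x list \<Rightarrow> 'x list \<Rightarrow> 'a \<Rightarrow> 'a \<Rightarrow> 'a" where
  "nested_ev v' u' e' e = e' \<star> (v' \<triangleright> e \<triangleleft> u')"

definition nested_coev :: "'x list \<Rightarrow> 'x list \<Rightarrow> 'a \<Rightarrow> 'a \<Rightarrow> 'a" where
  "nested_coev u v c c' = (u \<triangleright> c' \<triangleleft> v) \<star> c"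

text \<open>The dual of $u\,u'$ is $v'\,v$ with nested caps and cups.  After an interchange of the outer cup with the
  inner cap, each strand is straightened by its own zigzag.\<close>

lemma dual_pair_nested:
  assumes d: "dual_pair u v e c" and d': "dual_pair u' v' e' c'"
  shows "dual_pair (u @ u') (v' @ v) (nested_ev v' u' e' e) (nested_coev u v c c')"
proof -
  note [simp] = dual_arr[OF d] dual_arr[OF d']
  note zz = zig[OF d] zag[OF d] zig[OF d'] zag[OF d']
  let ?e = "nested_ev v' u' e' e" and ?c = "nested_coev u v c c'"
  have h: "?e \<in> hom ((v' @ v) @ (u @ u')) []" "?c \<in> hom [] ((u @ u') @ (v' @ v))"
    by (auto simp: nested_ev_def nested_coev_def intro!: homI)
  have "((u @ u') \<triangleright> ?e \<triangleleft> []) \<star> ([] \<triangleright> ?c \<triangleleft> (u @ u'))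
    = ((u @ u') \<triangleright> e' \<triangleleft> []) \<star> ((u @ u' @ v') \<triangleright> e \<triangleleft> u') \<star> (u \<triangleright> c' \<triangleleft> (v @ u @ u')) \<star> ([] \<triangleright> c \<triangleleft> (u @ u'))"
    by (simp add: nested_ev_def nested_coev_def)
  also have "\<dots> = ((u @ u') \<triangleright> e' \<triangleleft> []) \<star> (u \<triangleright> c' \<triangleleft> u') \<star> (u \<triangleright> e \<triangleleft> u') \<star> ([] \<triangleright> c \<triangleleft> (u @ u'))"
    using interchange_reduce[of c' e "[] \<triangleright> c \<triangleleft> (u @ u')" u "[]" u'] by simp
  also have "\<dots> = idt (u @ u')"
    using whisk_reduce[OF zz(3), of "(u \<triangleright> e \<triangleleft> u') \<star> ([] \<triangleright> c \<triangleleft> (u @ u'))" u "[]"] whisk_eq[OF zz(1), of "[]" u']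
    by simp
  finally have 1: "((u @ u') \<triangleright> ?e \<triangleleft> []) \<star> ([] \<triangleright> ?c \<triangleleft> (u @ u')) = idt (u @ u')" .
  have "([] \<triangleright> ?e \<triangleleft> (v' @ v)) \<star> ((v' @ v) \<triangleright> ?c \<triangleleft> [])
    = ([] \<triangleright> e' \<triangleleft> (v' @ v)) \<star> (v' \<triangleright> e \<triangleleft> (u' @ v' @ v)) \<star> ((v' @ v @ u) \<triangleright> c' \<triangleleft> v) \<star> ((v' @ v) \<triangleright> c \<triangleleft> [])"
    by (simp add: nested_ev_def nested_coev_def)
  also have "\<dots> = ([] \<triangleright> e' \<triangleleft> (v' @ v)) \<star> (v' \<triangleright> c' \<triangleleft> v) \<star> (v' \<triangleright> e \<triangleleft> v) \<star> ((v' @ v) \<triangleright> c \<triangleleft> [])"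
    using interchange_reduce[of e c' "(v' @ v) \<triangleright> c \<triangleleft> []" v' "[]" v] by simp
  also have "\<dots> = idt (v' @ v)"
    using whisk_reduce[OF zz(4), of "(v' \<triangleright> e \<triangleleft> v) \<star> ((v' @ v) \<triangleright> c \<triangleleft> [])" "[]" v] whisk_eq[OF zz(2), of v' "[]"]
    by simp
  finally have 2: "([] \<triangleright> ?e \<triangleleft> (v' @ v)) \<star> ((v' @ v) \<triangleright> ?c \<triangleleft> []) = idt (v' @ v)" .
  from h 1 2 show ?thesis by (simp add: dual_pair_def)
qed

definition dual_map :: "'x list \<Rightarrow> 'x list \<Rightarrow> 'a \<Rightarrow> 'a \<Rightarrow> 'a \<Rightarrow> 'a" where
  "dual_map v' v c e' f = mate v' v c (e' \<star> (v' \<triangleright> f \<triangleleft> []))"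

context
  fixes u v e c u' v' e' c' f
  assumes d: "dual_pair u v e c" and d': "dual_pair u' v' e' c'" and f: "f \<in> hom u u'"
begin

lemma dual_map_hom: "dual_map v' v c e' f \<in> hom v' v"
  unfolding dual_map_def using homD[OF f] dual_arr[OF d'] by (intro mate_hom[OF d] homI) auto

text \<open>A node that slides around a cap, or in the next lemma around a cup, becomes its transpose.\<close>

lemma dual_map_ev: "e \<star> ([] \<triangleright> dual_map v' v c e' f \<triangleleft> u) = e' \<star> (v' \<triangleright> f \<triangleleft> [])"
  unfolding dual_map_def using homD[OF f] dual_arr[OF d'] by (intro mate_eval[OF d] homI) auto

lemma dual_map_coev: "(u' \<triangleright> dual_map v' v c e' f \<triangleleft> []) \<star> c' = ([] \<triangleright> f \<triangleleft> v) \<star> c"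
proof -
  note [simp] = dual_arr[OF d] dual_arr[OF d'] homD[OF f]
  have "(u' \<triangleright> dual_map v' v c e' f \<triangleleft> []) \<star> c'
    = (u' \<triangleright> e' \<triangleleft> v) \<star> ((u' @ v') \<triangleright> f \<triangleleft> v) \<star> ((u' @ v') \<triangleright> c \<triangleleft> []) \<star> c'"
    by (simp add: dual_map_def mate_def)
  also have "\<dots> = (u' \<triangleright> e' \<triangleleft> v) \<star> ((u' @ v') \<triangleright> (([] \<triangleright> f \<triangleleft> v) \<star> c) \<triangleleft> []) \<star> c'"
    by simp
  also have "\<dots> = (u' \<triangleright> e' \<triangleleft> v) \<star> ([] \<triangleright> c' \<triangleleft> (u' @ v)) \<star> ([] \<triangleright> f \<triangleleft> v) \<star> c"
    using interchange[of c' "([] \<triangleright> f \<triangleleft> v) \<star> c" "[]" "[]" "[]"] by simp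
  also have "\<dots> = ([] \<triangleright> f \<triangleleft> v) \<star> c"
    using whisk_reduce[OF zig[OF d'], of "([] \<triangleright> f \<triangleleft> v) \<star> c" "[]" v] by simp
  finally show ?thesis .
qed

end

text \<open>The strand $u$ on the right is closed to a loop.  The cap $t : u\,v \to 1$ is not the evaluation
  $v\,u \to 1$ of the duality; it comes from a pivotal structure.\<close>

definition ptr :: "'x list \<Rightarrow> 'x list \<Rightarrow> 'x list \<Rightarrow> 'a \<Rightarrow> 'a \<Rightarrow> 'a \<Rightarrow> 'a" where
  "ptr a b v c t h = (b \<triangleright> t \<triangleleft> []) \<star> ([] \<triangleright> h \<triangleleft> v) \<star> (a \<triangleright> c \<triangleleft> [])"

text \<open>The node $g$ travels once around the loop, as \<open>gd\<close> on the dual strand.  This covers an arrow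
  and its transpose as well as a change of the dual that is used to close the loop.\<close>

lemma ptr_cyclic:
  assumes c: "c \<in> hom [] (u @ v)" "t \<in> hom (u @ v) []"
    and c': "c' \<in> hom [] (u' @ v')" "t' \<in> hom (u' @ v') []"
    and g: "g \<in> hom u' u" "gd \<in> hom v v'"
    and cc: "([] \<triangleright> g \<triangleleft> v') \<star> c' = (u \<triangleright> gd \<triangleleft> []) \<star> c"
    and tt: "t \<star> ([] \<triangleright> g \<triangleleft> v) = t' \<star> (u' \<triangleright> gd \<triangleleft> [])"
    and h: "h \<in> hom (a @ u) (b @ u')"
  shows "ptr a b v c t ((b \<triangleright> g \<triangleleft> []) \<star> h) = ptr a b v' c' t' (h \<star> (a \<triangleright> g \<triangleleft> []))"
proof -
  note [simp] = homD[OF c(1)] homD[OF c(2)] homD[OF c'(1)] homD[OF c'(2)] homD[OF g(1)] homD[OF g(2)] homD[OF h]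
  have "ptr a b v c t ((b \<triangleright> g \<triangleleft> []) \<star> h)
    = (b \<triangleright> (t \<star> ([] \<triangleright> g \<triangleleft> v)) \<triangleleft> []) \<star> ([] \<triangleright> h \<triangleleft> v) \<star> (a \<triangleright> c \<triangleleft> [])"
    unfolding ptr_def by simp
  also have "\<dots> = (b \<triangleright> t' \<triangleleft> []) \<star> ((b @ u') \<triangleright> gd \<triangleleft> []) \<star> ([] \<triangleright> h \<triangleleft> v) \<star> (a \<triangleright> c \<triangleleft> [])"
    unfolding tt by simp
  also have "\<dots> = (b \<triangleright> t' \<triangleleft> []) \<star> ([] \<triangleright> h \<triangleleft> v') \<star> ((a @ u) \<triangleright> gd \<triangleleft> []) \<star> (a \<triangleright> c \<triangleleft> [])"
    using interchange_reduce[of h gd "a \<triangleright> c \<triangleleft> []" "[]" "[]" "[]"] by simp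
  also have "\<dots> = (b \<triangleright> t' \<triangleleft> []) \<star> ([] \<triangleright> h \<triangleleft> v') \<star> (a \<triangleright> ((u \<triangleright> gd \<triangleleft> []) \<star> c) \<triangleleft> [])"
    by simp
  also have "\<dots> = ptr a b v' c' t' (h \<star> (a \<triangleright> g \<triangleleft> []))"
    unfolding cc[symmetric] ptr_def by simp
  finally show ?thesis .
qed

lemma ptr_nested:
  assumes "c \<in> hom [] (u @ v)" "t \<in> hom (u @ v) []"
    and "c' \<in> hom [] (u' @ v')" "t' \<in> hom (u' @ v') []"
    and "h \<in> hom (a @ u @ u') (b @ u @ u')"
  shows "ptr a b (v' @ v) (nested_coev u v c c') (nested_ev u v t t') h
    = ptr a b v c t (ptr (a @ u) (b @ u) v' c' t' h)"
proof -
  note [simp] = homD[OF assms(1)] homD[OF assms(2)] homD[OF assms(3)] homD[OF assms(4)] homD[OF assms(5)]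
  show ?thesis unfolding ptr_def nested_coev_def nested_ev_def by simp
qed

text \<open>Nodes on the open strand pass the cap and the cup of the loop by interchange.\<close>

lemma ptr_between:
  assumes "c \<in> hom [] (u @ v)" "t \<in> hom (u @ v) []" "h \<in> hom (a @ u) (b @ u)"
    "f \<in> hom a' a" "g \<in> hom b b'"
  shows "ptr a' b' v c t (([] \<triangleright> g \<triangleleft> u) \<star> h \<star> ([] \<triangleright> f \<triangleleft> u)) = g \<star> ptr a b v c t h \<star> f"
proof -
  note [simp] = homD[OF assms(1)] homD[OF assms(2)] homD[OF assms(3)] homD[OF assms(4)] homD[OF assms(5)]
  have "ptr a' b' v c t (([] \<triangleright> g \<triangleleft> u) \<star> h \<star> ([] \<triangleright> f \<triangleleft> u))
    = (b' \<triangleright> t \<triangleleft> []) \<star> ([] \<triangleright> g \<triangleleft> (u @ v)) \<star> ([] \<triangleright> h \<triangleleft> v) \<star> ([] \<triangleright> f \<triangleleft> (u @ v)) \<star> (a' \<triangleright> c \<triangleleft> [])"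
    unfolding ptr_def by simp
  also have "\<dots> = g \<star> (b \<triangleright> t \<triangleleft> []) \<star> ([] \<triangleright> h \<triangleleft> v) \<star> ([] \<triangleright> f \<triangleleft> (u @ v)) \<star> (a' \<triangleright> c \<triangleleft> [])"
    using interchange_reduce[of g t "([] \<triangleright> h \<triangleleft> v) \<star> ([] \<triangleright> f \<triangleleft> (u @ v)) \<star> (a' \<triangleright> c \<triangleleft> [])" "[]" "[]" "[]"] by simp
  also have "\<dots> = g \<star> (b \<triangleright> t \<triangleleft> []) \<star> ([] \<triangleright> h \<triangleleft> v) \<star> (a \<triangleright> c \<triangleleft> []) \<star> f"
    using interchange[of f c "[]" "[]" "[]"] by simp
  also have "\<dots> = g \<star> ptr a b v c t h \<star> f"
    unfolding ptr_def by simp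
  finally show ?thesis .
qed

lemma ptr_whisk:
  assumes "c \<in> hom [] (u @ v)" "t \<in> hom (u @ v) []" "h \<in> hom (a @ u) (b @ u)"
  shows "ptr (x @ a) (x @ b) v c t (x \<triangleright> h \<triangleleft> []) = x \<triangleright> ptr a b v c t h \<triangleleft> []"
proof -
  note [simp] = homD[OF assms(1)] homD[OF assms(2)] homD[OF assms(3)]
  show ?thesis unfolding ptr_def by simp
qed

end

section \<open>Linear and monoidal categories\<close>

context linear_category
begin

lemma Hom_iff: "f \<in> Hom C X Y \<longleftrightarrow> src C f = X \<and> tgt C f = Y"
  by (simp add: Hom_def)

lemma src_id [simp]: "src C (idm C X) = X" and tgt_id [simp]: "tgt C (idm C X) = X"
  using id_Hom[of X] by (simp_all add: Hom_iff)

lemma src_cmp [simp]: "src C g = tgt C f \<Longrightarrow> src C (g \<cdot> f) = src C f"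
  and tgt_cmp [simp]: "src C g = tgt C f \<Longrightarrow> tgt C (g \<cdot> f) = tgt C g"
  using cmp_Hom[of f "src C f" "tgt C f" g "tgt C g"] by (simp_all add: Hom_iff)

lemma id_cmp [simp]: "tgt C f = X \<Longrightarrow> idm C X \<cdot> f = f"
  and cmp_id [simp]: "src C f = X \<Longrightarrow> f \<cdot> idm C X = f"
  by (auto simp: id_left id_right)

lemma assoc_cmp: "\<lbrakk>src C g = tgt C f; src C h = tgt C g\<rbrakk> \<Longrightarrow> (h \<cdot> g) \<cdot> f = h \<cdot> (g \<cdot> f)"
  using cmp_assoc[of f "src C f" "tgt C f" g "tgt C g" h "tgt C h"] by (simp add: Hom_iff)

lemma cmp_reduce: "\<lbrakk>g \<cdot> f = r; src C g = tgt C f; src C f = tgt C h\<rbrakk> \<Longrightarrow> g \<cdot> (f \<cdot> h) = r \<cdot> h"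
  using assoc_cmp[of f h g] by simp

lemma inverse_arrows_unique:
  assumes "inverse_arrows C f g" "inverse_arrows C f h"
  shows "g = h"
proof -
  have "g = g \<cdot> (f \<cdot> h)" using assms unfolding inverse_arrows_def by auto
  also have "\<dots> = (g \<cdot> f) \<cdot> h" using assms unfolding inverse_arrows_def by (intro assoc_cmp[symmetric]) auto
  also have "\<dots> = h" using assms unfolding inverse_arrows_def by auto
  finally show ?thesis .
qed

lemma inv_arrow_eqI: "inverse_arrows C f g \<Longrightarrow> inv_arrow C f = g"
  unfolding inv_arrow_def by (rule the_equality) (auto intro: inverse_arrows_unique)

lemma iso_inverse_arrows: "iso_arrow C f \<Longrightarrow> inverse_arrows C f (inv_arrow C f)"
  unfolding iso_arrow_def by (metis inv_arrow_eqI)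

lemma src_inv [simp]: "iso_arrow C f \<Longrightarrow> src C (inv_arrow C f) = tgt C f"
  and tgt_inv [simp]: "iso_arrow C f \<Longrightarrow> tgt C (inv_arrow C f) = src C f"
  and inv_cmp [simp]: "iso_arrow C f \<Longrightarrow> src C f = X \<Longrightarrow> inv_arrow C f \<cdot> f = idm C X"
  and cmp_inv [simp]: "iso_arrow C f \<Longrightarrow> tgt C f = X \<Longrightarrow> f \<cdot> inv_arrow C f = idm C X"
  using iso_inverse_arrows[of f] by (auto simp: inverse_arrows_def)

lemma inv_cancel [simp]:
  assumes "iso_arrow C f"
  shows "tgt C h = src C f \<Longrightarrow> inv_arrow C f \<cdot> (f \<cdot> h) = h"
    and "tgt C h = tgt C f \<Longrightarrow> f \<cdot> (inv_arrow C f \<cdot> h) = h"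
proof -
  show "inv_arrow C f \<cdot> (f \<cdot> h) = h" if "tgt C h = src C f"
    using cmp_reduce[OF inv_cmp[OF assms refl], of h] assms that by simp
  show "f \<cdot> (inv_arrow C f \<cdot> h) = h" if "tgt C h = tgt C f"
    using cmp_reduce[OF cmp_inv[OF assms refl], of h] assms that by simp
qed

lemma isoI:
  assumes "src C g = tgt C f" "tgt C g = src C f" "g \<cdot> f = idm C (src C f)" "f \<cdot> g = idm C (tgt C f)"
  shows "iso_arrow C f" "inv_arrow C f = g"
  using assms inv_arrow_eqI[of f g] by (auto simp: iso_arrow_def inverse_arrows_def)

lemma iso_id [simp]: "iso_arrow C (idm C X)"
  by (rule isoI(1)[of "idm C X"]) auto

lemma iso_inv [simp]: "iso_arrow C f \<Longrightarrow> iso_arrow C (inv_arrow C f)"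
  by (rule isoI(1)[of f]) auto

lemma inv_inv [simp]: "iso_arrow C f \<Longrightarrow> inv_arrow C (inv_arrow C f) = f"
  by (rule isoI(2)[of f]) auto

lemma iso_cmp [simp]: "\<lbrakk>iso_arrow C f; iso_arrow C g; src C g = tgt C f\<rbrakk> \<Longrightarrow> iso_arrow C (g \<cdot> f)"
  by (rule isoI(1)[of "inv_arrow C f \<cdot> inv_arrow C g"]) (auto simp: assoc_cmp)

lemma iso_cancel_right:
  assumes "iso_arrow C f" "g \<cdot> f = h \<cdot> f" "src C g = tgt C f" "src C h = tgt C f"
  shows "g = h"
proof -
  have "(g \<cdot> f) \<cdot> inv_arrow C f = (h \<cdot> f) \<cdot> inv_arrow C f" using assms by simp
  then show ?thesis using assms(1,3,4) by (simp add: assoc_cmp)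
qed

lemma iso_cancel_left:
  assumes "iso_arrow C f" "f \<cdot> g = f \<cdot> h" "tgt C g = src C f" "tgt C h = src C f"
  shows "g = h"
proof -
  have "inv_arrow C f \<cdot> (f \<cdot> g) = inv_arrow C f \<cdot> (f \<cdot> h)" using assms by simp
  then show ?thesis using assms(1,3,4) by simp
qed

lemma inv_natural:
  assumes "iso_arrow C a" "iso_arrow C b" "b \<cdot> h = h' \<cdot> a"
    "src C a = src C h" "tgt C h = src C b" "src C h' = tgt C a" "tgt C h' = tgt C b"
  shows "inv_arrow C b \<cdot> h' = h \<cdot> inv_arrow C a"
proof -
  have "inv_arrow C b \<cdot> h' = inv_arrow C b \<cdot> ((h' \<cdot> a) \<cdot> inv_arrow C a)"
    using assms(1,2,4-7) by (simp add: assoc_cmp)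
  also have "\<dots> = inv_arrow C b \<cdot> ((b \<cdot> h) \<cdot> inv_arrow C a)" using assms(3) by simp
  also have "\<dots> = h \<cdot> inv_arrow C a" using assms(1,2,4-7) by (simp add: assoc_cmp)
  finally show ?thesis .
qed

end

context linear_monoidal_category
begin

lemma src_ten [simp]: "src C (f \<otimes>\<^sub>m g) = src C f \<otimes>\<^sub>o src C g"
  and tgt_ten [simp]: "tgt C (f \<otimes>\<^sub>m g) = tgt C f \<otimes>\<^sub>o tgt C g"
  using ten_Hom[of f "src C f" "tgt C f" g "src C g" "tgt C g"] by (simp_all add: Hom_iff)

lemma src_assoc [simp]: "src C (assoc C X Y Z) = (X \<otimes>\<^sub>o Y) \<otimes>\<^sub>o Z"
  and tgt_assoc [simp]: "tgt C (assoc C X Y Z) = X \<otimes>\<^sub>o (Y \<otimes>\<^sub>o Z)"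
  and src_lunit [simp]: "src C (lunit C X) = \<one>\<^sub>o \<otimes>\<^sub>o X" and tgt_lunit [simp]: "tgt C (lunit C X) = X"
  and src_runit [simp]: "src C (runit C X) = X \<otimes>\<^sub>o \<one>\<^sub>o" and tgt_runit [simp]: "tgt C (runit C X) = X"
  using assoc_Hom[of X Y Z] lunit_Hom[of X] runit_Hom[of X] by (simp_all add: Hom_iff)

declare assoc_iso [simp] lunit_iso [simp] runit_iso [simp] ten_id [simp]

lemma ten_cmp': "\<lbrakk>src C f' = tgt C f; src C g' = tgt C g\<rbrakk> \<Longrightarrow>
    (f' \<otimes>\<^sub>m g') \<cdot> (f \<otimes>\<^sub>m g) = (f' \<cdot> f) \<otimes>\<^sub>m (g' \<cdot> g)"
  using ten_cmp[of f "src C f" "tgt C f" f' "tgt C f'" g "src C g" "tgt C g" g' "tgt C g'"]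
  by (simp add: Hom_iff)

lemma assoc_nat: "assoc C (tgt C f) (tgt C g) (tgt C h) \<cdot> ((f \<otimes>\<^sub>m g) \<otimes>\<^sub>m h) =
    (f \<otimes>\<^sub>m (g \<otimes>\<^sub>m h)) \<cdot> assoc C (src C f) (src C g) (src C h)"
  by (rule assoc_natural) (simp_all add: Hom_iff)

lemma lunit_nat: "lunit C (tgt C f) \<cdot> (idm C \<one>\<^sub>o \<otimes>\<^sub>m f) = f \<cdot> lunit C (src C f)"
  by (rule lunit_natural) (simp add: Hom_iff)

lemma runit_nat: "runit C (tgt C f) \<cdot> (f \<otimes>\<^sub>m idm C \<one>\<^sub>o) = f \<cdot> runit C (src C f)"
  by (rule runit_natural) (simp add: Hom_iff)

lemma iso_ten [simp]: "\<lbrakk>iso_arrow C f; iso_arrow C g\<rbrakk> \<Longrightarrow> iso_arrow C (f \<otimes>\<^sub>m g)"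
  by (rule isoI(1)[of "inv_arrow C f \<otimes>\<^sub>m inv_arrow C g"]) (simp_all add: ten_cmp')

lemma inv_ten [simp]: "\<lbrakk>iso_arrow C f; iso_arrow C g\<rbrakk> \<Longrightarrow>
    inv_arrow C (f \<otimes>\<^sub>m g) = inv_arrow C f \<otimes>\<^sub>m inv_arrow C g"
  by (rule isoI(2)) (simp_all add: ten_cmp')

lemma unit_ten_faithful:
  assumes "idm C \<one>\<^sub>o \<otimes>\<^sub>m f = idm C \<one>\<^sub>o \<otimes>\<^sub>m g" "src C f = src C g" "tgt C f = tgt C g"
  shows "f = g"
proof (rule iso_cancel_right)
  show "f \<cdot> lunit C (src C f) = g \<cdot> lunit C (src C f)"
    using lunit_nat[of f] lunit_nat[of g] unfolding assms by simp
qed (simp_all add: assms(2))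

lemma ten_unit_faithful:
  assumes "f \<otimes>\<^sub>m idm C \<one>\<^sub>o = g \<otimes>\<^sub>m idm C \<one>\<^sub>o" "src C f = src C g" "tgt C f = tgt C g"
  shows "f = g"
proof (rule iso_cancel_right)
  show "f \<cdot> runit C (src C f) = g \<cdot> runit C (src C f)"
    using runit_nat[of f] runit_nat[of g] unfolding assms by simp
qed (simp_all add: assms(2))

text \<open>Kelly's lemma.  Both sides may be compared after tensoring with the unit object on the left, which is
  faithful, and after composing with an isomorphism made of associators.  The pentagon then turns the
  claim into two instances of the triangle.\<close>

lemma lunit_ten: "lunit C (A \<otimes>\<^sub>o B) \<cdot> assoc C \<one>\<^sub>o A B = lunit C A \<otimes>\<^sub>m idm C B"
proof (rule unit_ten_faithful)
  let ?i = "idm C \<one>\<^sub>o" and ?a = "assoc C" and ?I = "\<one>\<^sub>o"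
  \<comment> \<open>the isomorphism that is cancelled at the end\<close>
  let ?q = "?a ?I (?I \<otimes>\<^sub>o A) B \<cdot> (?a ?I ?I A \<otimes>\<^sub>m idm C B)"
  have "(?i \<otimes>\<^sub>m (lunit C (A \<otimes>\<^sub>o B) \<cdot> ?a ?I A B)) \<cdot> ?q =
    (?i \<otimes>\<^sub>m lunit C (A \<otimes>\<^sub>o B)) \<cdot> ((?i \<otimes>\<^sub>m ?a ?I A B) \<cdot> ?a ?I (?I \<otimes>\<^sub>o A) B \<cdot> (?a ?I ?I A \<otimes>\<^sub>m idm C B))"
    by (simp add: assoc_cmp cmp_reduce[OF ten_cmp'])
  also have "\<dots> = (?i \<otimes>\<^sub>m lunit C (A \<otimes>\<^sub>o B)) \<cdot> (?a ?I ?I (A \<otimes>\<^sub>o B) \<cdot> ?a (?I \<otimes>\<^sub>o ?I) A B)"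
    by (simp add: pentagon)
  also have "\<dots> = (runit C ?I \<otimes>\<^sub>m (idm C A \<otimes>\<^sub>m idm C B)) \<cdot> ?a (?I \<otimes>\<^sub>o ?I) A B"
    using cmp_reduce[OF triangle[of "?I" "A \<otimes>\<^sub>o B"], of "?a (?I \<otimes>\<^sub>o ?I) A B"] by simp
  also have "\<dots> = ?a ?I A B \<cdot> ((runit C ?I \<otimes>\<^sub>m idm C A) \<otimes>\<^sub>m idm C B)"
    using assoc_nat[of "runit C ?I" "idm C A" "idm C B"] by simp
  also have "\<dots> = ?a ?I A B \<cdot> (((?i \<otimes>\<^sub>m lunit C A) \<otimes>\<^sub>m idm C B) \<cdot> (?a ?I ?I A \<otimes>\<^sub>m idm C B))"
    by (simp add: ten_cmp' triangle)
  also have "\<dots> = (?i \<otimes>\<^sub>m (lunit C A \<otimes>\<^sub>m idm C B)) \<cdot> ?q"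
    using assoc_nat[of ?i "lunit C A" "idm C B"]
      cmp_reduce[of "?a ?I A B" "(?i \<otimes>\<^sub>m lunit C A) \<otimes>\<^sub>m idm C B" _ "?a ?I ?I A \<otimes>\<^sub>m idm C B"]
    by (simp add: assoc_cmp)
  finally show "?i \<otimes>\<^sub>m (lunit C (A \<otimes>\<^sub>o B) \<cdot> ?a ?I A B) = ?i \<otimes>\<^sub>m (lunit C A \<otimes>\<^sub>m idm C B)"
    by (rule iso_cancel_right[rotated]) auto
qed auto

end

section \<open>Strictification\<close>

text \<open>A word $X_1 \ldots X_n$ acts on objects by $W \mapsto X_1 \otimes (\cdots \otimes (X_n \otimes W))$.
  Concatenation of words is composition of these functors and therefore strictly associative and unital,
  whatever the associators are.  The arrows of the strict category are natural transformations between
  such functors; they carry their words, which cannot be recovered from the components.\<close>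

datatype ('o, 'm) family = Family (fdom: "'o list") (fcod: "'o list") (fam: "'o \<Rightarrow> 'm")

lemma family_eqI: "\<lbrakk>fdom f = fdom g; fcod f = fcod g; \<And>W. fam f W = fam g W\<rbrakk> \<Longrightarrow> f = g"
  by (rule family.expand) auto

context linear_monoidal_category
begin

definition actO :: "'o list \<Rightarrow> 'o \<Rightarrow> 'o" where
  "actO u W = foldr (tenO C) u W"

definition actM :: "'o list \<Rightarrow> 'm \<Rightarrow> 'm" where
  "actM u g = foldr (\<lambda>X. tenM C (idm C X)) u g"

lemma actO_simps [simp]: "actO [] W = W" "actO (X # u) W = X \<otimes>\<^sub>o actO u W" "actO (u @ v) W = actO u (actO v W)"
  by (simp_all add: actO_def)

lemma actM_simps [simp]: "actM [] g = g" "actM (X # u) g = idm C X \<otimes>\<^sub>m actM u g" "actM (u @ v) g = actM u (actM v g)"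
  by (simp_all add: actM_def)

lemma src_actM [simp]: "src C (actM u g) = actO u (src C g)"
  and tgt_actM [simp]: "tgt C (actM u g) = actO u (tgt C g)"
  by (induct u) auto

lemma actM_id [simp]: "actM u (idm C W) = idm C (actO u W)"
  by (induct u) auto

lemma actM_cmp: "src C g = tgt C f \<Longrightarrow> actM u (g \<cdot> f) = actM u g \<cdot> actM u f"
  by (induct u) (auto simp: ten_cmp')

definition natural :: "('o, 'm) family \<Rightarrow> bool" where
  "natural f \<longleftrightarrow> (\<forall>W. src C (fam f W) = actO (fdom f) W \<and> tgt C (fam f W) = actO (fcod f) W) \<and>
    (\<forall>g. fam f (tgt C g) \<cdot> actM (fdom f) g = actM (fcod f) g \<cdot> fam f (src C g))"

lemma naturalD:
  "natural f \<Longrightarrow> src C (fam f W) = actO (fdom f) W"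
  "natural f \<Longrightarrow> tgt C (fam f W) = actO (fcod f) W"
  "natural f \<Longrightarrow> fam f (tgt C g) \<cdot> actM (fdom f) g = actM (fcod f) g \<cdot> fam f (src C g)"
  by (auto simp: natural_def)

definition fcomp :: "('o, 'm) family \<Rightarrow> ('o, 'm) family \<Rightarrow> ('o, 'm) family"  (infixr "\<star>" 60) where
  "g \<star> f = Family (fdom f) (fcod g) (\<lambda>W. fam g W \<cdot> fam f W)"

definition fid :: "'o list \<Rightarrow> ('o, 'm) family" where
  "fid u = Family u u (\<lambda>W. idm C (actO u W))"

definition fwhisk :: "'o list \<Rightarrow> ('o, 'm) family \<Rightarrow> 'o list \<Rightarrow> ('o, 'm) family"  ("_ \<triangleright> _ \<triangleleft> _" [76, 75, 76] 75) where
  "u \<triangleright> f \<triangleleft> v = Family (u @ fdom f @ v) (u @ fcod f @ v) (\<lambda>W. actM u (fam f (actO v W)))"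

lemma natural_fcomp:
  assumes "natural f" "natural g" "fdom g = fcod f"
  shows "natural (g \<star> f)"
  unfolding natural_def
proof (intro conjI allI)
  note [simp] = naturalD(1,2)[OF assms(1)] naturalD(1,2)[OF assms(2)]
  fix h
  have "fam g (tgt C h) \<cdot> (fam f (tgt C h) \<cdot> actM (fdom f) h) = fam g (tgt C h) \<cdot> (actM (fdom g) h \<cdot> fam f (src C h))"
    using naturalD(3)[OF assms(1)] assms(3) by simp
  also have "\<dots> = actM (fcod g) h \<cdot> fam g (src C h) \<cdot> fam f (src C h)"
    using cmp_reduce[OF naturalD(3)[OF assms(2), of h], of "fam f (src C h)"] assms(3) by (simp add: assoc_cmp)
  finally show "fam (g \<star> f) (tgt C h) \<cdot> actM (fdom (g \<star> f)) h = actM (fcod (g \<star> f)) h \<cdot> fam (g \<star> f) (src C h)"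
    using assms(3) by (simp add: fcomp_def assoc_cmp)
qed (simp_all add: fcomp_def naturalD(1,2)[OF assms(1)] naturalD(1,2)[OF assms(2)] assms(3))

lemma natural_fwhisk:
  assumes "natural f"
  shows "natural (u \<triangleright> f \<triangleleft> v)"
  unfolding natural_def
proof (intro conjI allI)
  note [simp] = naturalD(1,2)[OF assms(1)]
  fix h
  have "actM u (fam f (actO v (tgt C h))) \<cdot> actM u (actM (fdom f) (actM v h)) =
    actM u (actM (fcod f) (actM v h)) \<cdot> actM u (fam f (actO v (src C h)))"
    using naturalD(3)[OF assms, of "actM v h"] by (simp add: actM_cmp[symmetric])
  then show "fam (u \<triangleright> f \<triangleleft> v) (tgt C h) \<cdot> actM (fdom (u \<triangleright> f \<triangleleft> v)) h
      = actM (fcod (u \<triangleright> f \<triangleleft> v)) h \<cdot> fam (u \<triangleright> f \<triangleleft> v) (src C h)"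
    by (simp add: fwhisk_def)
qed (simp_all add: fwhisk_def naturalD(1,2)[OF assms(1)])

text \<open>Naturality of \<open>f\<close> at the component of $v \triangleright g \triangleleft w$.\<close>

lemma family_interchange:
  assumes "natural f" "natural g"
  shows "(u \<triangleright> f \<triangleleft> (v @ fcod g @ w)) \<star> ((u @ fdom f @ v) \<triangleright> g \<triangleleft> w) =
      ((u @ fcod f @ v) \<triangleright> g \<triangleleft> w) \<star> (u \<triangleright> f \<triangleleft> (v @ fdom g @ w))"
proof (rule family_eqI)
  note [simp] = naturalD(1,2)[OF assms(1)] naturalD(1,2)[OF assms(2)]
  fix W
  let ?g = "actM v (fam g (actO w W))"
  have "fam f (tgt C ?g) \<cdot> actM (fdom f) ?g = actM (fcod f) ?g \<cdot> fam f (src C ?g)"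
    by (rule naturalD(3)[OF assms(1)])
  then show "fam ((u \<triangleright> f \<triangleleft> (v @ fcod g @ w)) \<star> ((u @ fdom f @ v) \<triangleright> g \<triangleleft> w)) W =
    fam (((u @ fcod f @ v) \<triangleright> g \<triangleleft> w) \<star> (u \<triangleright> f \<triangleleft> (v @ fdom g @ w))) W"
    by (simp add: fcomp_def fwhisk_def actM_cmp[symmetric])
qed (simp_all add: fcomp_def fwhisk_def)

lemma fwhisk_fcomp:
  assumes "natural f" "natural g" "fdom g = fcod f"
  shows "u \<triangleright> (g \<star> f) \<triangleleft> v = (u \<triangleright> g \<triangleleft> v) \<star> (u \<triangleright> f \<triangleleft> v)"
  using assms(3)
  by (intro family_eqI) (simp_all add: fcomp_def fwhisk_def actM_cmp naturalD(1,2)[OF assms(1)] naturalD(1,2)[OF assms(2)])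

lemma fcomp_assoc:
  assumes "natural f" "natural g" "natural h" "fdom g = fcod f" "fdom h = fcod g"
  shows "(h \<star> g) \<star> f = h \<star> g \<star> f"
  using assms(4,5)
  by (intro family_eqI) (simp_all add: fcomp_def assoc_cmp naturalD(1,2)[OF assms(1)] naturalD(1,2)[OF assms(2)] naturalD(1,2)[OF assms(3)])

lemma natural_fid: "natural (fid u)"
  by (simp add: natural_def fid_def)

lemma fcomp_fid:
  assumes "natural f"
  shows "fcod f = u \<Longrightarrow> fid u \<star> f = f" "fdom f = u \<Longrightarrow> f \<star> fid u = f"
  by (auto intro!: family_eqI simp: fid_def fcomp_def naturalD(1,2)[OF assms(1)])

lemma strict_whiskered: "whiskered_category natural fdom fcod fcomp fid fwhisk"
  apply (rule whiskered_category.intro)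
  apply (rule natural_fid)
  apply (simp add: fid_def)
  apply (simp add: fid_def)
  apply (erule (2) natural_fcomp)
  apply (simp add: fcomp_def)
  apply (simp add: fcomp_def)
  apply (erule natural_fwhisk)
  apply (simp add: fwhisk_def)
  apply (simp add: fwhisk_def)
  apply (erule (4) fcomp_assoc)
  apply (erule (1) fcomp_fid)
  apply (erule (1) fcomp_fid)
  apply (erule (2) fwhisk_fcomp)
  apply (rule family_eqI; simp add: fwhisk_def)
  apply (rule family_eqI; simp add: fwhisk_def)
  apply (rule family_eqI; simp add: fwhisk_def fid_def)
  apply (erule (1) family_interchange)
  done

sublocale strict: whiskered_category natural fdom fcod fcomp fid fwhisk
  by (rule strict_whiskered)

end

section \<open>Translation into string diagrams\<close>

context linear_monoidal_category
begin

text \<open>The category embeds by $f \mapsto f \otimes -$.  The words $[A, B]$ and $[A \otimes B]$ are different, and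
  so are $[\,]$ and $[\mathbf{1}]$; the isomorphisms between them are \<open>fuse\<close>, \<open>split\<close> and
  \<open>ins\<close>, \<open>del\<close>.\<close>

definition emb :: "'m \<Rightarrow> ('o, 'm) family" where
  "emb f = Family [src C f] [tgt C f] (\<lambda>W. f \<otimes>\<^sub>m idm C W)"

definition fuse :: "'o \<Rightarrow> 'o \<Rightarrow> ('o, 'm) family" where
  "fuse A B = Family [A, B] [A \<otimes>\<^sub>o B] (\<lambda>W. inv_arrow C (assoc C A B W))"

definition split :: "'o \<Rightarrow> 'o \<Rightarrow> ('o, 'm) family" where
  "split A B = Family [A \<otimes>\<^sub>o B] [A, B] (\<lambda>W. assoc C A B W)"

definition ins :: "('o, 'm) family" where
  "ins = Family [] [\<one>\<^sub>o] (\<lambda>W. inv_arrow C (lunit C W))"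

definition del :: "('o, 'm) family" where
  "del = Family [\<one>\<^sub>o] [] (\<lambda>W. lunit C W)"

lemma family_ends [simp]:
  "fdom (emb f) = [src C f]" "fcod (emb f) = [tgt C f]"
  "fdom (fuse A B) = [A, B]" "fcod (fuse A B) = [A \<otimes>\<^sub>o B]"
  "fdom (split A B) = [A \<otimes>\<^sub>o B]" "fcod (split A B) = [A, B]"
  "fdom ins = []" "fcod ins = [\<one>\<^sub>o]" "fdom del = [\<one>\<^sub>o]" "fcod del = []"
  by (simp_all add: emb_def fuse_def split_def ins_def del_def)

lemma inv_assoc_nat:
  "inv_arrow C (assoc C (tgt C f) (tgt C g) (tgt C h)) \<cdot> (f \<otimes>\<^sub>m (g \<otimes>\<^sub>m h)) =
    ((f \<otimes>\<^sub>m g) \<otimes>\<^sub>m h) \<cdot> inv_arrow C (assoc C (src C f) (src C g) (src C h))"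
  by (rule inv_natural[OF _ _ assoc_nat]) simp_all

lemma inv_lunit_nat:
  "inv_arrow C (lunit C (tgt C f)) \<cdot> f = (idm C \<one>\<^sub>o \<otimes>\<^sub>m f) \<cdot> inv_arrow C (lunit C (src C f))"
  by (rule inv_natural[OF _ _ lunit_nat]) simp_all

lemma natural_atoms [simp]:
  "natural (emb f)" "natural (fuse A B)" "natural (split A B)" "natural ins" "natural del"
proof -
  show "natural (emb f)"
    by (simp add: natural_def emb_def ten_cmp')
  show "natural (fuse A B)"
    using inv_assoc_nat[of "idm C A" "idm C B"] by (simp add: natural_def fuse_def)
  show "natural (split A B)"
    using assoc_nat[of "idm C A" "idm C B"] by (simp add: natural_def split_def)
  show "natural ins" by (simp add: natural_def ins_def inv_lunit_nat)
  show "natural del" by (simp add: natural_def del_def lunit_nat)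
qed

lemma emb_id [simp]: "emb (idm C X) = fid [X]"
  by (intro family_eqI) (simp_all add: emb_def fid_def)

lemma emb_cmp [simp]: "src C g = tgt C f \<Longrightarrow> emb (g \<cdot> f) = emb g \<star> emb f"
  by (intro family_eqI) (simp_all add: emb_def fcomp_def ten_cmp')

lemma emb_inj:
  assumes "emb f = emb g"
  shows "f = g"
proof (rule ten_unit_faithful)
  show "f \<otimes>\<^sub>m idm C \<one>\<^sub>o = g \<otimes>\<^sub>m idm C \<one>\<^sub>o"
    using arg_cong[OF assms, of "\<lambda>x. fam x \<one>\<^sub>o"] by (simp add: emb_def)
  show "src C f = src C g" "tgt C f = tgt C g"
    using arg_cong[OF assms, of fdom] arg_cong[OF assms, of fcod] by simp_all
qed

lemma split_fuse [simp]: "split A B \<star> fuse A B = fid [A, B]"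
  and fuse_split [simp]: "fuse A B \<star> split A B = fid [A \<otimes>\<^sub>o B]"
  and del_ins [simp]: "del \<star> ins = fid []"
  and ins_del [simp]: "ins \<star> del = fid [\<one>\<^sub>o]"
  by (intro family_eqI; simp add: split_def fuse_def ins_def del_def fcomp_def fid_def)+

lemma whisk_cancel [simp]:
  "(u \<triangleright> split A B \<triangleleft> v) \<star> (u \<triangleright> fuse A B \<triangleleft> v) = fid (u @ A # B # v)"
  "(u \<triangleright> fuse A B \<triangleleft> v) \<star> (u \<triangleright> split A B \<triangleleft> v) = fid (u @ (A \<otimes>\<^sub>o B) # v)"
  "(u \<triangleright> del \<triangleleft> v) \<star> (u \<triangleright> ins \<triangleleft> v) = fid (u @ v)"
  "(u \<triangleright> ins \<triangleleft> v) \<star> (u \<triangleright> del \<triangleleft> v) = fid (u @ \<one>\<^sub>o # v)"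
  using strict.whisk_eq[OF split_fuse, of A B u v] strict.whisk_eq[OF fuse_split, of A B u v]
    strict.whisk_eq[OF del_ins, of u v] strict.whisk_eq[OF ins_del, of u v] by simp_all

lemma reduce_cancel [simp]:
  assumes "natural h"
  shows "fcod h = [A, B] \<Longrightarrow> split A B \<star> fuse A B \<star> h = h"
    "fcod h = [A \<otimes>\<^sub>o B] \<Longrightarrow> fuse A B \<star> split A B \<star> h = h"
    "fcod h = [] \<Longrightarrow> del \<star> ins \<star> h = h"
    "fcod h = [\<one>\<^sub>o] \<Longrightarrow> ins \<star> del \<star> h = h"
    "fcod h = u @ A # B # v \<Longrightarrow> (u \<triangleright> split A B \<triangleleft> v) \<star> (u \<triangleright> fuse A B \<triangleleft> v) \<star> h = h"
    "fcod h = u @ (A \<otimes>\<^sub>o B) # v \<Longrightarrow> (u \<triangleright> fuse A B \<triangleleft> v) \<star> (u \<triangleright> split A B \<triangleleft> v) \<star> h = h"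
    "fcod h = u @ v \<Longrightarrow> (u \<triangleright> del \<triangleleft> v) \<star> (u \<triangleright> ins \<triangleleft> v) \<star> h = h"
    "fcod h = u @ \<one>\<^sub>o # v \<Longrightarrow> (u \<triangleright> ins \<triangleleft> v) \<star> (u \<triangleright> del \<triangleleft> v) \<star> h = h"
  by (simp_all add: assms strict.reduce[OF split_fuse] strict.reduce[OF fuse_split] strict.reduce[OF del_ins]
    strict.reduce[OF ins_del] strict.reduce[OF whisk_cancel(1)] strict.reduce[OF whisk_cancel(2)]
    strict.reduce[OF whisk_cancel(3)] strict.reduce[OF whisk_cancel(4)])

text \<open>This lemma and the following ones compute \<open>emb\<close> on every expression built from the monoidal
  structure.  Associators (by the pentagon) and unit constraints (by Kelly's lemma and the triangle) become
  composites of \<open>fuse\<close>, \<open>split\<close>, \<open>ins\<close> and \<open>del\<close>, which cancel between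
  neighbouring factors.  Thus simplification turns an arrow of the category into its string diagram.\<close>

lemma emb_ten [simp]: "emb (f \<otimes>\<^sub>m g) =
  fuse (tgt C f) (tgt C g) \<star> ([] \<triangleright> emb f \<triangleleft> [tgt C g]) \<star> ([src C f] \<triangleright> emb g \<triangleleft> []) \<star> split (src C f) (src C g)"
proof (rule family_eqI)
  fix W
  let ?i = "idm C W"
  have "(f \<otimes>\<^sub>m g) \<otimes>\<^sub>m ?i = inv_arrow C (assoc C (tgt C f) (tgt C g) W) \<cdot>
      (assoc C (tgt C f) (tgt C g) W \<cdot> ((f \<otimes>\<^sub>m g) \<otimes>\<^sub>m ?i))"
    by simp
  also have "\<dots> = inv_arrow C (assoc C (tgt C f) (tgt C g) W) \<cdot> (f \<otimes>\<^sub>m (g \<otimes>\<^sub>m ?i)) \<cdot> assoc C (src C f) (src C g) W"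
    using assoc_nat[of f g ?i] by (simp add: assoc_cmp)
  also have "f \<otimes>\<^sub>m (g \<otimes>\<^sub>m ?i) = (f \<otimes>\<^sub>m idm C (tgt C g \<otimes>\<^sub>o W)) \<cdot> (idm C (src C f) \<otimes>\<^sub>m (g \<otimes>\<^sub>m ?i))"
    by (simp add: ten_cmp')
  finally show "fam (emb (f \<otimes>\<^sub>m g)) W = fam (fuse (tgt C f) (tgt C g) \<star> ([] \<triangleright> emb f \<triangleleft> [tgt C g]) \<star>
    ([src C f] \<triangleright> emb g \<triangleleft> []) \<star> split (src C f) (src C g)) W"
    by (simp add: emb_def fuse_def split_def fcomp_def fwhisk_def assoc_cmp)
qed simp_all

lemma emb_assoc [simp]: "emb (assoc C A B D) =
  fuse A (B \<otimes>\<^sub>o D) \<star> ([A] \<triangleright> fuse B D \<triangleleft> []) \<star> ([] \<triangleright> split A B \<triangleleft> [D]) \<star> split (A \<otimes>\<^sub>o B) D"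
proof (rule family_eqI)
  fix W
  have "assoc C A B (D \<otimes>\<^sub>o W) \<cdot> assoc C (A \<otimes>\<^sub>o B) D W =
    (idm C A \<otimes>\<^sub>m assoc C B D W) \<cdot> (assoc C A (B \<otimes>\<^sub>o D) W \<cdot> (assoc C A B D \<otimes>\<^sub>m idm C W))"
    using pentagon[of A B D W] by (simp add: assoc_cmp)
  then have "assoc C A B D \<otimes>\<^sub>m idm C W = inv_arrow C (assoc C A (B \<otimes>\<^sub>o D) W) \<cdot>
    (inv_arrow C (idm C A \<otimes>\<^sub>m assoc C B D W) \<cdot> (assoc C A B (D \<otimes>\<^sub>o W) \<cdot> assoc C (A \<otimes>\<^sub>o B) D W))"
    by (simp del: inv_ten)
  moreover have "inv_arrow C (idm C A) = idm C A"
    by (rule isoI(2)) simp_all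
  ultimately show "fam (emb (assoc C A B D)) W = fam (fuse A (B \<otimes>\<^sub>o D) \<star> ([A] \<triangleright> fuse B D \<triangleleft> []) \<star>
    ([] \<triangleright> split A B \<triangleleft> [D]) \<star> split (A \<otimes>\<^sub>o B) D) W"
    by (simp add: emb_def fuse_def split_def fcomp_def fwhisk_def)
qed simp_all

lemma emb_lunit [simp]: "emb (lunit C A) = ([] \<triangleright> del \<triangleleft> [A]) \<star> split \<one>\<^sub>o A"
  by (rule family_eqI) (simp_all add: emb_def del_def split_def fcomp_def fwhisk_def lunit_ten)

lemma emb_runit [simp]: "emb (runit C A) = ([A] \<triangleright> del \<triangleleft> []) \<star> split A \<one>\<^sub>o"
  by (rule family_eqI) (simp_all add: emb_def del_def split_def fcomp_def fwhisk_def triangle)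

text \<open>The inverse of a coherence isomorphism is found by guessing its diagram and checking one composite.\<close>

lemma emb_inv_eqI:
  assumes "iso_arrow C f" "natural g" "fdom g = [tgt C f]" "fcod g = [src C f]" "emb f \<star> g = fid [tgt C f]"
  shows "emb (inv_arrow C f) = g"
proof -
  have "emb (inv_arrow C f) = emb (inv_arrow C f) \<star> (emb f \<star> g)"
    using assms by simp
  also have "\<dots> = emb (inv_arrow C f \<cdot> f) \<star> g"
    using assms(1-4) by (simp del: inv_cmp)
  also have "\<dots> = g" using assms by simp
  finally show ?thesis .
qed

lemma emb_inv_assoc [simp]: "emb (inv_arrow C (assoc C A B D)) =
  fuse (A \<otimes>\<^sub>o B) D \<star> ([] \<triangleright> fuse A B \<triangleleft> [D]) \<star> ([A] \<triangleright> split B D \<triangleleft> []) \<star> split A (B \<otimes>\<^sub>o D)"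
  by (rule emb_inv_eqI) simp_all

lemma emb_inv_lunit [simp]: "emb (inv_arrow C (lunit C A)) = fuse \<one>\<^sub>o A \<star> ([] \<triangleright> ins \<triangleleft> [A])"
  by (rule emb_inv_eqI) simp_all

lemma emb_inv_runit [simp]: "emb (inv_arrow C (runit C A)) = fuse A \<one>\<^sub>o \<star> ([A] \<triangleright> ins \<triangleleft> [])"
  by (rule emb_inv_eqI) simp_all

end

context fusion_category
begin

text \<open>Cap and cup of an object, as arrows between words without the unit object.\<close>

definition evs :: "'o \<Rightarrow> ('o, 'm) family" where
  "evs X = del \<star> emb (ev C X) \<star> fuse (dualO C X) X"

definition coevs :: "'o \<Rightarrow> ('o, 'm) family" where
  "coevs X = split X (dualO C X) \<star> emb (coev C X) \<star> ins"

lemma src_ev [simp]: "src C (ev C X) = dualO C X \<otimes>\<^sub>o X" and tgt_ev [simp]: "tgt C (ev C X) = \<one>\<^sub>o"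
  and src_coev [simp]: "src C (coev C X) = \<one>\<^sub>o" and tgt_coev [simp]: "tgt C (coev C X) = X \<otimes>\<^sub>o dualO C X"
  using dual[of X] by (simp_all add: left_dual_def Hom_iff)

lemma dual_pair_evs: "strict.dual_pair [X] [dualO C X] (evs X) (coevs X)"
proof -
  let ?D = "dualO C X"
  have z: "runit C X \<cdot> (idm C X \<otimes>\<^sub>m ev C X) \<cdot> assoc C X ?D X \<cdot> (coev C X \<otimes>\<^sub>m idm C X) \<cdot> inv_arrow C (lunit C X) = idm C X"
    "lunit C ?D \<cdot> (ev C X \<otimes>\<^sub>m idm C ?D) \<cdot> inv_arrow C (assoc C ?D X ?D) \<cdot> (idm C ?D \<otimes>\<^sub>m coev C X)
       \<cdot> inv_arrow C (runit C ?D) = idm C ?D"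
    using dual[of X] by (simp_all add: left_dual_def)
  have "([X] \<triangleright> evs X \<triangleleft> []) \<star> ([] \<triangleright> coevs X \<triangleleft> [X]) = fid [X]"
    using arg_cong[OF z(1), of emb] by (simp add: evs_def coevs_def)
  moreover have "([] \<triangleright> evs X \<triangleleft> [?D]) \<star> ([?D] \<triangleright> coevs X \<triangleleft> []) = fid [?D]"
    using arg_cong[OF z(2), of emb] by (simp add: evs_def coevs_def)
  ultimately show ?thesis
    by (auto simp: strict.dual_pair_def evs_def coevs_def intro!: strict.homI)
qed

lemma evs_arr [simp]: "natural (evs X)" "fdom (evs X) = [dualO C X, X]" "fcod (evs X) = []"
  "natural (coevs X)" "fdom (coevs X) = []" "fcod (coevs X) = [X, dualO C X]"
  by (simp_all add: evs_def coevs_def)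

definition pairing :: "'o \<Rightarrow> 'o \<Rightarrow> 'm \<Rightarrow> ('o, 'm) family" where
  "pairing Z W e = del \<star> emb e \<star> fuse Z W"

lemma pairing_arr [simp]:
  assumes "e \<in> Hom C (Z \<otimes>\<^sub>o W) \<one>\<^sub>o"
  shows "natural (pairing Z W e)" "fdom (pairing Z W e) = [Z, W]" "fcod (pairing Z W e) = []"
  using assms by (simp_all add: pairing_def Hom_iff)

lemma emb_mate:
  assumes "e \<in> Hom C (Z \<otimes>\<^sub>o W) \<one>\<^sub>o"
  shows "emb (mate C Z W e) = strict.mate [Z] [dualO C W] (coevs W) (pairing Z W e)"
  using assms by (simp add: Hom_iff mate_def strict.mate_def pairing_def coevs_def)

lemma mate_ends [simp]:
  assumes "e \<in> Hom C (Z \<otimes>\<^sub>o W) \<one>\<^sub>o"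
  shows "src C (mate C Z W e) = Z" "tgt C (mate C Z W e) = dualO C W"
  using assms by (simp_all add: mate_def Hom_iff)

lemma dualM_pairing_Hom: "ev C (tgt C f) \<cdot> (idm C (dualO C (tgt C f)) \<otimes>\<^sub>m f) \<in> Hom C (dualO C (tgt C f) \<otimes>\<^sub>o src C f) \<one>\<^sub>o"
  by (simp add: Hom_iff)

lemma dualM_ends [simp]: "src C (dualM C f) = dualO C (tgt C f)" "tgt C (dualM C f) = dualO C (src C f)"
  unfolding dualM_def using mate_ends[OF dualM_pairing_Hom] by simp_all

lemma emb_dualM: "emb (dualM C f) =
  strict.dual_map [dualO C (tgt C f)] [dualO C (src C f)] (coevs (src C f)) (evs (tgt C f)) (emb f)"
  unfolding dualM_def strict.dual_map_def emb_mate[OF dualM_pairing_Hom]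
  by (simp add: pairing_def evs_def)

lemma dual_ten_pairing_Hom:
  "ev C Y \<cdot> (idm C (dualO C Y) \<otimes>\<^sub>m
        (lunit C Y \<cdot> (ev C X \<otimes>\<^sub>m idm C Y) \<cdot> inv_arrow C (assoc C (dualO C X) X Y)))
      \<cdot> assoc C (dualO C Y) (dualO C X) (X \<otimes>\<^sub>o Y) \<in> Hom C ((dualO C Y \<otimes>\<^sub>o dualO C X) \<otimes>\<^sub>o (X \<otimes>\<^sub>o Y)) \<one>\<^sub>o"
  by (simp add: Hom_iff)

lemma dual_ten_ends [simp]:
  "src C (dual_ten C X Y) = dualO C Y \<otimes>\<^sub>o dualO C X" "tgt C (dual_ten C X Y) = dualO C (X \<otimes>\<^sub>o Y)"
  unfolding dual_ten_def using mate_ends[OF dual_ten_pairing_Hom] by simp_all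

abbreviation ev2 :: "'o \<Rightarrow> 'o \<Rightarrow> ('o, 'm) family" where
  "ev2 X Y \<equiv> strict.nested_ev [dualO C Y] [Y] (evs Y) (evs X)"

abbreviation coev2 :: "'o \<Rightarrow> 'o \<Rightarrow> ('o, 'm) family" where
  "coev2 X Y \<equiv> strict.nested_coev [X] [dualO C X] (coevs X) (coevs Y)"

lemma dual_pair_ev2: "strict.dual_pair [X, Y] [dualO C Y, dualO C X] (ev2 X Y) (coev2 X Y)"
  using strict.dual_pair_nested[OF dual_pair_evs[of X] dual_pair_evs[of Y]] by simp

text \<open>The isomorphism $Y^* \otimes X^* \to (X \otimes Y)^*$ is bent from the nested caps of $X$ and $Y$.\<close>

lemma emb_dual_ten: "emb (dual_ten C X Y) = strict.mate [dualO C Y \<otimes>\<^sub>o dualO C X] [dualO C (X \<otimes>\<^sub>o Y)]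
   (coevs (X \<otimes>\<^sub>o Y)) (ev2 X Y \<star> ([] \<triangleright> split (dualO C Y) (dualO C X) \<triangleleft> [X, Y]) \<star> ([dualO C Y \<otimes>\<^sub>o dualO C X] \<triangleright> split X Y \<triangleleft> []))"
proof -
  have "pairing (dualO C Y \<otimes>\<^sub>o dualO C X) (X \<otimes>\<^sub>o Y) (ev C Y \<cdot> (idm C (dualO C Y) \<otimes>\<^sub>m
        (lunit C Y \<cdot> (ev C X \<otimes>\<^sub>m idm C Y) \<cdot> inv_arrow C (assoc C (dualO C X) X Y)))
      \<cdot> assoc C (dualO C Y) (dualO C X) (X \<otimes>\<^sub>o Y))
   = ev2 X Y \<star> ([dualO C Y, dualO C X] \<triangleright> split X Y \<triangleleft> []) \<star> ([] \<triangleright> split (dualO C Y) (dualO C X) \<triangleleft> [X \<otimes>\<^sub>o Y])"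
    by (simp add: pairing_def evs_def strict.nested_ev_def)
  also have "\<dots> = ev2 X Y \<star> ([] \<triangleright> split (dualO C Y) (dualO C X) \<triangleleft> [X, Y]) \<star> ([dualO C Y \<otimes>\<^sub>o dualO C X] \<triangleright> split X Y \<triangleleft> [])"
    using strict.interchange[of "split (dualO C Y) (dualO C X)" "split X Y" "[]" "[]" "[]"] by simp
  finally show ?thesis
    unfolding dual_ten_def emb_mate[OF dual_ten_pairing_Hom] by simp
qed

end

section \<open>Pivotal traces\<close>

context linear_category
begin

lemma hom_module_simps [simp]:
  "carrier (hom_space C X Y) = Hom C X Y" "add (hom_space C X Y) = plusm C"
  "ring.zero (hom_space C X Y) = zerom C X Y" "module.smult (hom_space C X Y) = scale C"
  by (simp_all add: hom_space_def)

lemma scale_Hom: "f \<in> Hom C X Y \<Longrightarrow> scale C a f \<in> Hom C X Y"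
  using module.smult_closed[OF hom_module, of a f X Y] by (simp add: complex_ring_def)

lemma scale_ends [simp]: "src C (scale C a f) = src C f" "tgt C (scale C a f) = tgt C f"
  using scale_Hom[of f "src C f" "tgt C f" a] by (simp_all add: Hom_iff)

lemma scale_cmp [simp]: "src C g = tgt C f \<Longrightarrow> scale C a g \<cdot> f = scale C a (g \<cdot> f)"
  and cmp_scale [simp]: "src C g = tgt C f \<Longrightarrow> g \<cdot> scale C a f = scale C a (g \<cdot> f)"
  using cmp_scale_left[of f "src C f" "tgt C f" g "tgt C g"] cmp_scale_right[of f "src C f" "tgt C f" g "tgt C g"]
  by (simp_all add: Hom_iff)

end

context linear_monoidal_category
begin

definition fscale :: "complex \<Rightarrow> ('o, 'm) family \<Rightarrow> ('o, 'm) family" where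
  "fscale a f = Family (fdom f) (fcod f) (\<lambda>W. scale C a (fam f W))"

lemma fscale_ends [simp]: "fdom (fscale a f) = fdom f" "fcod (fscale a f) = fcod f"
  by (simp_all add: fscale_def)

lemma actM_scale [simp]: "actM u (scale C a f) = scale C a (actM u f)"
  by (induct u) (simp_all add: ten_scale_right)

lemma natural_fscale [simp]: "natural f \<Longrightarrow> natural (fscale a f)"
  by (simp add: natural_def fscale_def)

lemma fscale_fcomp [simp]:
  assumes "natural f" "natural g" "fdom g = fcod f"
  shows "fscale a g \<star> f = fscale a (g \<star> f)" "g \<star> fscale a f = fscale a (g \<star> f)"
  using assms(3)
  by (auto intro!: family_eqI simp: fscale_def fcomp_def naturalD(1,2)[OF assms(1)] naturalD(1,2)[OF assms(2)])

lemma fwhisk_fscale [simp]: "u \<triangleright> fscale a f \<triangleleft> v = fscale a (u \<triangleright> f \<triangleleft> v)"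
  by (rule family_eqI) (simp_all add: fscale_def fwhisk_def)

lemma emb_scale [simp]: "emb (scale C a f) = fscale a (emb f)"
  by (rule family_eqI) (simp_all add: emb_def fscale_def ten_scale_left)

end

context spherical_fusion_category
begin

lemma piv_ends [simp]: "src C (piv C X) = X" "tgt C (piv C X) = dualO C (dualO C X)"
  using piv_Hom[of X] by (simp_all add: Hom_iff)

text \<open>The cap $X\,X^* \to 1$ with which traces are closed.\<close>

definition trs :: "'o \<Rightarrow> ('o, 'm) family" where
  "trs X = evs (dualO C X) \<star> ([] \<triangleright> emb (piv C X) \<triangleleft> [dualO C X])"

lemma trs_arr [simp]: "natural (trs X)" "fdom (trs X) = [X, dualO C X]" "fcod (trs X) = []"
  by (simp_all add: trs_def)

lemma coevs_hom: "coevs X \<in> strict.hom [] ([X] @ [dualO C X])"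
  and trs_hom: "trs X \<in> strict.hom ([X] @ [dualO C X]) []"
  by (auto intro!: strict.homI)

lemma emb_hom: "emb f \<in> strict.hom [src C f] [tgt C f]"
  by (auto intro!: strict.homI)

lemma coevs_dinatural:
  "([] \<triangleright> emb f \<triangleleft> [dualO C (src C f)]) \<star> coevs (src C f) = ([tgt C f] \<triangleright> emb (dualM C f) \<triangleleft> []) \<star> coevs (tgt C f)"
  unfolding emb_dualM
  by (rule strict.dual_map_coev[OF dual_pair_evs dual_pair_evs emb_hom, symmetric])

lemma evs_dinatural:
  "evs (src C f) \<star> ([] \<triangleright> emb (dualM C f) \<triangleleft> [src C f]) = evs (tgt C f) \<star> ([dualO C (tgt C f)] \<triangleright> emb f \<triangleleft> [])"
  unfolding emb_dualM
  by (rule strict.dual_map_ev[OF dual_pair_evs dual_pair_evs emb_hom])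

text \<open>By naturality of the pivotal structure $f$ passes it as $f^{**}$, which slides around the cap of $Y^*$
  as $f^*$.\<close>

lemma trs_dinatural:
  "trs (tgt C f) \<star> ([] \<triangleright> emb f \<triangleleft> [dualO C (tgt C f)]) = trs (src C f) \<star> ([src C f] \<triangleright> emb (dualM C f) \<triangleleft> [])"
proof -
  let ?X = "src C f" and ?Y = "tgt C f" and ?D = "dualO C"
  have p: "piv C ?Y \<cdot> f = dualM C (dualM C f) \<cdot> piv C ?X"
    by (rule piv_natural) (simp add: Hom_iff)
  have "trs ?Y \<star> ([] \<triangleright> emb f \<triangleleft> [?D ?Y]) = evs (?D ?Y) \<star> ([] \<triangleright> emb (piv C ?Y \<cdot> f) \<triangleleft> [?D ?Y])"
    by (simp add: trs_def)
  also have "\<dots> = (evs (?D ?Y) \<star> ([] \<triangleright> emb (dualM C (dualM C f)) \<triangleleft> [?D ?Y])) \<star> ([] \<triangleright> emb (piv C ?X) \<triangleleft> [?D ?Y])"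
    unfolding p by simp
  also have "evs (?D ?Y) \<star> ([] \<triangleright> emb (dualM C (dualM C f)) \<triangleleft> [?D ?Y]) =
      evs (?D ?X) \<star> ([?D (?D ?X)] \<triangleright> emb (dualM C f) \<triangleleft> [])"
    using evs_dinatural[of "dualM C f"] by simp
  finally show ?thesis
    using strict.interchange[of "emb (piv C ?X)" "emb (dualM C f)" "[]" "[]" "[]"] by (simp add: trs_def)
qed

definition strict_ptrace :: "'o list \<Rightarrow> 'o list \<Rightarrow> 'o \<Rightarrow> ('o, 'm) family \<Rightarrow> ('o, 'm) family" where
  "strict_ptrace a b X h = strict.ptr a b [dualO C X] (coevs X) (trs X) h"

text \<open>Conjugation invariance of partial traces; its main use is that traces add up over the summands of a
  direct sum.\<close>

lemma strict_ptrace_cyclic: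
  assumes "h \<in> strict.hom (a @ [tgt C g]) (b @ [src C g])"
  shows "strict_ptrace a b (tgt C g) ((b \<triangleright> emb g \<triangleleft> []) \<star> h) = strict_ptrace a b (src C g) (h \<star> (a \<triangleright> emb g \<triangleleft> []))"
  unfolding strict_ptrace_def
  using strict.ptr_cyclic[OF coevs_hom trs_hom coevs_hom trs_hom emb_hom _ coevs_dinatural trs_dinatural assms]
    emb_hom[of "dualM C g"] by simp

lemma strict_ptrace_between:
  assumes "h \<in> strict.hom (a @ [X]) (b @ [X])" "f \<in> strict.hom a' a" "g \<in> strict.hom b b'"
  shows "strict_ptrace a' b' X (([] \<triangleright> g \<triangleleft> [X]) \<star> h \<star> ([] \<triangleright> f \<triangleleft> [X])) = g \<star> strict_ptrace a b X h \<star> f"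
  unfolding strict_ptrace_def by (rule strict.ptr_between[OF coevs_hom trs_hom assms])

lemma strict_ptrace_whisk:
  assumes "h \<in> strict.hom (a @ [X]) (b @ [X])"
  shows "strict_ptrace (x @ a) (x @ b) X (x \<triangleright> h \<triangleleft> []) = x \<triangleright> strict_ptrace a b X h \<triangleleft> []"
  unfolding strict_ptrace_def by (rule strict.ptr_whisk[OF coevs_hom trs_hom assms])

lemma strict_ptrace_scale:
  assumes "h \<in> strict.hom (a @ [X]) (b @ [X])"
  shows "strict_ptrace a b X (fscale k h) = fscale k (strict_ptrace a b X h)"
  unfolding strict_ptrace_def strict.ptr_def using strict.homD[OF assms] by simp

text \<open>The nested cups of $X$ and $Y$ as an arrow of the category.\<close>

definition coten :: "'o \<Rightarrow> 'o \<Rightarrow> 'm" where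
  "coten X Y = inv_arrow C (assoc C X Y (dualO C Y \<otimes>\<^sub>o dualO C X)) \<cdot>
    (idm C X \<otimes>\<^sub>m (assoc C Y (dualO C Y) (dualO C X) \<cdot> ((coev C Y \<otimes>\<^sub>m idm C (dualO C X)) \<cdot> inv_arrow C (lunit C (dualO C X)))))
    \<cdot> coev C X"

text \<open>The inverse of \<open>dual_ten\<close> occurs in the tensor structure of the double dual.  To identify it, an
  inverse must be exhibited among the arrows of the category itself.\<close>

definition dual_ten_inv :: "'o \<Rightarrow> 'o \<Rightarrow> 'm" where
  "dual_ten_inv X Y = lunit C (dualO C Y \<otimes>\<^sub>o dualO C X) \<cdot> (ev C (X \<otimes>\<^sub>o Y) \<otimes>\<^sub>m idm C (dualO C Y \<otimes>\<^sub>o dualO C X)) \<cdot>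
    inv_arrow C (assoc C (dualO C (X \<otimes>\<^sub>o Y)) (X \<otimes>\<^sub>o Y) (dualO C Y \<otimes>\<^sub>o dualO C X)) \<cdot>
    (idm C (dualO C (X \<otimes>\<^sub>o Y)) \<otimes>\<^sub>m coten X Y) \<cdot> inv_arrow C (runit C (dualO C (X \<otimes>\<^sub>o Y)))"

text \<open>The transpose of \<open>fuse\<close>, from the dual of the single letter $X \otimes Y$ to the nested dual of
  the word $[X, Y]$.  Up to \<open>split\<close> it is inverse to \<open>dual_ten\<close>.\<close>

definition fuse_dual :: "'o \<Rightarrow> 'o \<Rightarrow> ('o, 'm) family" where
  "fuse_dual X Y = strict.dual_map [dualO C (X \<otimes>\<^sub>o Y)] [dualO C Y, dualO C X] (coev2 X Y) (evs (X \<otimes>\<^sub>o Y)) (fuse X Y)"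

lemma fuse_hom: "fuse X Y \<in> strict.hom [X, Y] [X \<otimes>\<^sub>o Y]"
  by (auto intro!: strict.homI)

lemma fuse_dual_hom: "fuse_dual X Y \<in> strict.hom [dualO C (X \<otimes>\<^sub>o Y)] [dualO C Y, dualO C X]"
  unfolding fuse_dual_def by (rule strict.dual_map_hom[OF dual_pair_ev2 dual_pair_evs fuse_hom])

lemmas fuse_dual_arr [simp] = strict.homD[OF fuse_dual_hom]

lemma ev2_fuse_dual: "ev2 X Y \<star> ([] \<triangleright> fuse_dual X Y \<triangleleft> [X, Y]) = evs (X \<otimes>\<^sub>o Y) \<star> ([dualO C (X \<otimes>\<^sub>o Y)] \<triangleright> fuse X Y \<triangleleft> [])"
  unfolding fuse_dual_def by (rule strict.dual_map_ev[OF dual_pair_ev2 dual_pair_evs fuse_hom])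

lemma ev2_arr [simp]: "natural (ev2 X Y)" "fdom (ev2 X Y) = [dualO C Y, dualO C X, X, Y]" "fcod (ev2 X Y) = []"
  "natural (coev2 X Y)" "fdom (coev2 X Y) = []" "fcod (coev2 X Y) = [X, Y, dualO C Y, dualO C X]"
  by (simp_all add: strict.nested_ev_def strict.nested_coev_def)

lemma evs_dual_ten:
  "evs (X \<otimes>\<^sub>o Y) \<star> ([] \<triangleright> emb (dual_ten C X Y) \<triangleleft> [X \<otimes>\<^sub>o Y]) =
   ev2 X Y \<star> ([] \<triangleright> split (dualO C Y) (dualO C X) \<triangleleft> [X, Y]) \<star> ([dualO C Y \<otimes>\<^sub>o dualO C X] \<triangleright> split X Y \<triangleleft> [])"
  unfolding emb_dual_ten
  by (rule strict.mate_eval[OF dual_pair_evs]) (auto intro!: strict.homI)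

lemma fuse_dual_dual_ten: "fuse_dual X Y \<star> emb (dual_ten C X Y) = split (dualO C Y) (dualO C X)"
proof (rule strict.eval_cancel[OF dual_pair_ev2])
  let ?d = "emb (dual_ten C X Y)" and ?W = "X \<otimes>\<^sub>o Y"
  have "ev2 X Y \<star> ([] \<triangleright> (fuse_dual X Y \<star> ?d) \<triangleleft> [X, Y]) =
      (ev2 X Y \<star> ([] \<triangleright> fuse_dual X Y \<triangleleft> [X, Y])) \<star> ([] \<triangleright> ?d \<triangleleft> [X, Y])"
    by simp
  also have "\<dots> = evs ?W \<star> ([dualO C ?W] \<triangleright> fuse X Y \<triangleleft> []) \<star> ([] \<triangleright> ?d \<triangleleft> [X, Y])"
    unfolding ev2_fuse_dual by simp
  also have "\<dots> = (evs ?W \<star> ([] \<triangleright> ?d \<triangleleft> [?W])) \<star> ([dualO C Y \<otimes>\<^sub>o dualO C X] \<triangleright> fuse X Y \<triangleleft> [])"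
    using strict.interchange[of ?d "fuse X Y" "[]" "[]" "[]"] by simp
  also have "\<dots> = ev2 X Y \<star> ([] \<triangleright> split (dualO C Y) (dualO C X) \<triangleleft> [X, Y])"
    unfolding evs_dual_ten by (simp del: strict.nested_ev_def)
  finally show "ev2 X Y \<star> ([] \<triangleright> (fuse_dual X Y \<star> ?d) \<triangleleft> [X, Y]) =
    ev2 X Y \<star> ([] \<triangleright> split (dualO C Y) (dualO C X) \<triangleleft> [X, Y])" .
qed (auto intro!: strict.homI)

lemma dual_ten_fuse_dual: "emb (dual_ten C X Y) \<star> fuse (dualO C Y) (dualO C X) \<star> fuse_dual X Y = fid [dualO C (X \<otimes>\<^sub>o Y)]"
proof (rule strict.eval_cancel[OF dual_pair_evs])
  let ?d = "emb (dual_ten C X Y)" and ?W = "X \<otimes>\<^sub>o Y"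
  have "evs ?W \<star> ([] \<triangleright> (?d \<star> fuse (dualO C Y) (dualO C X) \<star> fuse_dual X Y) \<triangleleft> [?W]) =
      (evs ?W \<star> ([] \<triangleright> ?d \<triangleleft> [?W])) \<star> ([] \<triangleright> fuse (dualO C Y) (dualO C X) \<triangleleft> [?W]) \<star> ([] \<triangleright> fuse_dual X Y \<triangleleft> [?W])"
    by simp
  also have "\<dots> = ev2 X Y \<star> ([] \<triangleright> split (dualO C Y) (dualO C X) \<triangleleft> [X, Y]) \<star> (([dualO C Y \<otimes>\<^sub>o dualO C X] \<triangleright> split X Y \<triangleleft> [])
      \<star> ([] \<triangleright> fuse (dualO C Y) (dualO C X) \<triangleleft> [?W])) \<star> ([] \<triangleright> fuse_dual X Y \<triangleleft> [?W])"
    unfolding evs_dual_ten by simp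
  also have "\<dots> = ev2 X Y \<star> ([dualO C Y, dualO C X] \<triangleright> split X Y \<triangleleft> []) \<star> ([] \<triangleright> fuse_dual X Y \<triangleleft> [?W])"
    using strict.interchange[of "fuse (dualO C Y) (dualO C X)" "split X Y" "[]" "[]" "[]", symmetric] by simp
  also have "\<dots> = (ev2 X Y \<star> ([] \<triangleright> fuse_dual X Y \<triangleleft> [X, Y])) \<star> ([dualO C ?W] \<triangleright> split X Y \<triangleleft> [])"
    using strict.interchange[of "fuse_dual X Y" "split X Y" "[]" "[]" "[]"] by simp
  also have "\<dots> = evs ?W \<star> ([] \<triangleright> fid [dualO C ?W] \<triangleleft> [?W])"
    unfolding ev2_fuse_dual by simp
  finally show "evs ?W \<star> ([] \<triangleright> (?d \<star> fuse (dualO C Y) (dualO C X) \<star> fuse_dual X Y) \<triangleleft> [?W])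
    = evs ?W \<star> ([] \<triangleright> fid [dualO C ?W] \<triangleleft> [?W])" .
qed (auto intro!: strict.homI)

lemma coten_ends [simp]: "src C (coten X Y) = \<one>\<^sub>o" "tgt C (coten X Y) = (X \<otimes>\<^sub>o Y) \<otimes>\<^sub>o (dualO C Y \<otimes>\<^sub>o dualO C X)"
  by (simp_all add: coten_def)

lemma dual_ten_inv_ends [simp]: "src C (dual_ten_inv X Y) = dualO C (X \<otimes>\<^sub>o Y)" "tgt C (dual_ten_inv X Y) = dualO C Y \<otimes>\<^sub>o dualO C X"
  by (simp_all add: dual_ten_inv_def)

lemma emb_dual_ten_inv: "emb (dual_ten_inv X Y) = fuse (dualO C Y) (dualO C X) \<star> fuse_dual X Y"
proof -
  let ?W = "X \<otimes>\<^sub>o Y" and ?V = "dualO C Y \<otimes>\<^sub>o dualO C X" and ?f = "fuse (dualO C Y) (dualO C X)"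
  have "emb (dual_ten_inv X Y) = ([] \<triangleright> evs ?W \<triangleleft> [?V]) \<star> ([dualO C ?W] \<triangleright> fuse X Y \<triangleleft> [?V]) \<star> ([dualO C ?W, X, Y] \<triangleright> ?f \<triangleleft> []) \<star>
      ([dualO C ?W] \<triangleright> coev2 X Y \<triangleleft> [])"
    by (simp add: dual_ten_inv_def coten_def evs_def coevs_def strict.nested_coev_def)
  also have "\<dots> = (([] \<triangleright> (evs ?W \<star> ([dualO C ?W] \<triangleright> fuse X Y \<triangleleft> [])) \<triangleleft> [?V]) \<star> ([dualO C ?W, X, Y] \<triangleright> ?f \<triangleleft> [])) \<star>
      ([dualO C ?W] \<triangleright> coev2 X Y \<triangleleft> [])"
    by simp
  also have "\<dots> = ?f \<star> ([] \<triangleright> (evs ?W \<star> ([dualO C ?W] \<triangleright> fuse X Y \<triangleleft> [])) \<triangleleft> [dualO C Y, dualO C X]) \<star>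
      ([dualO C ?W] \<triangleright> coev2 X Y \<triangleleft> [])"
    using strict.interchange[of "evs ?W \<star> ([dualO C ?W] \<triangleright> fuse X Y \<triangleleft> [])" ?f "[]" "[]" "[]"] by simp
  also have "\<dots> = ?f \<star> fuse_dual X Y"
    by (simp add: fuse_dual_def strict.dual_map_def strict.mate_def)
  finally show ?thesis .
qed

lemma dual_ten_iso [simp]: "iso_arrow C (dual_ten C X Y)"
  and inv_dual_ten: "inv_arrow C (dual_ten C X Y) = dual_ten_inv X Y"
proof -
  have 1: "dual_ten C X Y \<cdot> dual_ten_inv X Y = idm C (dualO C (X \<otimes>\<^sub>o Y))"
    by (rule emb_inj) (simp add: emb_dual_ten_inv dual_ten_fuse_dual)
  have 2: "dual_ten_inv X Y \<cdot> dual_ten C X Y = idm C (dualO C Y \<otimes>\<^sub>o dualO C X)"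
    by (rule emb_inj) (simp add: emb_dual_ten_inv fuse_dual_dual_ten)
  show "iso_arrow C (dual_ten C X Y)" "inv_arrow C (dual_ten C X Y) = dual_ten_inv X Y"
    using isoI[of "dual_ten_inv X Y" "dual_ten C X Y"] 1 2 by simp_all
qed

abbreviation tr2 :: "'o \<Rightarrow> 'o \<Rightarrow> ('o, 'm) family" where
  "tr2 X Y \<equiv> strict.nested_ev [X] [dualO C X] (trs X) (trs Y)"

text \<open>The only place where the pivotal structure has to be monoidal: the cap of $Y \otimes Z$ is the nested cap
  of $Y$ and $Z$.  The factor \<open>dualM\<close> of \<open>ddual_ten\<close> slides around the cap of
  $(Y \otimes Z)^*$ and becomes the inverse of \<open>dual_ten\<close>; the other factor opens the cap of
  $Z^* \otimes Y^*$ into nested caps.\<close>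

lemma trs_ten: "trs (Y \<otimes>\<^sub>o Z) \<star> ([] \<triangleright> fuse Y Z \<triangleleft> [dualO C (Y \<otimes>\<^sub>o Z)]) = tr2 Y Z \<star> ([Y, Z] \<triangleright> fuse_dual Y Z \<triangleleft> [])"
proof -
  let ?D = "dualO C"
  let ?W = "Y \<otimes>\<^sub>o Z" and ?V = "?D Z \<otimes>\<^sub>o ?D Y"
  let ?d = "dual_ten C (?D Z) (?D Y)"
  define p where "p = ([] \<triangleright> emb (piv C Y) \<triangleleft> [?D (?D Z)]) \<star> ([Y] \<triangleright> emb (piv C Z) \<triangleleft> [])"
  have [simp]: "natural p" "fdom p = [Y, Z]" "fcod p = [?D (?D Y), ?D (?D Z)]"
    by (simp_all add: p_def)
  have piv: "emb (piv C ?W) \<star> fuse Y Z = emb (dualM C (dual_ten_inv Y Z)) \<star> emb ?d \<star> fuse (?D (?D Y)) (?D (?D Z)) \<star> p"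
    unfolding piv_monoidal ddual_ten_def inv_dual_ten by (simp add: p_def)
  have "trs ?W \<star> ([] \<triangleright> fuse Y Z \<triangleleft> [?D ?W]) = evs (?D ?W) \<star> ([] \<triangleright> (emb (piv C ?W) \<star> fuse Y Z) \<triangleleft> [?D ?W])"
    by (simp add: trs_def)
  also have "\<dots> = (evs (?D ?W) \<star> ([] \<triangleright> emb (dualM C (dual_ten_inv Y Z)) \<triangleleft> [?D ?W])) \<star>
      ([] \<triangleright> (emb ?d \<star> fuse (?D (?D Y)) (?D (?D Z)) \<star> p) \<triangleleft> [?D ?W])"
    unfolding piv by simp
  also have "evs (?D ?W) \<star> ([] \<triangleright> emb (dualM C (dual_ten_inv Y Z)) \<triangleleft> [?D ?W]) =
      evs ?V \<star> ([?D ?V] \<triangleright> emb (dual_ten_inv Y Z) \<triangleleft> [])"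
    using evs_dinatural[of "dual_ten_inv Y Z"] by simp
  also have "(evs ?V \<star> ([?D ?V] \<triangleright> emb (dual_ten_inv Y Z) \<triangleleft> [])) \<star>
      ([] \<triangleright> (emb ?d \<star> fuse (?D (?D Y)) (?D (?D Z)) \<star> p) \<triangleleft> [?D ?W]) =
      evs ?V \<star> ([] \<triangleright> (emb ?d \<star> fuse (?D (?D Y)) (?D (?D Z)) \<star> p) \<triangleleft> [?V]) \<star> ([Y, Z] \<triangleright> emb (dual_ten_inv Y Z) \<triangleleft> [])"
    using strict.interchange[of "emb ?d \<star> fuse (?D (?D Y)) (?D (?D Z)) \<star> p" "emb (dual_ten_inv Y Z)" "[]" "[]" "[]"] by simp
  also have "\<dots> = (evs ?V \<star> ([] \<triangleright> emb ?d \<triangleleft> [?V])) \<star> (([] \<triangleright> (fuse (?D (?D Y)) (?D (?D Z)) \<star> p) \<triangleleft> [?V]) \<star>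
      ([Y, Z] \<triangleright> fuse (?D Z) (?D Y) \<triangleleft> [])) \<star> ([Y, Z] \<triangleright> fuse_dual Y Z \<triangleleft> [])"
    unfolding emb_dual_ten_inv by simp
  also have "\<dots> = ev2 (?D Z) (?D Y) \<star> ([] \<triangleright> split (?D (?D Y)) (?D (?D Z)) \<triangleleft> [?D Z, ?D Y]) \<star>
      ([?D (?D Y) \<otimes>\<^sub>o ?D (?D Z)] \<triangleright> split (?D Z) (?D Y) \<triangleleft> []) \<star> ([?D (?D Y) \<otimes>\<^sub>o ?D (?D Z)] \<triangleright> fuse (?D Z) (?D Y) \<triangleleft> []) \<star>
      ([] \<triangleright> (fuse (?D (?D Y)) (?D (?D Z)) \<star> p) \<triangleleft> [?D Z, ?D Y]) \<star> ([Y, Z] \<triangleright> fuse_dual Y Z \<triangleleft> [])"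
    using strict.interchange[of "fuse (?D (?D Y)) (?D (?D Z)) \<star> p" "fuse (?D Z) (?D Y)" "[]" "[]" "[]"]
    unfolding evs_dual_ten by simp
  also have "\<dots> = (ev2 (?D Z) (?D Y) \<star> ([] \<triangleright> p \<triangleleft> [?D Z, ?D Y])) \<star> ([Y, Z] \<triangleright> fuse_dual Y Z \<triangleleft> [])"
    by simp
  also have "ev2 (?D Z) (?D Y) \<star> ([] \<triangleright> p \<triangleleft> [?D Z, ?D Y]) = tr2 Y Z"
    using strict.interchange_reduce[of "emb (piv C Y)" "evs (?D Z)" "[Y] \<triangleright> emb (piv C Z) \<triangleleft> [?D Z, ?D Y]" "[]" "[]" "[?D Y]"]
    by (simp add: p_def strict.nested_ev_def trs_def)
  finally show ?thesis .
qed

text \<open>A loop coloured $Y \otimes Z$ is a pair of parallel loops.\<close>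

lemma strict_ptrace_ten:
  assumes "h \<in> strict.hom (a @ [Y \<otimes>\<^sub>o Z]) (b @ [Y \<otimes>\<^sub>o Z])"
  shows "strict_ptrace a b (Y \<otimes>\<^sub>o Z) h =
    strict_ptrace a b Y (strict_ptrace (a @ [Y]) (b @ [Y]) Z ((b \<triangleright> split Y Z \<triangleleft> []) \<star> h \<star> (a \<triangleright> fuse Y Z \<triangleleft> [])))"
proof -
  note [simp] = strict.homD[OF assms]
  let ?h = "(b \<triangleright> split Y Z \<triangleleft> []) \<star> h"
  have h: "?h \<in> strict.hom (a @ [Y \<otimes>\<^sub>o Z]) (b @ [Y, Z])"
    "?h \<star> (a \<triangleright> fuse Y Z \<triangleleft> []) \<in> strict.hom (a @ [Y] @ [Z]) (b @ [Y] @ [Z])"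
    by (auto intro!: strict.homI)
  have c2: "coev2 Y Z \<in> strict.hom [] ([Y, Z] @ [dualO C Z, dualO C Y])"
    "tr2 Y Z \<in> strict.hom ([Y, Z] @ [dualO C Z, dualO C Y]) []"
    by (auto intro!: strict.homI simp: strict.nested_ev_def)
  have cc: "([] \<triangleright> fuse Y Z \<triangleleft> [dualO C Z, dualO C Y]) \<star> coev2 Y Z = ([Y \<otimes>\<^sub>o Z] \<triangleright> fuse_dual Y Z \<triangleleft> []) \<star> coevs (Y \<otimes>\<^sub>o Z)"
    unfolding fuse_dual_def by (rule strict.dual_map_coev[OF dual_pair_ev2 dual_pair_evs fuse_hom, symmetric])
  have "strict_ptrace a b (Y \<otimes>\<^sub>o Z) h = strict_ptrace a b (Y \<otimes>\<^sub>o Z) ((b \<triangleright> fuse Y Z \<triangleleft> []) \<star> ?h)"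
    by simp
  also have "\<dots> = strict.ptr a b [dualO C Z, dualO C Y] (coev2 Y Z) (tr2 Y Z) (?h \<star> (a \<triangleright> fuse Y Z \<triangleleft> []))"
    unfolding strict_ptrace_def by (rule strict.ptr_cyclic[OF coevs_hom trs_hom c2 fuse_hom fuse_dual_hom cc trs_ten h(1)])
  also have "\<dots> = strict_ptrace a b Y (strict_ptrace (a @ [Y]) (b @ [Y]) Z (?h \<star> (a \<triangleright> fuse Y Z \<triangleleft> [])))"
    unfolding strict_ptrace_def using strict.ptr_nested[OF coevs_hom trs_hom coevs_hom trs_hom h(2)] by simp
  finally show ?thesis by simp
qed

end

section \<open>Hom spaces and Schur's lemma\<close>

context linear_category
begin

lemma hom_abelian_group: "abelian_group (hom_space C X Y)"
  using hom_module[of X Y] by (simp add: Module.module_def)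

lemma Hom_ends: "f \<in> Hom C X Y \<Longrightarrow> src C f = X" "f \<in> Hom C X Y \<Longrightarrow> tgt C f = Y"
  by (simp_all add: Hom_iff)

lemma plus_Hom: "\<lbrakk>f \<in> Hom C X Y; g \<in> Hom C X Y\<rbrakk> \<Longrightarrow> plusm C f g \<in> Hom C X Y"
  using abelian_monoid.a_closed[OF abelian_group.axioms(1)[OF hom_abelian_group], of f X Y g] by simp

lemma zero_Hom [simp]: "zerom C X Y \<in> Hom C X Y"
  using abelian_monoid.zero_closed[OF abelian_group.axioms(1)[OF hom_abelian_group], of X Y] by simp

lemma zero_ends [simp]: "src C (zerom C X Y) = X" "tgt C (zerom C X Y) = Y"
  using zero_Hom[of X Y] by (simp_all add: Hom_iff del: zero_Hom)

lemma plus_ends [simp]: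
  "\<lbrakk>src C f = src C g; tgt C f = tgt C g\<rbrakk> \<Longrightarrow> src C (plusm C f g) = src C g"
  "\<lbrakk>src C f = src C g; tgt C f = tgt C g\<rbrakk> \<Longrightarrow> tgt C (plusm C f g) = tgt C g"
  using plus_Hom[of f "src C g" "tgt C g" g] by (simp_all add: Hom_iff)

lemma plus_comm: "\<lbrakk>f \<in> Hom C X Y; g \<in> Hom C X Y\<rbrakk> \<Longrightarrow> plusm C f g = plusm C g f"
  using abelian_monoid.a_comm[OF abelian_group.axioms(1)[OF hom_abelian_group], of f X Y g] by simp

lemma plus_assoc: "\<lbrakk>f \<in> Hom C X Y; g \<in> Hom C X Y; h \<in> Hom C X Y\<rbrakk> \<Longrightarrow>
    plusm C (plusm C f g) h = plusm C f (plusm C g h)"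
  using abelian_monoid.a_assoc[OF abelian_group.axioms(1)[OF hom_abelian_group], of f X Y g h] by simp

lemma plus_zero: "f \<in> Hom C X Y \<Longrightarrow> plusm C f (zerom C X Y) = f" "f \<in> Hom C X Y \<Longrightarrow> plusm C (zerom C X Y) f = f"
  using abelian_monoid.r_zero[OF abelian_group.axioms(1)[OF hom_abelian_group], of f X Y]
    abelian_monoid.l_zero[OF abelian_group.axioms(1)[OF hom_abelian_group], of f X Y] by simp_all

lemma plus_swap:
  assumes "a \<in> Hom C X Y" "b \<in> Hom C X Y" "c \<in> Hom C X Y" "d \<in> Hom C X Y"
  shows "plusm C (plusm C a b) (plusm C c d) = plusm C (plusm C a c) (plusm C b d)"
proof -
  have "plusm C (plusm C a b) (plusm C c d) = plusm C a (plusm C (plusm C b c) d)"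
    using assms by (simp add: plus_assoc plus_Hom)
  also have "plusm C b c = plusm C c b" using assms by (intro plus_comm)
  also have "plusm C a (plusm C (plusm C c b) d) = plusm C (plusm C a c) (plusm C b d)"
    using assms by (simp add: plus_assoc plus_Hom)
  finally show ?thesis .
qed

lemma scale_plus: "\<lbrakk>f \<in> Hom C X Y; g \<in> Hom C X Y\<rbrakk> \<Longrightarrow> scale C a (plusm C f g) = plusm C (scale C a f) (scale C a g)"
  using module.smult_r_distr[OF hom_module, of a f X Y g] by (simp add: complex_ring_def)

lemma scale_add: "scale C (a + b) f = plusm C (scale C a f) (scale C b f)"
  using module.smult_l_distr[OF hom_module, of a b f "src C f" "tgt C f"] by (simp add: complex_ring_def Hom_iff)

lemma scale_scale [simp]: "scale C a (scale C b f) = scale C (a * b) f"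
  using module.smult_assoc1[OF hom_module, of a b f "src C f" "tgt C f"] by (simp add: complex_ring_def Hom_iff)

lemma scale_one [simp]: "scale C 1 f = f"
  using module.smult_one[OF hom_module, of f "src C f" "tgt C f"] by (simp add: complex_ring_def Hom_iff)

lemma scale_0 [simp]: "scale C 0 f = zerom C (src C f) (tgt C f)"
  using module.smult_l_null[OF hom_module, of f "src C f" "tgt C f"] by (simp add: complex_ring_def Hom_iff)

lemma scale_zero [simp]: "scale C a (zerom C X Y) = zerom C X Y"
  using module.smult_r_null[OF hom_module, of a X Y] by (simp add: complex_ring_def)

lemma cmp_zero [simp]: "src C g = Y \<Longrightarrow> g \<cdot> zerom C X Y = zerom C X (tgt C g)"
  and zero_cmp [simp]: "tgt C f = Y \<Longrightarrow> zerom C Y Z \<cdot> f = zerom C (src C f) Z"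
proof -
  show "g \<cdot> zerom C X Y = zerom C X (tgt C g)" if "src C g = Y"
    using cmp_scale[of g "zerom C X Y" 0] that by simp
  show "zerom C Y Z \<cdot> f = zerom C (src C f) Z" if "tgt C f = Y"
    using scale_cmp[of "zerom C Y Z" f 0] that by simp
qed

lemma plus_neg: "f \<in> Hom C X Y \<Longrightarrow> plusm C f (scale C (-1) f) = zerom C X Y"
  using scale_add[of 1 "-1" f] by (simp add: Hom_ends)

lemma diff_zero_eq:
  assumes "f \<in> Hom C X Y" "g \<in> Hom C X Y" "plusm C f (scale C (-1) g) = zerom C X Y"
  shows "f = g"
proof -
  have "f = plusm C f (plusm C (scale C (-1) g) g)"
    using assms plus_neg[of g] plus_comm[OF assms(2) scale_Hom[OF assms(2)], of "-1"] plus_zero by simp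
  also have "\<dots> = plusm C (plusm C f (scale C (-1) g)) g"
    using plus_assoc[OF assms(1) scale_Hom[OF assms(2)] assms(2)] by simp
  also have "\<dots> = g" using assms plus_zero by simp
  finally show ?thesis .
qed

lemma cmp_plus [simp]:
  "\<lbrakk>src C f = src C g; tgt C f = tgt C g; src C h = tgt C g\<rbrakk> \<Longrightarrow> h \<cdot> plusm C f g = plusm C (h \<cdot> f) (h \<cdot> g)"
  "\<lbrakk>src C f = src C g; tgt C f = tgt C g; src C g = tgt C h\<rbrakk> \<Longrightarrow> plusm C f g \<cdot> h = plusm C (f \<cdot> h) (g \<cdot> h)"
  using cmp_plus_right[of f "src C g" "tgt C g" g h "tgt C h"] cmp_plus_left[of h "src C h" "src C g" f "tgt C g" g]
  by (simp_all add: Hom_iff)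

definition linmap :: "'o \<Rightarrow> 'o \<Rightarrow> 'o \<Rightarrow> 'o \<Rightarrow> ('m \<Rightarrow> 'm) \<Rightarrow> bool" where
  "linmap X Y X' Y' \<phi> \<longleftrightarrow> (\<forall>f\<in>Hom C X Y. \<phi> f \<in> Hom C X' Y') \<and>
    (\<forall>f\<in>Hom C X Y. \<forall>g\<in>Hom C X Y. \<phi> (plusm C f g) = plusm C (\<phi> f) (\<phi> g)) \<and>
    (\<forall>a. \<forall>f\<in>Hom C X Y. \<phi> (scale C a f) = scale C a (\<phi> f))"

definition linfun :: "'o \<Rightarrow> 'o \<Rightarrow> ('m \<Rightarrow> complex) \<Rightarrow> bool" where
  "linfun X Y \<psi> \<longleftrightarrow> (\<forall>f\<in>Hom C X Y. \<forall>g\<in>Hom C X Y. \<psi> (plusm C f g) = \<psi> f + \<psi> g) \<and>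
    (\<forall>a. \<forall>f\<in>Hom C X Y. \<psi> (scale C a f) = a * \<psi> f)"

lemma linmap_Hom: "linmap X Y X' Y' \<phi> \<Longrightarrow> f \<in> Hom C X Y \<Longrightarrow> \<phi> f \<in> Hom C X' Y'"
  by (auto simp: linmap_def)

lemma linfun_linmap: "linfun X' Y' \<psi> \<Longrightarrow> linmap X Y X' Y' \<phi> \<Longrightarrow> linfun X Y (\<lambda>f. \<psi> (\<phi> f))"
  by (auto simp: linfun_def linmap_def)

lemma linmap_cmp_left: "g \<in> Hom C Y Z \<Longrightarrow> linmap X Y X Z (\<lambda>f. g \<cdot> f)"
  by (auto simp: linmap_def Hom_iff)

lemma linmap_cmp_right: "g \<in> Hom C W X \<Longrightarrow> linmap X Y W Y (\<lambda>f. f \<cdot> g)"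
  by (auto simp: linmap_def Hom_iff)

lemma linmap_comp: "linmap X Y X' Y' \<phi> \<Longrightarrow> linmap X' Y' X'' Y'' \<phi>' \<Longrightarrow> linmap X Y X'' Y'' (\<lambda>f. \<phi>' (\<phi> f))"
  by (auto simp: linmap_def)

lemma linfun_zero: "linfun X Y \<psi> \<Longrightarrow> \<psi> (zerom C X Y) = 0"
  unfolding linfun_def using scale_0[of "zerom C X Y"] zero_Hom[of X Y] by (metis mult_zero_left zero_ends(1,2))

lemma linfun_scale: "linfun X Y \<psi> \<Longrightarrow> f \<in> Hom C X Y \<Longrightarrow> \<psi> (scale C a f) = a * \<psi> f"
  by (auto simp: linfun_def)

lemma finsum_Hom_and_linfun:
  assumes "finite A" "\<And>k. k \<in> A \<Longrightarrow> f k \<in> Hom C X Y"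
  shows "finsum (hom_space C X Y) f A \<in> Hom C X Y"
    and "linfun X Y \<psi> \<Longrightarrow> \<psi> (finsum (hom_space C X Y) f A) = (\<Sum>k\<in>A. \<psi> (f k))"
proof -
  interpret H: abelian_group "hom_space C X Y" by (rule hom_abelian_group)
  show 1: "finsum (hom_space C X Y) f A \<in> Hom C X Y"
    using H.finsum_closed[of f A] assms(2) by auto
  show "\<psi> (finsum (hom_space C X Y) f A) = (\<Sum>k\<in>A. \<psi> (f k))" if \<psi>: "linfun X Y \<psi>"
    using assms
  proof (induction A rule: finite_induct)
    case empty
    then show ?case using linfun_zero[OF \<psi>] by simp
  next
    case (insert x A)
    have "finsum (hom_space C X Y) f A \<in> Hom C X Y"
      using H.finsum_closed[of f A] insert(4) by auto
    moreover have "finsum (hom_space C X Y) f (insert x A) = plusm C (f x) (finsum (hom_space C X Y) f A)"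
      using H.finsum_insert[of A x f] insert by auto
    ultimately show ?case using insert \<psi> by (simp add: linfun_def)
  qed
qed

text \<open>A basis $b$ of a Hom space with coordinate functions $\beta$.  The expansion of $h$ is tested against all
  linear functionals $\psi$, so that only sums of complex numbers occur.  The condition
  $\beta_j(b_j) = 1$ is the part of duality that fixes the trace of the identity.\<close>

definition hom_frame :: "'o \<Rightarrow> 'o \<Rightarrow> nat set \<Rightarrow> (nat \<Rightarrow> 'm) \<Rightarrow> (nat \<Rightarrow> 'm \<Rightarrow> complex) \<Rightarrow> bool" where
  "hom_frame X Y J b \<beta> \<longleftrightarrow> finite J \<and> (\<forall>j\<in>J. b j \<in> Hom C X Y \<and> linfun X Y (\<beta> j)) \<and>
    (\<forall>j\<in>J. \<beta> j (b j) = 1) \<and>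
    (\<forall>\<psi> h. linfun X Y \<psi> \<longrightarrow> h \<in> Hom C X Y \<longrightarrow> \<psi> h = (\<Sum>j\<in>J. \<beta> j h * \<psi> (b j)))"

definition hom_dim :: "'o \<Rightarrow> 'o \<Rightarrow> nat \<Rightarrow> bool" where
  "hom_dim X Y n \<longleftrightarrow> (\<exists>J b \<beta>. hom_frame X Y J b \<beta> \<and> card J = n)"

text \<open>Either number is the trace of the identity, $\sum_{j,k} \gamma_k(b_j)\,\beta_j(c_k)$, summed in a
  different order.\<close>

lemma hom_dim_unique:
  assumes "hom_dim X Y n" "hom_dim X Y m"
  shows "n = m"
proof -
  obtain J b \<beta> where 1: "hom_frame X Y J b \<beta>" "card J = n" using assms(1) by (auto simp: hom_dim_def)
  obtain K c \<gamma> where 2: "hom_frame X Y K c \<gamma>" "card K = m" using assms(2) by (auto simp: hom_dim_def)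
  have "of_nat n = (\<Sum>j\<in>J. \<beta> j (b j))" using 1 by (simp add: hom_frame_def)
  also have "\<dots> = (\<Sum>j\<in>J. \<Sum>k\<in>K. \<gamma> k (b j) * \<beta> j (c k))"
    using 1 2 by (intro sum.cong) (auto simp: hom_frame_def)
  also have "\<dots> = (\<Sum>k\<in>K. \<Sum>j\<in>J. \<beta> j (c k) * \<gamma> k (b j))"
    by (subst sum.swap) (simp add: mult.commute)
  also have "\<dots> = (\<Sum>k\<in>K. \<gamma> k (c k))"
  proof (intro sum.cong refl)
    fix k assume k: "k \<in> K"
    have "linfun X Y (\<gamma> k)" "c k \<in> Hom C X Y" using 2 k by (auto simp: hom_frame_def)
    then show "(\<Sum>j\<in>J. \<beta> j (c k) * \<gamma> k (b j)) = \<gamma> k (c k)" using 1 by (auto simp: hom_frame_def)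
  qed
  also have "\<dots> = of_nat m" using 2 by (simp add: hom_frame_def)
  finally have "(of_nat n :: complex) = of_nat m" .
  then show ?thesis by simp
qed

lemma hom_dim_transport:
  assumes "hom_dim X Y n" "linmap X Y X' Y' \<phi>" "linmap X' Y' X Y \<phi>'"
    and "\<And>f. f \<in> Hom C X' Y' \<Longrightarrow> \<phi> (\<phi>' f) = f" "\<And>f. f \<in> Hom C X Y \<Longrightarrow> \<phi>' (\<phi> f) = f"
  shows "hom_dim X' Y' n"
proof -
  obtain J b \<beta> where 1: "hom_frame X Y J b \<beta>" "card J = n" using assms(1) by (auto simp: hom_dim_def)
  have "hom_frame X' Y' J (\<lambda>j. \<phi> (b j)) (\<lambda>j f. \<beta> j (\<phi>' f))"
    unfolding hom_frame_def
  proof (intro conjI allI impI ballI)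
    show "finite J" using 1 by (simp add: hom_frame_def)
    fix j assume j: "j \<in> J"
    then have b: "b j \<in> Hom C X Y" "linfun X Y (\<beta> j)" "\<beta> j (b j) = 1" using 1 by (auto simp: hom_frame_def)
    then show "\<phi> (b j) \<in> Hom C X' Y'" using assms(2) by (auto simp: linmap_def)
    show "linfun X' Y' (\<lambda>f. \<beta> j (\<phi>' f))" using linfun_linmap[OF b(2) assms(3)] .
    show "\<beta> j (\<phi>' (\<phi> (b j))) = 1" using assms(5) b by simp
  next
    fix \<psi> h assume p: "linfun X' Y' \<psi>" "h \<in> Hom C X' Y'"
    have "\<psi> h = \<psi> (\<phi> (\<phi>' h))" using assms(4) p by simp
    also have "\<dots> = (\<Sum>j\<in>J. \<beta> j (\<phi>' h) * \<psi> (\<phi> (b j)))"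
      using 1(1) linfun_linmap[OF p(1) assms(2)] linmap_Hom[OF assms(3) p(2)] unfolding hom_frame_def by blast
    finally show "\<psi> h = (\<Sum>j\<in>J. \<beta> j (\<phi>' h) * \<psi> (\<phi> (b j)))" .
  qed
  then show ?thesis using 1(2) by (auto simp: hom_dim_def)
qed

lemma hom_dim_iso_target:
  assumes "hom_dim X Y n" "g \<in> Hom C Y Z" "iso_arrow C g"
  shows "hom_dim X Z n"
  using assms(2,3)
  by (intro hom_dim_transport[OF assms(1) linmap_cmp_left[of g] linmap_cmp_left[of "inv_arrow C g"]]) (auto simp: Hom_iff)

lemma hom_dim_iso_source:
  assumes "hom_dim X Y n" "g \<in> Hom C Z X" "iso_arrow C g"
  shows "hom_dim Z Y n"
  using assms(2,3)
  by (intro hom_dim_transport[OF assms(1) linmap_cmp_right[of g] linmap_cmp_right[of "inv_arrow C g"]]) (auto simp: Hom_iff assoc_cmp)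

lemma isomorphic_refl [simp]: "isomorphic C X X"
  unfolding isomorphic_def by (rule bexI[of _ "idm C X"]) (simp_all add: Hom_iff)

lemma isomorphic_sym: "isomorphic C X Y \<Longrightarrow> isomorphic C Y X"
  unfolding isomorphic_def by (metis Hom_iff iso_inv src_inv tgt_inv)

lemma isomorphic_trans: "isomorphic C X Y \<Longrightarrow> isomorphic C Y Z \<Longrightarrow> isomorphic C X Z"
  unfolding isomorphic_def by (metis Hom_iff iso_cmp src_cmp tgt_cmp)

lemma zero_objectI: "idm C X = zerom C X X \<Longrightarrow> zero_object C X"
  unfolding zero_object_def
proof (intro allI conjI ex1I[of _ "zerom C _ _"])
  fix Y f assume i: "idm C X = zerom C X X"
  show "f = zerom C X Y" if "f \<in> Hom C X Y"
    using that cmp_id[of f X] i by (simp add: Hom_iff)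
  show "f = zerom C Y X" if "f \<in> Hom C Y X"
    using that id_cmp[of f X] i by (simp add: Hom_iff)
qed simp_all

lemma zero_objectD: "zero_object C X \<Longrightarrow> f \<in> Hom C Y X \<Longrightarrow> f = zerom C Y X"
  unfolding zero_object_def by (metis zero_Hom)

lemma simple_id_nonzero: "simple_obj C X \<Longrightarrow> idm C X \<noteq> zerom C X X"
  using zero_objectI by (auto simp: simple_obj_def)

end

text \<open>The vectors are the columns of a square matrix whose last row is zero.\<close>

lemma dependent_vectors:
  fixes v :: "nat \<Rightarrow> nat \<Rightarrow> complex"
  shows "\<exists>c. (\<exists>j\<le>n. c j \<noteq> 0) \<and> (\<forall>i<n. (\<Sum>j\<le>n. c j * v j i) = 0)"
proof -
  define A where "A = mat (Suc n) (Suc n) (\<lambda>(i, j). if i < n then v j i else 0)"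
  have A: "A \<in> carrier_mat (Suc n) (Suc n)" by (simp add: A_def)
  have "det A = 0"
  proof -
    have "row A n = 0\<^sub>v (Suc n)" by (rule eq_vecI) (auto simp: A_def)
    moreover have "det A = (\<Sum>j<Suc n. A $$ (n, j) * cofactor A n j)"
      by (rule laplace_expansion_row[OF A]) simp
    ultimately show ?thesis by (simp add: A_def)
  qed
  then obtain x where x: "x \<in> carrier_vec (Suc n)" "x \<noteq> 0\<^sub>v (Suc n)" "A *\<^sub>v x = 0\<^sub>v (Suc n)"
    using det_0_iff_vec_prod_zero[OF A] by auto
  have "\<exists>j\<le>n. x $ j \<noteq> 0"
  proof (rule ccontr)
    assume "\<not> ?thesis"
    then have "x = 0\<^sub>v (Suc n)" using x(1) by (intro eq_vecI) auto
    then show False using x by simp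
  qed
  moreover have "(\<Sum>j\<le>n. x $ j * v j i) = 0" if "i < n" for i
  proof -
    have "(A *\<^sub>v x) $ i = 0" using x(3) that by simp
    moreover have "(A *\<^sub>v x) $ i = (\<Sum>j\<in>{0..<Suc n}. v j i * x $ j)"
      using that x(1) by (simp add: A_def scalar_prod_def)
    ultimately show ?thesis
      by (simp add: mult.commute atLeast0LessThan lessThan_Suc_atMost)
  qed
  ultimately show ?thesis by (intro exI[of _ "\<lambda>j. x $ j"]) auto
qed

context linear_category
begin

primrec lincomb :: "'o \<Rightarrow> 'o \<Rightarrow> nat \<Rightarrow> (nat \<Rightarrow> 'm) \<Rightarrow> (nat \<Rightarrow> complex) \<Rightarrow> 'm" where
  "lincomb X Y 0 b v = zerom C X Y"
| "lincomb X Y (Suc n) b v = plusm C (lincomb X Y n b v) (scale C (v n) (b n))"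

context
  fixes X Y :: 'o and b :: "nat \<Rightarrow> 'm"
  assumes b: "\<And>i. b i \<in> Hom C X Y"
begin

lemma lincomb_Hom: "lincomb X Y n b v \<in> Hom C X Y"
  using b by (induct n) (auto intro!: plus_Hom scale_Hom)

lemma lincomb_ends [simp]: "src C (lincomb X Y n b v) = X" "tgt C (lincomb X Y n b v) = Y"
  using lincomb_Hom by (simp_all add: Hom_iff)

lemma lincomb_cong: "(\<And>i. i < n \<Longrightarrow> v i = w i) \<Longrightarrow> lincomb X Y n b v = lincomb X Y n b w"
  by (induct n) auto

lemma lincomb_plus: "lincomb X Y n b (\<lambda>i. v i + w i) = plusm C (lincomb X Y n b v) (lincomb X Y n b w)"
proof (induct n)
  case (Suc n)
  show ?case
    using plus_swap[of "lincomb X Y n b v" X Y "lincomb X Y n b w" "scale C (v n) (b n)" "scale C (w n) (b n)"]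
    by (simp add: Suc scale_add lincomb_Hom scale_Hom[OF b])
qed (simp add: plus_zero)

lemma lincomb_scale: "lincomb X Y n b (\<lambda>i. a * v i) = scale C a (lincomb X Y n b v)"
  by (induct n) (simp_all add: scale_plus[OF lincomb_Hom scale_Hom[OF b]])

lemma lincomb_zero: "(\<And>i. i < n \<Longrightarrow> v i = 0) \<Longrightarrow> lincomb X Y n b v = zerom C X Y"
  by (induct n) (simp_all add: plus_zero Hom_ends[OF b])

lemma lincomb_span:
  assumes "\<And>j. j < m \<Longrightarrow> f j = lincomb X Y n b (w j)"
  shows "lincomb X Y m f c = lincomb X Y n b (\<lambda>i. \<Sum>j<m. c j * w j i)"
  using assms
proof (induct m)
  case 0
  then show ?case by (simp add: lincomb_zero)
next
  case (Suc m)
  then show ?case by (simp add: lincomb_plus lincomb_scale)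
qed

end

lemma finsum_lincomb:
  assumes "finite B" "B \<subseteq> Hom C X Y"
  shows "\<exists>n b. (\<forall>i. b i \<in> Hom C X Y) \<and> (\<forall>a. \<exists>v. finsum (hom_space C X Y) (\<lambda>b. scale C (a b) b) B = lincomb X Y n b v)"
  using assms
proof (induction B rule: finite_induct)
  case empty
  interpret H: abelian_group "hom_space C X Y" by (rule hom_abelian_group)
  show ?case
    using H.finsum_empty by (intro exI[of _ 0] exI[of _ "\<lambda>_. zerom C X Y"]) simp
next
  case (insert x B)
  interpret H: abelian_group "hom_space C X Y" by (rule hom_abelian_group)
  from insert obtain n b where nb: "\<forall>i. b i \<in> Hom C X Y"
    "\<forall>a. \<exists>v. finsum (hom_space C X Y) (\<lambda>b. scale C (a b) b) B = lincomb X Y n b v" by auto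
  have x: "x \<in> Hom C X Y" using insert by simp
  have cong: "lincomb X Y m (b(n := x)) v = lincomb X Y m b v" if "m \<le> n" for m v
    using that by (induct m) auto
  have "\<exists>v. finsum (hom_space C X Y) (\<lambda>b. scale C (a b) b) (insert x B) = lincomb X Y (Suc n) (b(n := x)) v" for a
  proof -
    obtain v where v: "finsum (hom_space C X Y) (\<lambda>b. scale C (a b) b) B = lincomb X Y n b v" using nb by blast
    have vc: "lincomb X Y n b (v(n := a x)) = lincomb X Y n b v"
      using nb by (intro lincomb_cong) auto
    have "(\<lambda>b. scale C (a b) b) \<in> B \<rightarrow> carrier (hom_space C X Y)" "scale C (a x) x \<in> carrier (hom_space C X Y)"
      using insert(4) by (auto simp: subset_iff intro!: scale_Hom)
    then have "finsum (hom_space C X Y) (\<lambda>b. scale C (a b) b) (insert x B) =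
      plusm C (scale C (a x) x) (finsum (hom_space C X Y) (\<lambda>b. scale C (a b) b) B)"
      using H.finsum_insert[of B x "\<lambda>b. scale C (a b) b"] insert(1,2) by simp
    also have "\<dots> = plusm C (lincomb X Y n b v) (scale C (a x) x)"
      unfolding v using nb x by (intro plus_comm) (auto intro!: scale_Hom lincomb_Hom)
    also have "\<dots> = lincomb X Y (Suc n) (b(n := x)) (v(n := a x))"
      using cong[of n "v(n := a x)"] vc by simp
    finally show ?thesis by blast
  qed
  moreover have "\<forall>i. (b(n := x)) i \<in> Hom C X Y" using nb x by simp
  ultimately show ?case by blast
qed

primrec endo_power :: "'m \<Rightarrow> nat \<Rightarrow> 'm" where
  "endo_power f 0 = idm C (src C f)"
| "endo_power f (Suc n) = f \<cdot> endo_power f n"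

lemma endo_power_Hom: "f \<in> Hom C X X \<Longrightarrow> endo_power f n \<in> Hom C X X"
  by (induct n) (auto simp: Hom_iff)

text \<open>Let $p(f) = 0$ and let $\alpha$ be a root of $p$.  Either $f = \alpha$, or $f - \alpha$ is invertible and
  can be cancelled from $p(f) = (f - \alpha)\,q(f)$, which lowers the degree.\<close>

lemma poly_scalar:
  assumes f: "f \<in> Hom C X X" and nz: "idm C X \<noteq> zerom C X X"
    and div: "\<And>g. g \<in> Hom C X X \<Longrightarrow> g \<noteq> zerom C X X \<Longrightarrow> iso_arrow C g"
    and p: "p \<noteq> 0" "degree p < n" "lincomb X X n (endo_power f) (coeff p) = zerom C X X"
  shows "\<exists>a. f = scale C a (idm C X)"
  using p
proof (induction n arbitrary: p)
  case (Suc n)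
  let ?b = "endo_power f" and ?L = "\<lambda>n. lincomb X X n (endo_power f)"
  have b: "?b i \<in> Hom C X X" for i using endo_power_Hom[OF f] .
  note lc = lincomb_Hom[where b="endo_power f", OF b] lincomb_plus[where b="endo_power f", OF b]
    lincomb_scale[where b="endo_power f", OF b]
  note [simp] = lincomb_ends[where b="endo_power f", OF b] Hom_ends[OF f]
  show ?case
  proof (cases "degree p = 0")
    case True
    then obtain c where c: "p = [:c:]" "c \<noteq> 0" using Suc.prems(1) by (metis degree_eq_zeroE pCons_eq_0_iff)
    have "?L (Suc m) (coeff [:c:]) = scale C c (idm C X)" for m
    proof (induct m)
      case 0
      show ?case using plus_zero(2)[OF scale_Hom[of "idm C X" X X c]] by (simp add: Hom_iff)
    next
      case (Suc k)
      have "?L (Suc (Suc k)) (coeff [:c:]) = plusm C (scale C c (idm C X)) (scale C 0 (?b (Suc k)))"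
        unfolding lincomb.simps(2)[of X X "Suc k"] Suc by simp
      also have "\<dots> = scale C c (idm C X)"
        using Hom_ends[OF b[of "Suc k"]] plus_zero(1)[OF scale_Hom[of "idm C X" X X c]] by (simp add: Hom_iff)
      finally show ?case .
    qed
    then have "scale C c (idm C X) = zerom C X X" using Suc.prems c by simp
    then have "scale C (1 / c) (scale C c (idm C X)) = zerom C X X" by simp
    then show ?thesis using c nz by simp
  next
    case False
    then obtain \<alpha> where "poly p \<alpha> = 0"
      using fundamental_theorem_of_algebra[of p] constant_degree[of p] by auto
    then obtain q where q: "p = [:-\<alpha>, 1:] * q" using poly_eq_0_iff_dvd[of p \<alpha>] by (auto elim: dvdE)
    have q0: "q \<noteq> 0" using Suc.prems(1) q by auto
    have dq: "degree q < n" using Suc.prems(2) q q0 degree_mult_eq[of "[:-\<alpha>, 1:]" q] by simp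
    have shift: "?L (Suc m) (coeff (pCons 0 q)) = f \<cdot> ?L m (coeff q)" for m
    proof (induct m)
      case (Suc m)
      have "?L (Suc (Suc m)) (coeff (pCons 0 q)) = plusm C (f \<cdot> ?L m (coeff q)) (scale C (coeff q m) (f \<cdot> ?b m))"
        using Suc by simp
      also have "\<dots> = f \<cdot> ?L (Suc m) (coeff q)" using Hom_ends[OF b[of m]] by simp
      finally show ?case .
    qed (simp add: plus_zero)
    have "p = pCons 0 q + smult (-\<alpha>) q" using q by simp
    then have "coeff p = (\<lambda>i. coeff (pCons 0 q) i + (-\<alpha>) * coeff q i)" by (metis coeff_add coeff_smult)
    then have "zerom C X X = ?L (Suc n) (\<lambda>i. coeff (pCons 0 q) i + (-\<alpha>) * coeff q i)"
      using Suc.prems(3) by metis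
    also have "\<dots> = plusm C (?L (Suc n) (coeff (pCons 0 q))) (scale C (-\<alpha>) (?L (Suc n) (coeff q)))"
      by (simp only: lc)
    also have "?L (Suc n) (coeff q) = ?L n (coeff q)"
      using dq Hom_ends[OF b[of n]] plus_zero(1)[OF lc(1)] by (simp add: coeff_eq_0)
    also have "plusm C (?L (Suc n) (coeff (pCons 0 q))) (scale C (-\<alpha>) (?L n (coeff q))) =
      plusm C f (scale C (-\<alpha>) (idm C X)) \<cdot> ?L n (coeff q)"
      unfolding shift by simp
    finally have z: "plusm C f (scale C (-\<alpha>) (idm C X)) \<cdot> ?L n (coeff q) = zerom C X X" by simp
    show ?thesis
    proof (cases "plusm C f (scale C (-\<alpha>) (idm C X)) = zerom C X X")
      case True
      then have "f = scale C \<alpha> (idm C X)"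
        by (intro diff_zero_eq[OF f]) (simp_all add: Hom_iff)
      then show ?thesis by blast
    next
      case False
      then have i: "iso_arrow C (plusm C f (scale C (-\<alpha>) (idm C X)))"
        by (intro div) (simp_all add: Hom_iff)
      have "?L n (coeff q) = zerom C X X"
        by (rule iso_cancel_left[OF i]) (use z in simp_all)
      then show ?thesis using Suc.IH[OF q0 dq] by simp
    qed
  qed
qed simp

end

context fusion_category
begin

text \<open>The kernel is a subobject of a simple object.  If it were everything, the arrow would be zero; so it is
  zero, and the arrow is monic because differences of arrows factor through the kernel.\<close>

lemma simple_monic:
  assumes "simple_obj C S" "f \<in> Hom C S Y" "f \<noteq> zerom C S Y"
  shows "Defs.monic C f"
proof -
  obtain k where k: "is_kernel C k f" using ex_kernel by blast
  note [simp] = Hom_ends[OF assms(2)]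
  have k1: "tgt C k = src C f \<and> f \<cdot> k = zerom C (src C k) (tgt C f)"
    and all: "\<forall>h. tgt C h = src C f \<and> f \<cdot> h = zerom C (src C h) (tgt C f) \<longrightarrow>
       (\<exists>!u. u \<in> Hom C (src C h) (src C k) \<and> k \<cdot> u = h)"
    using k unfolding is_kernel_def by blast+
  have kS: "tgt C k = S" "f \<cdot> k = zerom C (src C k) Y" using k1 by simp_all
  have un: "\<exists>!u. u \<in> Hom C (src C h) (src C k) \<and> k \<cdot> u = h" if "tgt C h = S" "f \<cdot> h = zerom C (src C h) Y" for h
    by (rule all[rule_format]) (use that in simp)
  have "Defs.monic C k" unfolding Defs.monic_def
  proof (intro allI impI)
    fix g h assume a: "tgt C g = src C k \<and> tgt C h = src C k \<and> src C g = src C h \<and> k \<cdot> g = k \<cdot> h"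
    have z: "f \<cdot> (k \<cdot> g) = zerom C (src C g) Y"
      using cmp_reduce[OF kS(2), of g] a kS(1) by simp
    have "\<exists>!u. u \<in> Hom C (src C (k \<cdot> g)) (src C k) \<and> k \<cdot> u = k \<cdot> g"
      by (rule un) (use a kS(1) z in simp_all)
    moreover have "g \<in> Hom C (src C (k \<cdot> g)) (src C k)" "h \<in> Hom C (src C (k \<cdot> g)) (src C k)" "k \<cdot> h = k \<cdot> g"
      using a by (simp_all add: Hom_iff)
    ultimately show "g = h" by blast
  qed
  then have "zero_object C (src C k) \<or> iso_arrow C k" using assms(1) kS(1) unfolding simple_obj_def by blast
  then show ?thesis
  proof
    assume "iso_arrow C k"
    then have "f = zerom C S Y"
      by (rule iso_cancel_right) (simp_all add: kS)
    then show ?thesis using assms(3) by simp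
  next
    assume z: "zero_object C (src C k)"
    show ?thesis unfolding Defs.monic_def
    proof (intro allI impI)
      fix g h assume a: "tgt C g = src C f \<and> tgt C h = src C f \<and> src C g = src C h \<and> f \<cdot> g = f \<cdot> h"
      let ?d = "plusm C g (scale C (-1) h)"
      have gh: "g \<in> Hom C (src C g) S" "h \<in> Hom C (src C g) S" using a by (simp_all add: Hom_iff)
      have d: "?d \<in> Hom C (src C g) S" by (rule plus_Hom[OF gh(1) scale_Hom[OF gh(2)]])
      have fh: "f \<cdot> h \<in> Hom C (src C g) Y" by (rule cmp_Hom[OF gh(2) assms(2)])
      have "f \<cdot> ?d = plusm C (f \<cdot> g) (f \<cdot> scale C (-1) h)"
        by (rule cmp_plus_right[OF gh(1) scale_Hom[OF gh(2)] assms(2)])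
      also have "f \<cdot> scale C (-1) h = scale C (-1) (f \<cdot> h)" by (rule cmp_scale_right[OF gh(2) assms(2)])
      also have "f \<cdot> g = f \<cdot> h" using a by blast
      also have "plusm C (f \<cdot> h) (scale C (-1) (f \<cdot> h)) = zerom C (src C g) Y" by (rule plus_neg[OF fh])
      finally have "f \<cdot> ?d = zerom C (src C ?d) Y" unfolding Hom_ends(1)[OF d] .
      then obtain u where u: "u \<in> Hom C (src C ?d) (src C k)" "k \<cdot> u = ?d"
        using un[OF Hom_ends(2)[OF d]] by blast
      have "u = zerom C (src C g) (src C k)" using zero_objectD[OF z u(1)] unfolding Hom_ends(1)[OF d] .
      then have "?d = k \<cdot> zerom C (src C g) (src C k)" using u(2) by metis
      also have "\<dots> = zerom C (src C g) S" unfolding cmp_zero[OF refl] kS(1) ..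
      finally have "?d = zerom C (src C g) S" .
      then show "g = h" by (rule diff_zero_eq[OF gh])
    qed
  qed
qed

lemma simple_iso:
  assumes "simple_obj C S" "simple_obj C T" "f \<in> Hom C S T" "f \<noteq> zerom C S T"
  shows "iso_arrow C f"
proof -
  have "\<forall>g. Defs.monic C g \<and> tgt C g = T \<longrightarrow> zero_object C (src C g) \<or> iso_arrow C g"
    using assms(2) unfolding simple_obj_def by blast
  from this[rule_format, of f] have "zero_object C S \<or> iso_arrow C f"
    using simple_monic[OF assms(1,3,4)] Hom_ends[OF assms(3)] by simp
  moreover have "\<not> zero_object C S" using assms(1) unfolding simple_obj_def by (rule conjunct1)
  ultimately show ?thesis by simp
qed

text \<open>Powers of $f$ lie in a finite-dimensional space, so some non-zero polynomial annihilates $f$.\<close>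

lemma schur_ex:
  assumes S: "simple_obj C S" and f: "f \<in> Hom C S S"
  shows "\<exists>a. f = scale C a (idm C S)"
proof -
  obtain B where B: "finite B" "B \<subseteq> Hom C S S"
    "\<forall>f\<in>Hom C S S. \<exists>a. f = finsum (hom_space C S S) (\<lambda>b. scale C (a b) b) B"
    using hom_finite_dim[of S S] by blast
  obtain n b where b: "\<And>i. b i \<in> Hom C S S"
    "\<forall>a. \<exists>v. finsum (hom_space C S S) (\<lambda>b. scale C (a b) b) B = lincomb S S n b v"
    using finsum_lincomb[OF B(1,2)] by blast
  have "\<forall>j. \<exists>v. endo_power f j = lincomb S S n b v"
  proof
    fix j
    obtain a where "endo_power f j = finsum (hom_space C S S) (\<lambda>b. scale C (a b) b) B"
      using B(3) endo_power_Hom[OF f] by blast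
    then show "\<exists>v. endo_power f j = lincomb S S n b v" using b(2)[rule_format, of a] by simp
  qed
  from choice[OF this] obtain w where w: "\<And>j. endo_power f j = lincomb S S n b (w j)" by blast
  obtain c where c: "\<exists>j\<le>n. c j \<noteq> 0" "\<forall>i<n. (\<Sum>j\<le>n. c j * w j i) = 0"
    using dependent_vectors[of n w] by blast
  have "lincomb S S (Suc n) (endo_power f) c = lincomb S S n b (\<lambda>i. \<Sum>j<Suc n. c j * w j i)"
    by (rule lincomb_span[where b=b, OF b(1) w])
  also have "\<dots> = zerom C S S" by (rule lincomb_zero[where b=b, OF b(1)]) (simp only: lessThan_Suc_atMost c(2)[rule_format])
  finally have z: "lincomb S S (Suc n) (endo_power f) c = zerom C S S" .
  define p where "p = Abs_poly (\<lambda>i. if i \<le> n then c i else 0)"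
  have cp: "coeff p = (\<lambda>i. if i \<le> n then c i else 0)"
    unfolding p_def by (rule coeff_Abs_poly[of n]) simp
  obtain j where "j \<le> n" "c j \<noteq> 0" using c(1) by blast
  then have "coeff p j \<noteq> 0" by (simp add: cp)
  then have p0: "p \<noteq> 0" by auto
  have dp: "degree p < Suc n"
    unfolding less_Suc_eq_le by (rule degree_le) (simp add: cp)
  have pf: "lincomb S S (Suc n) (endo_power f) (coeff p) = zerom C S S"
  proof -
    have "lincomb S S (Suc n) (endo_power f) (coeff p) = lincomb S S (Suc n) (endo_power f) c"
      by (rule lincomb_cong[where b="endo_power f", OF endo_power_Hom[OF f]]) (simp add: cp)
    then show ?thesis using z by metis
  qed
  have "iso_arrow C g" if "g \<in> Hom C S S" "g \<noteq> zerom C S S" for g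
    by (rule simple_iso[OF S S that])
  from poly_scalar[OF f simple_id_nonzero[OF S] this p0 dp pf] show ?thesis by simp
qed

definition schur :: "'o \<Rightarrow> 'm \<Rightarrow> complex" where
  "schur S f = (SOME a. f = scale C a (idm C S))"

lemma schur: "simple_obj C S \<Longrightarrow> f \<in> Hom C S S \<Longrightarrow> f = scale C (schur S f) (idm C S)"
  unfolding schur_def by (rule someI_ex[OF schur_ex])

lemma scale_inj:
  assumes "f \<noteq> zerom C (src C f) (tgt C f)" "scale C a f = scale C b f"
  shows "a = b"
proof (rule ccontr)
  assume ne: "a \<noteq> b"
  have "scale C (a - b) f = plusm C (scale C b f) (scale C (-1) (scale C b f))"
    using scale_add[of a "-b" f] assms(2) by simp
  also have "\<dots> = zerom C (src C f) (tgt C f)" by (rule plus_neg) (simp add: Hom_iff)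
  finally have "scale C (1 / (a - b)) (scale C (a - b) f) = zerom C (src C f) (tgt C f)" by simp
  then show False using ne assms(1) by simp
qed

lemma schur_unique: "simple_obj C S \<Longrightarrow> schur S (scale C a (idm C S)) = a"
  using scale_inj[OF _ schur[of S "scale C a (idm C S)"], symmetric] simple_id_nonzero[of S] by (simp add: Hom_iff)

lemma schur_id [simp]: "simple_obj C S \<Longrightarrow> schur S (idm C S) = 1"
  using schur_unique[of S 1] by simp

lemma linfun_schur:
  assumes "simple_obj C S"
  shows "linfun S S (schur S)"
  unfolding linfun_def
proof (intro conjI ballI allI)
  fix f g assume f: "f \<in> Hom C S S" and g: "g \<in> Hom C S S"
  have "plusm C f g = plusm C (scale C (schur S f) (idm C S)) (scale C (schur S g) (idm C S))"
    by (rule arg_cong2[OF schur[OF assms f] schur[OF assms g]])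
  then show "schur S (plusm C f g) = schur S f + schur S g"
    using schur_unique[OF assms] by (simp add: scale_add[symmetric])
next
  fix a f assume f: "f \<in> Hom C S S"
  have "scale C a f = scale C a (scale C (schur S f) (idm C S))"
    by (rule arg_cong[OF schur[OF assms f]])
  then show "schur S (scale C a f) = a * schur S f" using schur_unique[OF assms] by simp
qed

end

section \<open>Multiplicities\<close>

context linear_category
begin

lemma finsum_linmap_zero:
  assumes "finite A" "\<And>k. k \<in> A \<Longrightarrow> x k \<in> Hom C X Y" "linmap X Y X' Y' \<phi>"
    "\<And>k. k \<in> A \<Longrightarrow> \<phi> (x k) = zerom C X' Y'"
  shows "\<phi> (finsum (hom_space C X Y) x A) = zerom C X' Y'"
proof -
  interpret H: abelian_group "hom_space C X Y" by (rule hom_abelian_group)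
  have z: "\<phi> (zerom C X Y) = zerom C X' Y'"
  proof -
    have "\<phi> (scale C 0 (zerom C X Y)) = scale C 0 (\<phi> (zerom C X Y))"
      using assms(3) zero_Hom[of X Y] unfolding linmap_def by blast
    then show ?thesis using Hom_ends[OF linmap_Hom[OF assms(3) zero_Hom]] by simp
  qed
  show ?thesis using assms(1,2,4)
  proof (induction A rule: finite_induct)
    case empty
    then show ?case using z by simp
  next
    case (insert k A)
    have k: "x k \<in> Hom C X Y" "finsum (hom_space C X Y) x A \<in> Hom C X Y"
      using H.finsum_closed[of x A] insert(4) by auto
    have "finsum (hom_space C X Y) x (insert k A) = plusm C (x k) (finsum (hom_space C X Y) x A)"
      using H.finsum_insert[of A k x] insert by auto
    then have "\<phi> (finsum (hom_space C X Y) x (insert k A)) = plusm C (\<phi> (x k)) (\<phi> (finsum (hom_space C X Y) x A))"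
      using assms(3) k unfolding linmap_def by simp
    then show ?case using insert plus_zero(1)[OF zero_Hom] by simp
  qed
qed

text \<open>The sum of the idempotents in a direct sum is only used through its images under linear functionals and
  linear maps.\<close>

lemma direct_sumE:
  assumes "direct_sum C X Ss"
  obtains i p where "\<And>k. k < length Ss \<Longrightarrow> i k \<in> Hom C (Ss ! k) X" "\<And>k. k < length Ss \<Longrightarrow> p k \<in> Hom C X (Ss ! k)"
    "\<And>j k. j < length Ss \<Longrightarrow> k < length Ss \<Longrightarrow> p j \<cdot> i k = (if j = k then idm C (Ss ! k) else zerom C (Ss ! k) (Ss ! j))"
    "\<And>\<psi>. linfun X X \<psi> \<Longrightarrow> \<psi> (idm C X) = (\<Sum>k<length Ss. \<psi> (i k \<cdot> p k))"
    "\<And>\<phi> X' Y'. linmap X X X' Y' \<phi> \<Longrightarrow> (\<And>k. k < length Ss \<Longrightarrow> \<phi> (i k \<cdot> p k) = zerom C X' Y') \<Longrightarrow> \<phi> (idm C X) = zerom C X' Y'"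
    "length Ss = 1 \<Longrightarrow> i 0 \<cdot> p 0 = idm C X"
proof -
  from assms obtain i p where 1: "\<forall>k<length Ss. i k \<in> Hom C (Ss ! k) X \<and> p k \<in> Hom C X (Ss ! k)"
     "\<forall>j<length Ss. \<forall>k<length Ss. p j \<cdot> i k = (if j = k then idm C (Ss ! k) else zerom C (Ss ! k) (Ss ! j))"
     and s: "finsum (hom_space C X X) (\<lambda>k. i k \<cdot> p k) {..<length Ss} = idm C X"
    unfolding direct_sum_def by blast
  have 2: "i k \<cdot> p k \<in> Hom C X X" if "k \<in> {..<length Ss}" for k
    using 1(1) that by (auto simp: Hom_iff)
  interpret H: abelian_group "hom_space C X X" by (rule hom_abelian_group)
  show ?thesis
  proof (rule that[of i p])
    show "\<psi> (idm C X) = (\<Sum>k<length Ss. \<psi> (i k \<cdot> p k))" if "linfun X X \<psi>" for \<psi>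
      unfolding s[symmetric] by (rule finsum_Hom_and_linfun(2)[OF _ 2 that]) simp_all
    show "\<phi> (idm C X) = zerom C X' Y'" if "linmap X X X' Y' \<phi>"
      "\<And>k. k < length Ss \<Longrightarrow> \<phi> (i k \<cdot> p k) = zerom C X' Y'" for \<phi> X' Y'
      unfolding s[symmetric] by (rule finsum_linmap_zero[OF _ 2 that(1)]) (simp_all add: that(2))
    show "i 0 \<cdot> p 0 = idm C X" if "length Ss = 1"
    proof -
      have "finsum (hom_space C X X) (\<lambda>k. i k \<cdot> p k) {0} = i 0 \<cdot> p 0"
        using H.finsum_singleton[of 0 "{0}" "\<lambda>k. i k \<cdot> p k"] H.finsum_insert[of "{}" 0 "\<lambda>k. i k \<cdot> p k"] 2[of 0] that
          plus_zero(1)[of "i 0 \<cdot> p 0" X X] by simp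
      moreover have "{..<length Ss} = {0}" using that by auto
      ultimately show ?thesis using s by simp
    qed
  qed (use 1 in auto)
qed

lemma direct_sum_single:
  assumes "isomorphic C Y X"
  shows "direct_sum C X [Y]"
proof -
  interpret H: abelian_group "hom_space C X X" by (rule hom_abelian_group)
  obtain f where f: "f \<in> Hom C Y X" "iso_arrow C f" using assms by (auto simp: isomorphic_def)
  note [simp] = Hom_ends[OF f(1)] f(2)
  have "finsum (hom_space C X X) (\<lambda>k::nat. f \<cdot> inv_arrow C f) (insert 0 {}) = idm C X"
    using H.finsum_insert[of "{}" "0::nat" "\<lambda>k. f \<cdot> inv_arrow C f"] plus_zero(1)[of "idm C X" X X]
    by (simp add: Hom_iff)
  moreover have "{..<length [Y]} = insert 0 {}" by auto
  ultimately show ?thesis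
    unfolding direct_sum_def
    by (intro exI[of _ "\<lambda>_. f"] exI[of _ "\<lambda>_. inv_arrow C f"]) (simp add: Hom_iff)
qed

end

context fusion_category
begin

text \<open>By Schur's lemma a summand contributes one dimension if it is isomorphic to $W$, and nothing otherwise.
  The second half, for arrows into $W$, is what lets Frobenius reciprocity exchange the two arguments.\<close>

lemma hom_dim_decomposition:
  assumes W: "simple_obj C W" and Z: "direct_sum C Z Ss" and Ss: "\<forall>S\<in>set Ss. simple_obj C S"
  shows "hom_dim W Z (card {k. k < length Ss \<and> isomorphic C W (Ss ! k)})"
    and "hom_dim Z W (card {k. k < length Ss \<and> isomorphic C W (Ss ! k)})"
proof -
  let ?n = "length Ss" and ?J = "{k. k < length Ss \<and> isomorphic C W (Ss ! k)}"
  obtain i p where i: "\<And>k. k < ?n \<Longrightarrow> i k \<in> Hom C (Ss ! k) Z" and p: "\<And>k. k < ?n \<Longrightarrow> p k \<in> Hom C Z (Ss ! k)"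
    and pi: "\<And>j k. j < ?n \<Longrightarrow> k < ?n \<Longrightarrow> p j \<cdot> i k = (if j = k then idm C (Ss ! k) else zerom C (Ss ! k) (Ss ! j))"
    and sum: "\<And>\<psi>. linfun Z Z \<psi> \<Longrightarrow> \<psi> (idm C Z) = (\<Sum>k<?n. \<psi> (i k \<cdot> p k))"
    by (rule direct_sumE[OF Z]) blast
  have "\<forall>k\<in>?J. \<exists>t. t \<in> Hom C W (Ss ! k) \<and> iso_arrow C t" by (auto simp: isomorphic_def)
  from bchoice[OF this] obtain t where t0: "\<forall>k\<in>?J. t k \<in> Hom C W (Ss ! k) \<and> iso_arrow C (t k)" by blast
  have t: "t k \<in> Hom C W (Ss ! k)" "iso_arrow C (t k)" "k < ?n" if "k \<in> ?J" for k using t0 that by auto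
  have fJ: "finite ?J" by simp
  have ends: "src C (i k) = Ss ! k" "tgt C (i k) = Z" "src C (p k) = Z" "tgt C (p k) = Ss ! k" if "k < ?n" for k
    using i[OF that] p[OF that] by (simp_all add: Hom_iff)
  have tends: "src C (t k) = W" "tgt C (t k) = Ss ! k" if "k \<in> ?J" for k using t(1)[OF that] by (simp_all add: Hom_iff)
  have zero: "f = zerom C W (Ss ! k)" if "k < ?n" "k \<notin> ?J" "f \<in> Hom C W (Ss ! k)" for k f
  proof (rule ccontr)
    assume "f \<noteq> zerom C W (Ss ! k)"
    then have "iso_arrow C f" using simple_iso[OF W _ that(3)] Ss that(1) by auto
    then show False using that by (auto simp: isomorphic_def)
  qed
  have zero': "f = zerom C (Ss ! k) W" if "k < ?n" "k \<notin> ?J" "f \<in> Hom C (Ss ! k) W" for k f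
  proof (rule ccontr)
    assume "f \<noteq> zerom C (Ss ! k) W"
    then have "iso_arrow C f" using simple_iso[OF _ W that(3)] Ss that(1) by auto
    then have "isomorphic C W (Ss ! k)" using that(3) by (metis isomorphic_def isomorphic_sym)
    then show False using that by auto
  qed
  have "hom_frame W Z ?J (\<lambda>k. i k \<cdot> t k) (\<lambda>k h. schur W (inv_arrow C (t k) \<cdot> (p k \<cdot> h)))"
    unfolding hom_frame_def
  proof (intro conjI ballI allI impI fJ)
    fix k assume k: "k \<in> ?J"
    note kn = t(3)[OF k]
    show "i k \<cdot> t k \<in> Hom C W Z" by (rule cmp_Hom[OF t(1)[OF k] i[OF kn]])
    have "inv_arrow C (t k) \<in> Hom C (Ss ! k) W" using t(2)[OF k] tends[OF k] by (simp add: Hom_iff)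
    then show "linfun W Z (\<lambda>h. schur W (inv_arrow C (t k) \<cdot> (p k \<cdot> h)))"
      by (rule linfun_linmap[OF linfun_schur[OF W] linmap_comp[OF linmap_cmp_left[OF p[OF kn]] linmap_cmp_left]])
    have "p k \<cdot> (i k \<cdot> t k) = t k"
      using cmp_reduce[of "p k" "i k" "idm C (Ss ! k)" "t k"] pi[OF kn kn] ends[OF kn] tends[OF k] by simp
    then show "schur W (inv_arrow C (t k) \<cdot> (p k \<cdot> (i k \<cdot> t k))) = 1"
      using t(2)[OF k] tends[OF k] W by simp
  next
    fix \<psi> h assume \<psi>: "linfun W Z \<psi>" and h: "h \<in> Hom C W Z"
    have "\<psi> (idm C Z \<cdot> h) = (\<Sum>k<?n. \<psi> ((i k \<cdot> p k) \<cdot> h))"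
      by (rule sum[OF linfun_linmap[OF \<psi> linmap_cmp_right[OF h]]])
    also have "\<dots> = (\<Sum>k<?n. if k \<in> ?J then schur W (inv_arrow C (t k) \<cdot> (p k \<cdot> h)) * \<psi> (i k \<cdot> t k) else 0)"
    proof (rule sum.cong[OF refl])
      fix k assume "k \<in> {..<?n}"
      then have kn: "k < ?n" by simp
      have ph: "p k \<cdot> h \<in> Hom C W (Ss ! k)" by (rule cmp_Hom[OF h p[OF kn]])
      have a: "(i k \<cdot> p k) \<cdot> h = i k \<cdot> (p k \<cdot> h)" using ends[OF kn] Hom_ends[OF h] by (intro assoc_cmp) simp_all
      show "\<psi> ((i k \<cdot> p k) \<cdot> h) = (if k \<in> ?J then schur W (inv_arrow C (t k) \<cdot> (p k \<cdot> h)) * \<psi> (i k \<cdot> t k) else 0)"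
      proof (cases "k \<in> ?J")
        case True
        let ?g = "inv_arrow C (t k) \<cdot> (p k \<cdot> h)"
        have g: "?g \<in> Hom C W W" using t(2)[OF True] tends[OF True] ends[OF kn] Hom_ends[OF h] by (simp add: Hom_iff)
        have "p k \<cdot> h = t k \<cdot> ?g" using t(2)[OF True] tends[OF True] ends[OF kn] Hom_ends[OF h] by simp
        also have "\<dots> = t k \<cdot> scale C (schur W ?g) (idm C W)" by (rule arg_cong[OF schur[OF W g]])
        also have "\<dots> = scale C (schur W ?g) (t k)" using tends[OF True] by simp
        finally have "i k \<cdot> (p k \<cdot> h) = i k \<cdot> scale C (schur W ?g) (t k)" by (rule arg_cong)
        also have "\<dots> = scale C (schur W ?g) (i k \<cdot> t k)" using tends[OF True] ends[OF kn] by simp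
        finally have "\<psi> (i k \<cdot> (p k \<cdot> h)) = schur W ?g * \<psi> (i k \<cdot> t k)"
          using linfun_scale[OF \<psi> cmp_Hom[OF t(1)[OF True] i[OF kn]]] by simp
        then show ?thesis using True a by simp
      next
        case False
        have "\<psi> ((i k \<cdot> p k) \<cdot> h) = 0"
          unfolding a using zero[OF kn False ph] ends[OF kn] linfun_zero[OF \<psi>] by simp
        then show ?thesis by (simp only: False if_False)
      qed
    qed
    also have "\<dots> = (\<Sum>k\<in>?J. schur W (inv_arrow C (t k) \<cdot> (p k \<cdot> h)) * \<psi> (i k \<cdot> t k))"
      by (rule sum.mono_neutral_cong_right) auto
    finally show "\<psi> h = (\<Sum>k\<in>?J. schur W (inv_arrow C (t k) \<cdot> (p k \<cdot> h)) * \<psi> (i k \<cdot> t k))"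
      using Hom_ends[OF h] by simp
  qed
  then show "hom_dim W Z (card ?J)" by (auto simp: hom_dim_def)
  have "hom_frame Z W ?J (\<lambda>k. inv_arrow C (t k) \<cdot> p k) (\<lambda>k h. schur W ((h \<cdot> i k) \<cdot> t k))"
    unfolding hom_frame_def
  proof (intro conjI ballI allI impI fJ)
    fix k assume k: "k \<in> ?J"
    note kn = t(3)[OF k]
    have it: "inv_arrow C (t k) \<in> Hom C (Ss ! k) W" using t(2)[OF k] tends[OF k] by (simp add: Hom_iff)
    show "inv_arrow C (t k) \<cdot> p k \<in> Hom C Z W" by (rule cmp_Hom[OF p[OF kn] it])
    show "linfun Z W (\<lambda>h. schur W ((h \<cdot> i k) \<cdot> t k))"
      by (rule linfun_linmap[OF linfun_schur[OF W] linmap_comp[OF linmap_cmp_right[OF i[OF kn]] linmap_cmp_right[OF t(1)[OF k]]]])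
    have "(inv_arrow C (t k) \<cdot> p k) \<cdot> i k = inv_arrow C (t k)"
      using pi[OF kn kn] ends[OF kn] tends[OF k] t(2)[OF k] by (simp add: assoc_cmp)
    then show "schur W (((inv_arrow C (t k) \<cdot> p k) \<cdot> i k) \<cdot> t k) = 1"
      using t(2)[OF k] tends[OF k] W by simp
  next
    fix \<psi> h assume \<psi>: "linfun Z W \<psi>" and h: "h \<in> Hom C Z W"
    have "\<psi> (h \<cdot> idm C Z) = (\<Sum>k<?n. \<psi> (h \<cdot> (i k \<cdot> p k)))"
      by (rule sum[OF linfun_linmap[OF \<psi> linmap_cmp_left[OF h]]])
    also have "\<dots> = (\<Sum>k<?n. if k \<in> ?J then schur W ((h \<cdot> i k) \<cdot> t k) * \<psi> (inv_arrow C (t k) \<cdot> p k) else 0)"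
    proof (rule sum.cong[OF refl])
      fix k assume "k \<in> {..<?n}"
      then have kn: "k < ?n" by simp
      have hi: "h \<cdot> i k \<in> Hom C (Ss ! k) W" by (rule cmp_Hom[OF i[OF kn] h])
      have a: "h \<cdot> (i k \<cdot> p k) = (h \<cdot> i k) \<cdot> p k" using ends[OF kn] Hom_ends[OF h] by (intro assoc_cmp[symmetric]) simp_all
      show "\<psi> (h \<cdot> (i k \<cdot> p k)) = (if k \<in> ?J then schur W ((h \<cdot> i k) \<cdot> t k) * \<psi> (inv_arrow C (t k) \<cdot> p k) else 0)"
      proof (cases "k \<in> ?J")
        case True
        let ?g = "(h \<cdot> i k) \<cdot> t k"
        note e = tends[OF True] ends[OF kn] Hom_ends[OF h] t(2)[OF True]
        have g: "?g \<in> Hom C W W" using e by (simp add: Hom_iff)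
        have "h \<cdot> i k = ?g \<cdot> inv_arrow C (t k)" using e by (simp add: assoc_cmp)
        also have "\<dots> = scale C (schur W ?g) (idm C W) \<cdot> inv_arrow C (t k)" by (rule arg_cong[OF schur[OF W g]])
        also have "\<dots> = scale C (schur W ?g) (inv_arrow C (t k))" using e by simp
        finally have "(h \<cdot> i k) \<cdot> p k = scale C (schur W ?g) (inv_arrow C (t k)) \<cdot> p k" by (rule arg_cong)
        also have "\<dots> = scale C (schur W ?g) (inv_arrow C (t k) \<cdot> p k)" using e by simp
        finally have "\<psi> ((h \<cdot> i k) \<cdot> p k) = schur W ?g * \<psi> (inv_arrow C (t k) \<cdot> p k)"
          using linfun_scale[OF \<psi>, of "inv_arrow C (t k) \<cdot> p k"] e by (simp add: Hom_iff)
        then show ?thesis using True a by simp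
      next
        case False
        have "\<psi> (h \<cdot> (i k \<cdot> p k)) = 0"
          unfolding a using zero'[OF kn False hi] ends[OF kn] linfun_zero[OF \<psi>] by simp
        then show ?thesis by (simp only: False if_False)
      qed
    qed
    also have "\<dots> = (\<Sum>k\<in>?J. schur W ((h \<cdot> i k) \<cdot> t k) * \<psi> (inv_arrow C (t k) \<cdot> p k))"
      by (rule sum.mono_neutral_cong_right) auto
    finally show "\<psi> h = (\<Sum>k\<in>?J. schur W ((h \<cdot> i k) \<cdot> t k) * \<psi> (inv_arrow C (t k) \<cdot> p k))"
      using Hom_ends[OF h] by simp
  qed
  then show "hom_dim Z W (card ?J)" by (auto simp: hom_dim_def)
qed

definition hom_mult :: "'o \<Rightarrow> 'o \<Rightarrow> nat" where
  "hom_mult W Z = (THE n. hom_dim W Z n)"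

lemma hom_mult_eqI: "hom_dim W Z n \<Longrightarrow> hom_mult W Z = n"
  unfolding hom_mult_def by (rule the_equality) (auto intro: hom_dim_unique)

lemma hom_mult_decomposition:
  assumes "simple_obj C W" "direct_sum C Z Ss" "\<forall>S\<in>set Ss. simple_obj C S"
  shows "hom_mult W Z = card {k. k < length Ss \<and> isomorphic C W (Ss ! k)}"
  by (rule hom_mult_eqI[OF hom_dim_decomposition(1)[OF assms]])

lemma hom_dim_hom_mult:
  assumes "simple_obj C W"
  shows "hom_dim W Z (hom_mult W Z)" "hom_dim Z W (hom_mult W Z)"
proof -
  obtain Ss where "\<forall>S\<in>set Ss. simple_obj C S" "direct_sum C Z Ss" using semisimple[of Z] by blast
  then show "hom_dim W Z (hom_mult W Z)" "hom_dim Z W (hom_mult W Z)"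
    using hom_dim_decomposition[OF assms, of Z Ss] hom_mult_decomposition[OF assms, of Z Ss] by simp_all
qed

lemma isomorphic_simple:
  assumes "simple_obj C S" "isomorphic C S X"
  shows "simple_obj C X"
proof -
  obtain g where g: "g \<in> Hom C S X" "iso_arrow C g" using assms(2) by (auto simp: isomorphic_def)
  note [simp] = Hom_ends[OF g(1)] g(2)
  have S: "\<not> zero_object C S" "\<forall>f. Defs.monic C f \<and> tgt C f = S \<longrightarrow> zero_object C (src C f) \<or> iso_arrow C f"
    using assms(1) unfolding simple_obj_def by blast+
  have "\<not> zero_object C X"
  proof
    assume "zero_object C X"
    then have "idm C X = zerom C X X" by (rule zero_objectD) (simp add: Hom_iff)
    then have "inv_arrow C g \<cdot> idm C X \<cdot> g = zerom C S S" by simp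
    then show False using simple_id_nonzero[OF assms(1)] by simp
  qed
  moreover have "zero_object C (src C f) \<or> iso_arrow C f" if "Defs.monic C f" "tgt C f = X" for f
  proof -
    let ?f = "inv_arrow C g \<cdot> f"
    have "Defs.monic C ?f" unfolding Defs.monic_def
    proof (intro allI impI)
      fix a b assume ab: "tgt C a = src C ?f \<and> tgt C b = src C ?f \<and> src C a = src C b \<and> ?f \<cdot> a = ?f \<cdot> b"
      have e: "tgt C a = src C f" "tgt C b = src C f" using ab that(2) by simp_all
      have "f \<cdot> a = g \<cdot> (?f \<cdot> a)" using e(1) that(2) by (simp add: assoc_cmp)
      also have "?f \<cdot> a = ?f \<cdot> b" using ab by blast
      also have "g \<cdot> (?f \<cdot> b) = f \<cdot> b" using e(2) that(2) by (simp add: assoc_cmp)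
      finally have "f \<cdot> a = f \<cdot> b" .
      then show "a = b" using that(1)[unfolded Defs.monic_def, rule_format, of a b] ab that(2) by simp
    qed
    then have "zero_object C (src C f) \<or> iso_arrow C ?f" using S(2)[rule_format, of ?f] that(2) by simp
    moreover have "iso_arrow C f" if i: "iso_arrow C ?f"
    proof -
      have "iso_arrow C (g \<cdot> ?f)" by (rule iso_cmp[OF i g(2)]) (simp add: \<open>tgt C f = X\<close>)
      then show ?thesis using \<open>tgt C f = X\<close> by simp
    qed
    ultimately show ?thesis by (elim disjE) simp_all
  qed
  ultimately show ?thesis unfolding simple_obj_def by blast
qed

lemma hom_mult_simple:
  assumes "simple_obj C W" "simple_obj C Y"
  shows "hom_mult W Y = of_bool (isomorphic C W Y)"
proof -
  have "hom_mult W Y = card {k. k < length [Y] \<and> isomorphic C W ([Y] ! k)}"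
    using assms by (intro hom_mult_decomposition direct_sum_single) simp_all
  also have "{k. k < length [Y] \<and> isomorphic C W ([Y] ! k)} = (if isomorphic C W Y then {0} else {})"
    by auto
  finally show ?thesis by simp
qed

lemma hom_mult_isomorphic:
  assumes "simple_obj C W" "isomorphic C Y Z"
  shows "hom_mult W Y = hom_mult W Z"
proof -
  obtain g where "g \<in> Hom C Y Z" "iso_arrow C g" using assms(2) by (auto simp: isomorphic_def)
  from hom_dim_iso_target[OF hom_dim_hom_mult(1)[OF assms(1)] this] show ?thesis by (rule hom_mult_eqI[symmetric])
qed

lemma hom_mult_isomorphic_source:
  assumes "simple_obj C W" "isomorphic C V W"
  shows "hom_mult V Z = hom_mult W Z"
proof -
  obtain g where "g \<in> Hom C V W" "iso_arrow C g" using assms(2) by (auto simp: isomorphic_def)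
  from hom_dim_iso_source[OF hom_dim_hom_mult(1)[OF assms(1)] this] show ?thesis by (rule hom_mult_eqI)
qed

lemma constituent_iff: "constituent C S X \<longleftrightarrow> simple_obj C S \<and> hom_mult S X \<noteq> 0"
proof (cases "simple_obj C S")
  case S: True
  obtain Ss where Ss: "\<forall>S\<in>set Ss. simple_obj C S" "direct_sum C X Ss" using semisimple[of X] by blast
  let ?n = "length Ss"
  obtain i p where i: "\<And>k. k < ?n \<Longrightarrow> i k \<in> Hom C (Ss ! k) X" and p: "\<And>k. k < ?n \<Longrightarrow> p k \<in> Hom C X (Ss ! k)"
    and pi: "\<And>j k. j < ?n \<Longrightarrow> k < ?n \<Longrightarrow> p j \<cdot> i k = (if j = k then idm C (Ss ! k) else zerom C (Ss ! k) (Ss ! j))"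
    and z: "\<And>\<phi> X' Y'. linmap X X X' Y' \<phi> \<Longrightarrow> (\<And>k. k < ?n \<Longrightarrow> \<phi> (i k \<cdot> p k) = zerom C X' Y') \<Longrightarrow> \<phi> (idm C X) = zerom C X' Y'"
    by (rule direct_sumE[OF Ss(2)]) blast
  have m: "hom_mult S X \<noteq> 0 \<longleftrightarrow> (\<exists>k<?n. isomorphic C S (Ss ! k))"
    unfolding hom_mult_decomposition[OF S Ss(2,1)] by auto
  have "(\<exists>f\<in>Hom C S X. Defs.monic C f) \<longleftrightarrow> (\<exists>k<?n. isomorphic C S (Ss ! k))"
  proof
    assume "\<exists>f\<in>Hom C S X. Defs.monic C f"
    then obtain f where f: "f \<in> Hom C S X" "Defs.monic C f" by blast
    note [simp] = Hom_ends[OF f(1)]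
    have fz: "f \<noteq> zerom C S X"
    proof
      assume "f = zerom C S X"
      then have "idm C S = zerom C S S"
        using f(2)[unfolded Defs.monic_def, rule_format, of "idm C S" "zerom C S S"] by simp
      then show False using simple_id_nonzero[OF S] by simp
    qed
    show "\<exists>k<?n. isomorphic C S (Ss ! k)"
    proof (rule ccontr)
      assume none: "\<not> ?thesis"
      have "idm C X \<cdot> f = zerom C S X"
      proof (rule z[OF linmap_cmp_right[OF f(1)]])
        fix k assume k: "k < ?n"
        have pf: "p k \<cdot> f \<in> Hom C S (Ss ! k)" by (rule cmp_Hom[OF f(1) p[OF k]])
        have "p k \<cdot> f = zerom C S (Ss ! k)"
        proof (rule ccontr)
          assume "p k \<cdot> f \<noteq> zerom C S (Ss ! k)"
          then have "iso_arrow C (p k \<cdot> f)" using simple_iso[OF S _ pf] Ss(1) k by simp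
          then show False using none pf k by (auto simp: isomorphic_def)
        qed
        then show "(i k \<cdot> p k) \<cdot> f = zerom C S X"
          using Hom_ends[OF i[OF k]] Hom_ends[OF p[OF k]] by (simp add: assoc_cmp)
      qed
      then show False using fz by simp
    qed
  next
    assume "\<exists>k<?n. isomorphic C S (Ss ! k)"
    then obtain k t where k: "k < ?n" "t \<in> Hom C S (Ss ! k)" "iso_arrow C t" by (auto simp: isomorphic_def)
    note e = Hom_ends[OF i[OF k(1)]] Hom_ends[OF p[OF k(1)]] Hom_ends[OF k(2)]
    have "Defs.monic C (i k \<cdot> t)" unfolding Defs.monic_def
    proof (intro allI impI)
      fix g h assume a: "tgt C g = src C (i k \<cdot> t) \<and> tgt C h = src C (i k \<cdot> t) \<and> src C g = src C h \<and> (i k \<cdot> t) \<cdot> g = (i k \<cdot> t) \<cdot> h"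
      have r: "x = inv_arrow C t \<cdot> (p k \<cdot> ((i k \<cdot> t) \<cdot> x))" if "tgt C x = S" for x
        using that e k(3) pi[OF k(1) k(1)] cmp_reduce[of "p k" "i k" "idm C (Ss ! k)" "t \<cdot> x"] by (simp add: assoc_cmp)
      have "tgt C g = S" "tgt C h = S" using a e by simp_all
      from r[OF this(1)] r[OF this(2)] a show "g = h" by metis
    qed
    then show "\<exists>f\<in>Hom C S X. Defs.monic C f" using cmp_Hom[OF k(2) i[OF k(1)]] by blast
  qed
  then show ?thesis using m S by (simp add: constituent_def)
qed (simp add: constituent_def)

text \<open>The idempotents of two different summands would be linearly independent endomorphisms, and an empty sum
  would leave only the zero endomorphism.\<close>

lemma simpleI_hom_dim:
  assumes "hom_dim X X 1"
  shows "simple_obj C X"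
proof -
  obtain Ss where Ss: "\<forall>S\<in>set Ss. simple_obj C S" "direct_sum C X Ss" using semisimple[of X] by blast
  let ?n = "length Ss"
  obtain i p where i: "\<And>k. k < ?n \<Longrightarrow> i k \<in> Hom C (Ss ! k) X" and p: "\<And>k. k < ?n \<Longrightarrow> p k \<in> Hom C X (Ss ! k)"
    and pi: "\<And>j k. j < ?n \<Longrightarrow> k < ?n \<Longrightarrow> p j \<cdot> i k = (if j = k then idm C (Ss ! k) else zerom C (Ss ! k) (Ss ! j))"
    and z: "\<And>\<psi>. linfun X X \<psi> \<Longrightarrow> \<psi> (idm C X) = (\<Sum>k<length Ss. \<psi> (i k \<cdot> p k))"
    and one: "?n = 1 \<Longrightarrow> i 0 \<cdot> p 0 = idm C X"
    by (rule direct_sumE[OF Ss(2)]) blast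
  obtain J b \<beta> where fr: "hom_frame X X J b \<beta>" "card J = 1" using assms by (auto simp: hom_dim_def)
  then obtain j where J: "J = {j}" by (auto simp: card_1_singleton_iff)
  have b: "b j \<in> Hom C X X" "linfun X X (\<beta> j)" "\<beta> j (b j) = 1"
    and ex: "\<And>\<psi> h. linfun X X \<psi> \<Longrightarrow> h \<in> Hom C X X \<Longrightarrow> \<psi> h = \<beta> j h * \<psi> (b j)"
    using fr(1) unfolding hom_frame_def J by auto
  define \<psi> where "\<psi> k h = schur (Ss ! k) (p k \<cdot> (h \<cdot> i k))" for k h
  have \<psi>: "linfun X X (\<psi> k)" if "k < ?n" for k
    unfolding \<psi>_def using Ss(1) that
    by (intro linfun_linmap[OF linfun_schur linmap_comp[OF linmap_cmp_right[OF i[OF that]] linmap_cmp_left[OF p[OF that]]]]) simp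
  have ip: "i k \<cdot> p k \<in> Hom C X X" if "k < ?n" for k by (rule cmp_Hom[OF p[OF that] i[OF that]])
  have val: "\<psi> k (i l \<cdot> p l) = of_bool (k = l)" if "k < ?n" "l < ?n" for k l
  proof -
    note e = Hom_ends[OF i[OF that(1)]] Hom_ends[OF i[OF that(2)]] Hom_ends[OF p[OF that(1)]] Hom_ends[OF p[OF that(2)]]
    have "p k \<cdot> ((i l \<cdot> p l) \<cdot> i k) = (p k \<cdot> i l) \<cdot> (p l \<cdot> i k)" using e by (simp add: assoc_cmp)
    also have "\<dots> = (if k = l then idm C (Ss ! k) else zerom C (Ss ! k) (Ss ! k))"
      using pi[OF that] pi[OF that(2,1)] by simp
    finally have *: "p k \<cdot> ((i l \<cdot> p l) \<cdot> i k) = (if k = l then idm C (Ss ! k) else zerom C (Ss ! k) (Ss ! k))" .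
    have S: "simple_obj C (Ss ! k)" using Ss(1) that(1) by simp
    show ?thesis unfolding \<psi>_def * using schur_id[OF S] linfun_zero[OF linfun_schur[OF S]] by (cases "k = l") simp_all
  qed
  have "?n = 1"
  proof (rule ccontr)
    assume "?n \<noteq> 1"
    then consider "?n = 0" | "0 < ?n" "1 < ?n" by linarith
    then show False
    proof cases
      case 1
      have "\<beta> j (b j \<cdot> idm C X) = 0"
        using z[OF linfun_linmap[OF b(2) linmap_cmp_left[OF b(1)]]] 1 by simp
      then show False using b(3) Hom_ends[OF b(1)] by simp
    next
      case 2
      have "\<psi> 1 (i 1 \<cdot> p 1) = 1" "\<psi> 0 (i 0 \<cdot> p 0) = 1" "\<psi> 1 (i 0 \<cdot> p 0) = 0"
        using val[OF 2(2,2)] val[OF 2(1,1)] val[OF 2(2,1)] by simp_all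
      then show False using ex[OF \<psi>[OF 2(2)] ip[OF 2(2)]] ex[OF \<psi>[OF 2(1)] ip[OF 2(1)]] ex[OF \<psi>[OF 2(2)] ip[OF 2(1)]]
        by auto
    qed
  qed
  then have 0: "0 < ?n" by simp
  have "iso_arrow C (i 0)"
    using one[OF \<open>?n = 1\<close>] pi[OF 0 0] Hom_ends[OF i[OF 0]] Hom_ends[OF p[OF 0]] by (intro isoI(1)[of "p 0"]) simp_all
  then have i0: "isomorphic C (Ss ! 0) X" using i[OF 0] by (auto simp: isomorphic_def)
  have "simple_obj C (Ss ! 0)" using Ss(1) 0 by simp
  from isomorphic_simple[OF this i0] show ?thesis .
qed

lemma hom_dim_simple: "simple_obj C X \<Longrightarrow> hom_dim X X 1"
  using hom_dim_hom_mult(1)[of X X] hom_mult_simple[of X X] by simp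

lemma ten_scale_simps [simp]: "scale C a f \<otimes>\<^sub>m g = scale C a (f \<otimes>\<^sub>m g)" "f \<otimes>\<^sub>m scale C a g = scale C a (f \<otimes>\<^sub>m g)"
  by (rule ten_scale_left, rule ten_scale_right)

lemma ten_plus_simps [simp]:
  "\<lbrakk>src C f = src C g; tgt C f = tgt C g\<rbrakk> \<Longrightarrow> plusm C f g \<otimes>\<^sub>m h = plusm C (f \<otimes>\<^sub>m h) (g \<otimes>\<^sub>m h)"
  "\<lbrakk>src C f = src C g; tgt C f = tgt C g\<rbrakk> \<Longrightarrow> h \<otimes>\<^sub>m plusm C f g = plusm C (h \<otimes>\<^sub>m f) (h \<otimes>\<^sub>m g)"
  using ten_plus_left[of f "src C g" "tgt C g" g h] ten_plus_right[of f "src C g" "tgt C g" g h] by (simp_all add: Hom_iff)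

section \<open>Frobenius reciprocity\<close>

text \<open>The strand $Z$ is bent down from the target to the source, and back by \<open>frob_inv\<close>.\<close>

definition frob :: "'o \<Rightarrow> 'o \<Rightarrow> 'm \<Rightarrow> 'm" where
  "frob Z Y f = lunit C Y \<cdot> ((ev C Z \<otimes>\<^sub>m idm C Y) \<cdot> (inv_arrow C (assoc C (dualO C Z) Z Y) \<cdot> (idm C (dualO C Z) \<otimes>\<^sub>m f)))"

definition frob_inv :: "'o \<Rightarrow> 'o \<Rightarrow> 'm \<Rightarrow> 'm" where
  "frob_inv Z W g = (idm C Z \<otimes>\<^sub>m g) \<cdot> (assoc C Z (dualO C Z) W \<cdot> ((coev C Z \<otimes>\<^sub>m idm C W) \<cdot> inv_arrow C (lunit C W)))"

lemma linmap_frob: "linmap W (Z \<otimes>\<^sub>o Y) (dualO C Z \<otimes>\<^sub>o W) Y (frob Z Y)"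
  by (auto simp: linmap_def frob_def Hom_iff)

lemma linmap_frob_inv: "linmap (dualO C Z \<otimes>\<^sub>o W) Y W (Z \<otimes>\<^sub>o Y) (frob_inv Z W)"
  by (auto simp: linmap_def frob_inv_def Hom_iff)

lemma emb_frob: "f \<in> Hom C W (Z \<otimes>\<^sub>o Y) \<Longrightarrow> emb (frob Z Y f) =
    ([] \<triangleright> evs Z \<triangleleft> [Y]) \<star> ([dualO C Z] \<triangleright> (split Z Y \<star> emb f) \<triangleleft> []) \<star> split (dualO C Z) W"
  by (simp add: Hom_iff frob_def evs_def)

lemma emb_frob_inv: "g \<in> Hom C (dualO C Z \<otimes>\<^sub>o W) Y \<Longrightarrow> emb (frob_inv Z W g) =
    fuse Z Y \<star> ([Z] \<triangleright> (emb g \<star> fuse (dualO C Z) W) \<triangleleft> []) \<star> ([] \<triangleright> coevs Z \<triangleleft> [W])"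
  by (simp add: Hom_iff frob_inv_def coevs_def)

lemma frob_inv_frob:
  assumes "f \<in> Hom C W (Z \<otimes>\<^sub>o Y)"
  shows "frob_inv Z W (frob Z Y f) = f"
proof (rule emb_inj)
  note [simp] = Hom_ends[OF assms]
  have "emb (frob_inv Z W (frob Z Y f)) =
    fuse Z Y \<star> ([Z] \<triangleright> evs Z \<triangleleft> [Y]) \<star> ([Z, dualO C Z] \<triangleright> (split Z Y \<star> emb f) \<triangleleft> []) \<star> ([] \<triangleright> coevs Z \<triangleleft> [W])"
    unfolding emb_frob_inv[OF linmap_Hom[OF linmap_frob assms]] emb_frob[OF assms] by simp
  also have "\<dots> = fuse Z Y \<star> (([Z] \<triangleright> evs Z \<triangleleft> [Y]) \<star> ([] \<triangleright> coevs Z \<triangleleft> [Z, Y])) \<star> (split Z Y \<star> emb f)"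
    using strict.interchange[of "coevs Z" "split Z Y \<star> emb f" "[]" "[]" "[]"] by simp
  also have "([Z] \<triangleright> evs Z \<triangleleft> [Y]) \<star> ([] \<triangleright> coevs Z \<triangleleft> [Z, Y]) = fid [Z, Y]"
    using strict.whisk_eq[OF strict.zig[OF dual_pair_evs[of Z]], of "[]" "[Y]"] by simp
  finally show "emb (frob_inv Z W (frob Z Y f)) = emb f" by simp
qed

lemma frob_frob_inv:
  assumes "g \<in> Hom C (dualO C Z \<otimes>\<^sub>o W) Y"
  shows "frob Z Y (frob_inv Z W g) = g"
proof (rule emb_inj)
  note [simp] = Hom_ends[OF assms]
  let ?g = "emb g \<star> fuse (dualO C Z) W"
  have "emb (frob Z Y (frob_inv Z W g)) =
    (([] \<triangleright> evs Z \<triangleleft> [Y]) \<star> ([dualO C Z, Z] \<triangleright> ?g \<triangleleft> [])) \<star> ([dualO C Z] \<triangleright> coevs Z \<triangleleft> [W]) \<star> split (dualO C Z) W"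
    unfolding emb_frob[OF linmap_Hom[OF linmap_frob_inv assms]] emb_frob_inv[OF assms] by simp
  also have "\<dots> = ?g \<star> (([] \<triangleright> evs Z \<triangleleft> [dualO C Z, W]) \<star> ([dualO C Z] \<triangleright> coevs Z \<triangleleft> [W])) \<star> split (dualO C Z) W"
    using strict.interchange[of "evs Z" ?g "[]" "[]" "[]"] by simp
  also have "([] \<triangleright> evs Z \<triangleleft> [dualO C Z, W]) \<star> ([dualO C Z] \<triangleright> coevs Z \<triangleleft> [W]) = fid [dualO C Z, W]"
    using strict.whisk_eq[OF strict.zag[OF dual_pair_evs[of Z]], of "[]" "[W]"] by simp
  finally show "emb (frob Z Y (frob_inv Z W g)) = emb g" by simp
qed

lemma hom_dim_frobenius: "hom_dim W (Z \<otimes>\<^sub>o Y) n \<longleftrightarrow> hom_dim (dualO C Z \<otimes>\<^sub>o W) Y n"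
  using hom_dim_transport[OF _ linmap_frob linmap_frob_inv frob_frob_inv frob_inv_frob]
    hom_dim_transport[OF _ linmap_frob_inv linmap_frob frob_inv_frob frob_frob_inv] by blast

text \<open>The Hom space on the right of the bijection has the simple object as its target; its dimension is the
  multiplicity because both kinds of Hom spaces count the same summands.\<close>

lemma hom_mult_frobenius:
  assumes "simple_obj C W" "simple_obj C Y"
  shows "hom_mult W (Z \<otimes>\<^sub>o Y) = hom_mult Y (dualO C Z \<otimes>\<^sub>o W)"
  using hom_dim_frobenius[of W Z Y "hom_mult W (Z \<otimes>\<^sub>o Y)"] hom_dim_hom_mult[OF assms(1)]
    hom_dim_unique[OF hom_dim_hom_mult(2)[OF assms(2)]] by metis

end

section \<open>Loops around a simple object\<close>

context spherical_fusion_category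
begin

lemma fscale_fid_inj:
  assumes "idm C X \<noteq> zerom C X X" "fscale a (fid [X]) = fscale b (fid [X])"
  shows "a = b"
proof -
  have "emb (scale C a (idm C X)) = emb (scale C b (idm C X))" using assms(2) by simp
  then have "scale C a (idm C X) = scale C b (idm C X)" by (rule emb_inj)
  then show ?thesis using scale_inj[of "idm C X"] assms(1) by simp
qed

lemma unit_nonzero: "idm C \<one>\<^sub>o \<noteq> zerom C \<one>\<^sub>o \<one>\<^sub>o"
proof
  assume "idm C \<one>\<^sub>o = zerom C \<one>\<^sub>o \<one>\<^sub>o"
  then have "scale C 0 (idm C \<one>\<^sub>o) = scale C 1 (idm C \<one>\<^sub>o)" by simp
  then show False using bij_betw_imp_inj_on[OF unit_End] by (metis UNIV_I inj_on_eq_iff zero_neq_one)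
qed

lemma fscale_empty_inj:
  assumes "fscale a (fid []) = fscale b (fid [])"
  shows "a = b"
proof -
  have "ins \<star> fscale a (fid []) \<star> del = ins \<star> fscale b (fid []) \<star> del" using assms by simp
  then show ?thesis using fscale_fid_inj[OF unit_nonzero] by simp
qed

lemma scalar: "f \<in> Hom C \<one>\<^sub>o \<one>\<^sub>o \<Longrightarrow> f = scale C (scalar C f) (idm C \<one>\<^sub>o)"
proof -
  assume f: "f \<in> Hom C \<one>\<^sub>o \<one>\<^sub>o"
  then obtain a where a: "f = scale C a (idm C \<one>\<^sub>o)" using bij_betw_imp_surj_on[OF unit_End] by blast
  have "scalar C f = a" unfolding scalar_def
  proof (rule the_equality)
    show "f = scale C a (idm C \<one>\<^sub>o)" by (rule a)
    show "b = a" if "f = scale C b (idm C \<one>\<^sub>o)" for b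
      by (rule scale_inj[of "idm C \<one>\<^sub>o"]) (use unit_nonzero a that in simp_all)
  qed
  then show ?thesis using a by simp
qed

lemma strict_ptrace_qtrace:
  assumes "f \<in> Hom C X X"
  shows "strict_ptrace [] [] X (emb f) = fscale (qtrace C X f) (fid [])"
proof -
  let ?D = "dualO C X"
  note [simp] = Hom_ends[OF assms]
  let ?g = "ev C ?D \<cdot> ((piv C X \<cdot> f) \<otimes>\<^sub>m idm C ?D) \<cdot> coev C X"
  have "emb ?g = fscale (qtrace C X f) (fid [\<one>\<^sub>o])"
    using arg_cong[OF scalar[of ?g], of emb] by (simp add: qtrace_def Hom_iff del: emb_cmp emb_ten)
  then have "del \<star> emb ?g \<star> ins = del \<star> fscale (qtrace C X f) (fid [\<one>\<^sub>o]) \<star> ins" by (rule arg_cong)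
  then show ?thesis by (simp add: strict_ptrace_def strict.ptr_def trs_def evs_def coevs_def)
qed

lemma qtrace_cyclic:
  assumes "f \<in> Hom C X Y" "g \<in> Hom C Y X"
  shows "qtrace C X (g \<cdot> f) = qtrace C Y (f \<cdot> g)"
proof (rule fscale_empty_inj)
  note [simp] = Hom_ends[OF assms(1)] Hom_ends[OF assms(2)]
  have "strict_ptrace [] [] (tgt C g) (([] \<triangleright> emb g \<triangleleft> []) \<star> emb f) = strict_ptrace [] [] (src C g) (emb f \<star> ([] \<triangleright> emb g \<triangleleft> []))"
    by (rule strict_ptrace_cyclic) (auto intro!: strict.homI)
  then show "fscale (qtrace C X (g \<cdot> f)) (fid []) = fscale (qtrace C Y (f \<cdot> g)) (fid [])"
    using strict_ptrace_qtrace[of "g \<cdot> f" X] strict_ptrace_qtrace[of "f \<cdot> g" Y] by (simp add: Hom_iff)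
qed

lemma qdim_isomorphic:
  assumes "isomorphic C X Y"
  shows "qdim C X = qdim C Y"
proof -
  obtain f where f: "f \<in> Hom C X Y" "iso_arrow C f" using assms by (auto simp: isomorphic_def)
  have "inv_arrow C f \<in> Hom C Y X" using f by (simp add: Hom_iff)
  from qtrace_cyclic[OF f(1) this] show ?thesis using f by (simp add: qdim_def Hom_iff)
qed

lemma strict_ptrace_id: "strict_ptrace [] [] X (fid [X]) = fscale (qdim C X) (fid [])"
  using strict_ptrace_qtrace[of "idm C X" X] by (simp add: qdim_def Hom_iff)

lemma strict_ptrace_fid: "strict_ptrace [A] [A] X (fid [A, X]) = fscale (qdim C X) (fid [A])"
  using strict_ptrace_whisk[of "fid [X]" "[]" X "[]" "[A]"] strict_ptrace_id[of X] by (simp add: strict.hom_def)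

lemma qtrace_ten:
  assumes h: "h \<in> Hom C (K \<otimes>\<^sub>o L) (K \<otimes>\<^sub>o L)"
    and p: "strict_ptrace [K] [K] L (split K L \<star> emb h \<star> fuse K L) = fscale c (fid [K])"
  shows "qtrace C (K \<otimes>\<^sub>o L) h = c * qdim C K"
proof (rule fscale_empty_inj)
  have "fscale (qtrace C (K \<otimes>\<^sub>o L) h) (fid []) = strict_ptrace [] [] (K \<otimes>\<^sub>o L) (emb h)"
    by (rule strict_ptrace_qtrace[OF h, symmetric])
  also have "\<dots> = strict_ptrace [] [] K (strict_ptrace [K] [K] L (split K L \<star> emb h \<star> fuse K L))"
    using strict_ptrace_ten[of "emb h" "[]" K L "[]"] Hom_ends[OF h] by (simp add: strict.hom_def)
  also have "\<dots> = fscale c (fscale (qdim C K) (fid []))"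
    unfolding p using strict_ptrace_scale[of "fid [K]" "[]" K "[]" c] strict_ptrace_id[of K] by (simp add: strict.hom_def)
  also have "\<dots> = fscale (c * qdim C K) (fid [])"
    by (rule family_eqI) (simp_all add: fscale_def fid_def)
  finally show "fscale (qtrace C (K \<otimes>\<^sub>o L) h) (fid []) = fscale (c * qdim C K) (fid [])" .
qed

lemma qdim_ten: "qdim C (K \<otimes>\<^sub>o L) = qdim C K * qdim C L"
  using qtrace_ten[of "idm C (K \<otimes>\<^sub>o L)" K L "qdim C L"] strict_ptrace_fid[of K L] by (simp add: qdim_def Hom_iff mult.commute)

text \<open>The partial trace as an arrow of the category, to which Schur's lemma applies.\<close>

definition ptrace :: "'o \<Rightarrow> 'o \<Rightarrow> 'm \<Rightarrow> 'm" where
  "ptrace A X h = runit C A \<cdot> ((idm C A \<otimes>\<^sub>m (ev C (dualO C X) \<cdot> (piv C X \<otimes>\<^sub>m idm C (dualO C X)))) \<cdot>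
    (assoc C A X (dualO C X) \<cdot> ((h \<otimes>\<^sub>m idm C (dualO C X)) \<cdot>
    (inv_arrow C (assoc C A X (dualO C X)) \<cdot> ((idm C A \<otimes>\<^sub>m coev C X) \<cdot> inv_arrow C (runit C A))))))"

lemma emb_ptrace:
  assumes "h \<in> Hom C (A \<otimes>\<^sub>o X) (A \<otimes>\<^sub>o X)"
  shows "emb (ptrace A X h) = strict_ptrace [A] [A] X (split A X \<star> emb h \<star> fuse A X)"
  using Hom_ends[OF assms] by (simp add: ptrace_def strict_ptrace_def strict.ptr_def trs_def evs_def coevs_def)

lemma linmap_ptrace: "linmap (A \<otimes>\<^sub>o X) (A \<otimes>\<^sub>o X) A A (ptrace A X)"
  by (auto simp: linmap_def ptrace_def Hom_iff)

lemma linmap_ten_right: "linmap X Y (A \<otimes>\<^sub>o X) (A \<otimes>\<^sub>o Y) (\<lambda>g. idm C A \<otimes>\<^sub>m g)"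
  by (auto simp: linmap_def Hom_iff)

end

context modular_fusion_category
begin

lemma braid_ends [simp]: "src C (braid C X Y) = X \<otimes>\<^sub>o Y" "tgt C (braid C X Y) = Y \<otimes>\<^sub>o X"
  using braid_Hom[of X Y] by (simp_all add: Hom_iff)

definition strict_braid :: "'o \<Rightarrow> 'o \<Rightarrow> ('o, 'm) family" where
  "strict_braid X Y = split Y X \<star> emb (braid C X Y) \<star> fuse X Y"

lemma strict_braid_arr [simp]: "natural (strict_braid X Y)" "fdom (strict_braid X Y) = [X, Y]" "fcod (strict_braid X Y) = [Y, X]"
  by (simp_all add: strict_braid_def)

text \<open>The hexagons without associators: a strand crosses two strands one after the other.\<close>

lemma strict_braid_ten_right:
  "([] \<triangleright> split Y Z \<triangleleft> [X]) \<star> strict_braid X (Y \<otimes>\<^sub>o Z) \<star> ([X] \<triangleright> fuse Y Z \<triangleleft> []) =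
    ([Y] \<triangleright> strict_braid X Z \<triangleleft> []) \<star> ([] \<triangleright> strict_braid X Y \<triangleleft> [Z])"
  using arg_cong[OF hexagon1[of Y Z X], of "\<lambda>f. ([Y] \<triangleright> split Z X \<triangleleft> []) \<star> split Y (Z \<otimes>\<^sub>o X) \<star> emb f \<star>
    fuse (X \<otimes>\<^sub>o Y) Z \<star> ([] \<triangleright> fuse X Y \<triangleleft> [Z])"]
  by (simp add: strict_braid_def)

lemma strict_braid_ten_left:
  "([Z] \<triangleright> split X Y \<triangleleft> []) \<star> strict_braid (X \<otimes>\<^sub>o Y) Z \<star> ([] \<triangleright> fuse X Y \<triangleleft> [Z]) =
    ([] \<triangleright> strict_braid X Z \<triangleleft> [Y]) \<star> ([X] \<triangleright> strict_braid Y Z \<triangleleft> [])"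
  using arg_cong[OF hexagon2[of Z X Y], of "\<lambda>f. ([] \<triangleright> split Z X \<triangleleft> [Y]) \<star> split (Z \<otimes>\<^sub>o X) Y \<star> emb f \<star>
    fuse X (Y \<otimes>\<^sub>o Z) \<star> ([X] \<triangleright> fuse Y Z \<triangleleft> [])"]
  by (simp add: strict_braid_def)

definition double_braid :: "'o \<Rightarrow> 'o \<Rightarrow> 'm" where
  "double_braid X Y = braid C Y X \<cdot> braid C X Y"

lemma double_braid_Hom: "double_braid X Y \<in> Hom C (X \<otimes>\<^sub>o Y) (X \<otimes>\<^sub>o Y)"
  by (simp add: double_braid_def Hom_iff)

lemma emb_double_braid: "split X Y \<star> emb (double_braid X Y) \<star> fuse X Y = strict_braid Y X \<star> strict_braid X Y"
  by (simp add: double_braid_def strict_braid_def)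

lemma double_braid_natural:
  assumes "g \<in> Hom C X Y"
  shows "double_braid A Y \<cdot> (idm C A \<otimes>\<^sub>m g) = (idm C A \<otimes>\<^sub>m g) \<cdot> double_braid A X"
proof -
  note [simp] = Hom_ends[OF assms]
  have 1: "braid C A Y \<cdot> (idm C A \<otimes>\<^sub>m g) = (g \<otimes>\<^sub>m idm C A) \<cdot> braid C A X"
    by (rule braid_natural) (simp_all add: Hom_iff)
  have 2: "braid C Y A \<cdot> (g \<otimes>\<^sub>m idm C A) = (idm C A \<otimes>\<^sub>m g) \<cdot> braid C X A"
    by (rule braid_natural) (simp_all add: Hom_iff)
  have "double_braid A Y \<cdot> (idm C A \<otimes>\<^sub>m g) = braid C Y A \<cdot> ((g \<otimes>\<^sub>m idm C A) \<cdot> braid C A X)"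
    unfolding double_braid_def 1[symmetric] by (simp add: assoc_cmp)
  also have "\<dots> = (braid C Y A \<cdot> (g \<otimes>\<^sub>m idm C A)) \<cdot> braid C A X" by (simp add: assoc_cmp)
  also have "\<dots> = (idm C A \<otimes>\<^sub>m g) \<cdot> double_braid A X" unfolding 2 double_braid_def by (simp add: assoc_cmp)
  finally show ?thesis .
qed

text \<open>The scalar by which a loop coloured $X$ around $A$ acts, $S_{A,X} / \dim(A)$.\<close>

definition lam :: "'o \<Rightarrow> 'o \<Rightarrow> complex" where
  "lam A X = schur A (ptrace A X (double_braid A X))"

lemma strict_ptrace_lam:
  assumes "simple_obj C A"
  shows "strict_ptrace [A] [A] X (strict_braid X A \<star> strict_braid A X) = fscale (lam A X) (fid [A])"
proof -
  have "emb (ptrace A X (double_braid A X)) = emb (scale C (lam A X) (idm C A))"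
    unfolding lam_def by (rule arg_cong[OF schur[OF assms linmap_Hom[OF linmap_ptrace double_braid_Hom]]])
  then show ?thesis unfolding emb_ptrace[OF double_braid_Hom] emb_double_braid by simp
qed

lemma qtrace_double_braid:
  assumes "simple_obj C K"
  shows "qtrace C (K \<otimes>\<^sub>o L) (double_braid K L) = lam K L * qdim C K"
  by (rule qtrace_ten[OF double_braid_Hom]) (simp only: emb_double_braid strict_ptrace_lam[OF assms])

text \<open>The double braidings of $X, Y$ and of $Y, X$ are the two composites of one pair of braidings, so this is
  the symmetry of the S-matrix.\<close>

lemma qtrace_double_braid_sym: "qtrace C (K \<otimes>\<^sub>o L) (double_braid K L) = qtrace C (L \<otimes>\<^sub>o K) (double_braid L K)"
  unfolding double_braid_def by (rule qtrace_cyclic[OF braid_Hom braid_Hom])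

text \<open>The loop coloured $Y \otimes Z$ opens into two parallel loops.  The hexagons show the inner one as a loop
  coloured $Z$ around $A$ alone, which is a scalar; removing it leaves a loop coloured $Y$.\<close>

lemma lam_ten:
  assumes A: "simple_obj C A"
  shows "lam A (Y \<otimes>\<^sub>o Z) = lam A Y * lam A Z"
proof (rule fscale_fid_inj[OF simple_id_nonzero[OF A]])
  let ?W = "Y \<otimes>\<^sub>o Z"
  let ?M = "[Y] \<triangleright> (strict_braid Z A \<star> strict_braid A Z) \<triangleleft> []"
  have "([A] \<triangleright> split Y Z \<triangleleft> []) \<star> (strict_braid ?W A \<star> strict_braid A ?W) \<star> ([A] \<triangleright> fuse Y Z \<triangleleft> []) =
    (([A] \<triangleright> split Y Z \<triangleleft> []) \<star> strict_braid ?W A \<star> ([] \<triangleright> fuse Y Z \<triangleleft> [A])) \<star>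
    (([] \<triangleright> split Y Z \<triangleleft> [A]) \<star> strict_braid A ?W \<star> ([A] \<triangleright> fuse Y Z \<triangleleft> []))"
    by simp
  also have "\<dots> = ([] \<triangleright> strict_braid Y A \<triangleleft> [Z]) \<star> ?M \<star> ([] \<triangleright> strict_braid A Y \<triangleleft> [Z])"
    unfolding strict_braid_ten_left strict_braid_ten_right by simp
  finally have conj: "([A] \<triangleright> split Y Z \<triangleleft> []) \<star> (strict_braid ?W A \<star> strict_braid A ?W) \<star> ([A] \<triangleright> fuse Y Z \<triangleleft> []) =
    ([] \<triangleright> strict_braid Y A \<triangleleft> [Z]) \<star> ?M \<star> ([] \<triangleright> strict_braid A Y \<triangleleft> [Z])" .
  have M: "?M \<in> strict.hom ([Y, A] @ [Z]) ([Y, A] @ [Z])" by (auto intro!: strict.homI)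
  have pM: "strict_ptrace [Y, A] [Y, A] Z ?M = fscale (lam A Z) (fid [Y, A])"
    using strict_ptrace_whisk[of "strict_braid Z A \<star> strict_braid A Z" "[A]" Z "[A]" "[Y]"] strict_ptrace_lam[OF A, of Z] by (simp add: strict.hom_def)
  have "fscale (lam A ?W) (fid [A]) = strict_ptrace [A] [A] ?W (strict_braid ?W A \<star> strict_braid A ?W)"
    by (rule strict_ptrace_lam[OF A, symmetric])
  also have "\<dots> = strict_ptrace [A] [A] Y (strict_ptrace [A, Y] [A, Y] Z (([] \<triangleright> strict_braid Y A \<triangleleft> [Z]) \<star> ?M \<star> ([] \<triangleright> strict_braid A Y \<triangleleft> [Z])))"
    unfolding conj[symmetric] using strict_ptrace_ten[of "strict_braid ?W A \<star> strict_braid A ?W" "[A]" Y Z "[A]"] by (simp add: strict.hom_def)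
  also have "strict_ptrace [A, Y] [A, Y] Z (([] \<triangleright> strict_braid Y A \<triangleleft> [Z]) \<star> ?M \<star> ([] \<triangleright> strict_braid A Y \<triangleleft> [Z])) =
    strict_braid Y A \<star> strict_ptrace [Y, A] [Y, A] Z ?M \<star> strict_braid A Y"
    by (rule strict_ptrace_between[OF M]) (auto intro!: strict.homI)
  also have "\<dots> = fscale (lam A Z) (strict_braid Y A \<star> strict_braid A Y)"
    unfolding pM by simp
  also have "strict_ptrace [A] [A] Y \<dots> = fscale (lam A Z) (fscale (lam A Y) (fid [A]))"
    using strict_ptrace_scale[of "strict_braid Y A \<star> strict_braid A Y" "[A]" Y "[A]" "lam A Z"] strict_ptrace_lam[OF A, of Y] by (simp add: strict.hom_def)
  also have "\<dots> = fscale (lam A Y * lam A Z) (fid [A])"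
    by (rule family_eqI) (simp_all add: fscale_def fid_def mult.commute)
  finally show "fscale (lam A ?W) (fid [A]) = fscale (lam A Y * lam A Z) (fid [A])" .
qed

text \<open>The idempotent $i\,p$ placed on a loop coloured $Z$ is cut open by cyclicity, and leaves a loop coloured
  $S$.\<close>

lemma lam_split:
  assumes i: "i \<in> Hom C S Z" and p: "p \<in> Hom C Z S" and pi: "p \<cdot> i = idm C S"
  shows "ptrace A Z (double_braid A Z \<cdot> (idm C A \<otimes>\<^sub>m (i \<cdot> p))) = ptrace A S (double_braid A S)"
proof (rule emb_inj)
  note [simp] = Hom_ends[OF i] Hom_ends[OF p]
  let ?c = "\<lambda>X Y h. split A Y \<star> emb h \<star> fuse A X"
  have e: "src C (double_braid A Y) = A \<otimes>\<^sub>o Y" "tgt C (double_braid A Y) = A \<otimes>\<^sub>o Y" for Y using Hom_ends[OF double_braid_Hom] .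
  note [simp] = e
  have "double_braid A Z \<cdot> (idm C A \<otimes>\<^sub>m (i \<cdot> p)) = double_braid A Z \<cdot> ((idm C A \<otimes>\<^sub>m i) \<cdot> (idm C A \<otimes>\<^sub>m p))"
    by (simp add: ten_cmp')
  also have "\<dots> = (idm C A \<otimes>\<^sub>m i) \<cdot> (double_braid A S \<cdot> (idm C A \<otimes>\<^sub>m p))"
    using cmp_reduce[OF double_braid_natural[OF i, of A], of "idm C A \<otimes>\<^sub>m p"] by (simp add: assoc_cmp)
  finally have 1: "double_braid A Z \<cdot> (idm C A \<otimes>\<^sub>m (i \<cdot> p)) = (idm C A \<otimes>\<^sub>m i) \<cdot> (double_braid A S \<cdot> (idm C A \<otimes>\<^sub>m p))" .
  let ?h = "split A S \<star> emb (double_braid A S) \<star> fuse A S \<star> ([A] \<triangleright> emb p \<triangleleft> [])"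
  have H: "double_braid A Z \<cdot> (idm C A \<otimes>\<^sub>m (i \<cdot> p)) \<in> Hom C (A \<otimes>\<^sub>o Z) (A \<otimes>\<^sub>o Z)" by (simp add: Hom_iff)
  have "emb (ptrace A Z (double_braid A Z \<cdot> (idm C A \<otimes>\<^sub>m (i \<cdot> p)))) = strict_ptrace [A] [A] Z (([A] \<triangleright> emb i \<triangleleft> []) \<star> ?h)"
    unfolding emb_ptrace[OF H] unfolding 1 by simp
  also have "\<dots> = strict_ptrace [A] [A] S (?h \<star> ([A] \<triangleright> emb i \<triangleleft> []))"
    using strict_ptrace_cyclic[of ?h "[A]" i "[A]"] by (simp add: strict.hom_def)
  also have "?h \<star> ([A] \<triangleright> emb i \<triangleleft> []) = split A S \<star> emb (double_braid A S) \<star> fuse A S \<star> ([A] \<triangleright> emb (p \<cdot> i) \<triangleleft> [])"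
    by simp
  also have "\<dots> = split A S \<star> emb (double_braid A S) \<star> fuse A S"
    unfolding pi by simp
  finally show "emb (ptrace A Z (double_braid A Z \<cdot> (idm C A \<otimes>\<^sub>m (i \<cdot> p)))) = emb (ptrace A S (double_braid A S))"
    unfolding emb_ptrace[OF double_braid_Hom] .
qed

lemma lam_direct_sum:
  assumes A: "simple_obj C A" and Z: "direct_sum C Z Ss"
  shows "lam A Z = (\<Sum>k<length Ss. lam A (Ss ! k))"
proof -
  obtain i p where i: "\<And>k. k < length Ss \<Longrightarrow> i k \<in> Hom C (Ss ! k) Z" and p: "\<And>k. k < length Ss \<Longrightarrow> p k \<in> Hom C Z (Ss ! k)"
    and pi: "\<And>j k. j < length Ss \<Longrightarrow> k < length Ss \<Longrightarrow> p j \<cdot> i k = (if j = k then idm C (Ss ! k) else zerom C (Ss ! k) (Ss ! j))"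
    and sum: "\<And>\<psi>. linfun Z Z \<psi> \<Longrightarrow> \<psi> (idm C Z) = (\<Sum>k<length Ss. \<psi> (i k \<cdot> p k))"
    by (rule direct_sumE[OF Z]) blast
  let ?\<psi> = "\<lambda>g. schur A (ptrace A Z (double_braid A Z \<cdot> (idm C A \<otimes>\<^sub>m g)))"
  have "linfun Z Z ?\<psi>"
    by (rule linfun_linmap[OF linfun_schur[OF A] linmap_comp[OF linmap_comp[OF linmap_ten_right linmap_cmp_left[OF double_braid_Hom]] linmap_ptrace]])
  from sum[OF this] have "?\<psi> (idm C Z) = (\<Sum>k<length Ss. ?\<psi> (i k \<cdot> p k))" .
  also have "\<dots> = (\<Sum>k<length Ss. lam A (Ss ! k))"
  proof (rule sum.cong[OF refl])
    fix k assume "k \<in> {..<length Ss}"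
    then have k: "k < length Ss" by simp
    have "p k \<cdot> i k = idm C (Ss ! k)" using pi[OF k k] by simp
    from lam_split[OF i[OF k] p[OF k] this, of A] show "?\<psi> (i k \<cdot> p k) = lam A (Ss ! k)"
      unfolding lam_def by simp
  qed
  finally show ?thesis using Hom_ends[OF double_braid_Hom] by (simp add: lam_def)
qed

lemma lam_isomorphic:
  assumes "simple_obj C A" "isomorphic C Y Z"
  shows "lam A Z = lam A Y"
  using lam_direct_sum[OF assms(1) direct_sum_single[OF assms(2)]] by simp

text \<open>The space $\mathrm{End}(Z^*)$ is $\mathrm{Hom}(\mathbf{1}, Z \otimes Z^*)$, by the braiding
  $\mathrm{Hom}(\mathbf{1}, Z^* \otimes Z)$, which is $\mathrm{Hom}(Z^{**}, Z)$ and so one-dimensional.\<close>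

lemma dual_simple:
  assumes Z: "simple_obj C Z"
  shows "simple_obj C (dualO C Z)"
proof (rule simpleI_hom_dim)
  let ?D = "dualO C Z" and ?DD = "dualO C (dualO C Z)"
  have "hom_dim Z Z 1" by (rule hom_dim_simple[OF Z])
  moreover have "inv_arrow C (piv C Z) \<in> Hom C ?DD Z" "iso_arrow C (inv_arrow C (piv C Z))"
    using piv_iso[of Z] by (simp_all add: Hom_iff)
  ultimately have "hom_dim ?DD Z 1" by (rule hom_dim_iso_source)
  then have "hom_dim (?DD \<otimes>\<^sub>o \<one>\<^sub>o) Z 1" by (rule hom_dim_iso_source[OF _ runit_Hom runit_iso])
  then have "hom_dim \<one>\<^sub>o (?D \<otimes>\<^sub>o Z) 1" unfolding hom_dim_frobenius .
  then have "hom_dim \<one>\<^sub>o (Z \<otimes>\<^sub>o ?D) 1" by (rule hom_dim_iso_target[OF _ braid_Hom braid_iso])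
  then have "hom_dim (?D \<otimes>\<^sub>o \<one>\<^sub>o) ?D 1" unfolding hom_dim_frobenius .
  moreover have "inv_arrow C (runit C ?D) \<in> Hom C ?D (?D \<otimes>\<^sub>o \<one>\<^sub>o)" "iso_arrow C (inv_arrow C (runit C ?D))"
    by (simp_all add: Hom_iff)
  ultimately show "hom_dim ?D ?D 1" by (rule hom_dim_iso_source)
qed

end

section \<open>The algebra of modular data\<close>

text \<open>An eigenvalue of an integer matrix is a root of its characteristic polynomial.\<close>

lemma algebraic_int_eigenvalue:
  fixes v :: "'i \<Rightarrow> complex" and a :: "'i \<Rightarrow> 'i \<Rightarrow> int"
  assumes I: "finite I" and u: "u \<in> I" "v u \<noteq> 0"
    and ev: "\<And>K. K \<in> I \<Longrightarrow> \<alpha> * v K = (\<Sum>L\<in>I. of_int (a K L) * v L)"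
  shows "algebraic_int \<alpha>"
proof -
  let ?m = "card I"
  obtain e where e: "bij_betw e {0..<?m} I" using ex_bij_betw_nat_finite[OF I] by blast
  define A where "A = mat ?m ?m (\<lambda>(i, j). a (e i) (e j))"
  let ?A = "map_mat of_int A :: complex mat"
  let ?w = "vec ?m (\<lambda>i. v (e i))"
  have A: "A \<in> carrier_mat ?m ?m" by (simp add: A_def)
  have cA: "?A \<in> carrier_mat ?m ?m" using A by simp
  have "?A *\<^sub>v ?w = \<alpha> \<cdot>\<^sub>v ?w"
  proof (rule eq_vecI)
    fix i assume "i < dim_vec (\<alpha> \<cdot>\<^sub>v ?w)"
    then have i: "i < ?m" by simp
    then have ei: "e i \<in> I" using e by (auto simp: bij_betw_def)
    have "(?A *\<^sub>v ?w) $ i = (\<Sum>j\<in>{0..<?m}. of_int (a (e i) (e j)) * v (e j))"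
      using i by (simp add: A_def scalar_prod_def)
    also have "\<dots> = (\<Sum>L\<in>I. of_int (a (e i) L) * v L)"
      by (rule sum.reindex_bij_betw[OF e])
    also have "\<dots> = (\<alpha> \<cdot>\<^sub>v ?w) $ i" using ev[OF ei] i by simp
    finally show "(?A *\<^sub>v ?w) $ i = (\<alpha> \<cdot>\<^sub>v ?w) $ i" .
  qed (simp add: A_def)
  moreover have "?w \<noteq> 0\<^sub>v ?m"
  proof
    have "u \<in> e ` {0..<?m}" using e u(1) by (simp add: bij_betw_def)
    then obtain i where i: "i < ?m" "e i = u" by auto
    assume "?w = 0\<^sub>v ?m"
    then have "?w $ i = 0" using i by simp
    then show False using i u(2) by simp
  qed
  ultimately have "eigenvalue ?A \<alpha>"
    unfolding eigenvalue_def eigenvector_def using cA by (intro exI[of _ ?w]) auto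
  then have "poly (char_poly ?A) \<alpha> = 0" using eigenvalue_root_char_poly[OF cA] by simp
  moreover have "char_poly ?A = map_poly of_int (char_poly A)"
    by (rule of_int_hom.char_poly_hom[OF A])
  moreover have "lead_coeff (char_poly A) = 1" using degree_monic_char_poly[OF A] by simp
  ultimately show ?thesis unfolding algebraic_int_altdef_ipoly by auto
qed

text \<open>The complement of an orbit is again stable under $\sigma$, so the orbits are removed one by one.\<close>

lemma sum_free_orbits:
  fixes f :: "'i \<Rightarrow> complex"
  assumes "finite J" "\<And>A. A \<in> J \<Longrightarrow> \<sigma> A \<in> J" "\<And>A. A \<in> J \<Longrightarrow> (\<sigma> ^^ n) A = A"
    "\<And>A k. A \<in> J \<Longrightarrow> 0 < k \<Longrightarrow> k < n \<Longrightarrow> (\<sigma> ^^ k) A \<noteq> A" "\<And>A. A \<in> J \<Longrightarrow> f (\<sigma> A) = f A" "0 < n"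
  shows "\<exists>R\<subseteq>J. sum f J = of_nat n * sum f R"
  using assms(1-5)
proof (induction "card J" arbitrary: J rule: less_induct)
  case less
  show ?case
  proof (cases "J = {}")
    case False
    then obtain A where A: "A \<in> J" by blast
    let ?O = "(\<lambda>k. (\<sigma> ^^ k) A) ` {..<n}"
    have it: "(\<sigma> ^^ k) B \<in> J" if "B \<in> J" for k B using that less(3) by (induct k) auto
    have fit: "f ((\<sigma> ^^ k) A) = f A" for k
      by (induct k) (use less(6) it[OF A] in auto)
    have inj: "inj_on (\<lambda>k. (\<sigma> ^^ k) A) {..<n}"
    proof (rule linorder_inj_onI')
      fix i j assume ij: "i \<in> {..<n}" "j \<in> {..<n}" "i < j"
      show "(\<sigma> ^^ i) A \<noteq> (\<sigma> ^^ j) A"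
      proof
        assume "(\<sigma> ^^ i) A = (\<sigma> ^^ j) A"
        then have "(\<sigma> ^^ (n - j)) ((\<sigma> ^^ i) A) = (\<sigma> ^^ (n - j)) ((\<sigma> ^^ j) A)" by simp
        moreover have "(\<sigma> ^^ (n - j)) ((\<sigma> ^^ j) A) = A"
          using ij less(4)[OF A] by (simp add: funpow_add[symmetric, THEN fun_cong, unfolded comp_def])
        moreover have "(\<sigma> ^^ (n - j)) ((\<sigma> ^^ i) A) = (\<sigma> ^^ (n - j + i)) A" by (simp add: funpow_add)
        ultimately have "(\<sigma> ^^ (n - j + i)) A = A" by simp
        moreover have "0 < n - j + i" "n - j + i < n" using ij unfolding lessThan_iff by linarith+
        ultimately show False using less(5)[OF A, of "n - j + i"] by simp
      qed
    qed
    have sumO: "sum f ?O = of_nat n * f A"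
      using sum.reindex[OF inj, of f] fit by simp
    have OJ: "?O \<subseteq> J" using it[OF A] by auto
    have cl: "\<sigma> B \<in> J - ?O" if B: "B \<in> J - ?O" for B
    proof
      show "\<sigma> B \<in> J" using less(3) B by auto
      show "\<sigma> B \<notin> ?O"
      proof
        assume "\<sigma> B \<in> ?O"
        then obtain k where k: "k < n" "\<sigma> B = (\<sigma> ^^ k) A" by auto
        have n1: "Suc (n - 1) = n" using assms(6) by simp
        have "B = (\<sigma> ^^ n) B" using less(4)[of B] B by simp
        also have "(\<sigma> ^^ n) B = (\<sigma> ^^ (n - 1)) (\<sigma> B)"
          using fun_cong[OF funpow_Suc_right[of "n - 1" \<sigma>], of B] unfolding n1 by simp
        also have "\<dots> = (\<sigma> ^^ (n - 1 + k)) A" by (simp add: k funpow_add)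
        also have "\<dots> \<in> ?O"
        proof (cases "k = 0")
          case True
          then show ?thesis using assms(6) by (intro image_eqI[of _ _ "n - 1"]) auto
        next
          case False
          then have "n - 1 + k = n + (k - 1)" using assms(6) by linarith
          then have "(\<sigma> ^^ (n - 1 + k)) A = (\<sigma> ^^ (k - 1)) A"
            using fun_cong[OF funpow_add[of "k - 1" n \<sigma>], of A] less(4)[OF A] by (simp add: add.commute)
          then show ?thesis using k by (intro image_eqI[of _ _ "k - 1"]) auto
        qed
        finally show False using B by simp
      qed
    qed
    have "card (J - ?O) < card J"
      using A less(2) assms(6) by (intro psubset_card_mono) (auto intro: image_eqI[of _ _ 0])
    from less(1)[OF this _ cl] obtain R where R: "R \<subseteq> J - ?O" "sum f (J - ?O) = of_nat n * sum f R"
      using less(2-6) by auto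
    have "sum f J = sum f ?O + sum f (J - ?O)"
      using sum.subset_diff[OF OJ less(2), of f] by simp
    also have "\<dots> = of_nat n * sum f (insert A R)"
    proof -
      have "A \<in> ?O" using assms(6) by (intro image_eqI[of _ _ 0]) auto
      then have "A \<notin> R" "finite R" using R(1) less(2) finite_subset by blast+
      then show ?thesis by (simp add: sumO R(2) algebra_simps)
    qed
    finally show ?thesis using A R(1) by (intro exI[of _ "insert A R"]) auto
  qed auto
qed

text \<open>The simple objects, their fusion rules and dimensions, and the normalised S-matrix
  $\lambda_A(K) = S_{A,K} / d_A$.  The axioms say that the $\lambda_A$ are characters, that $S$ is symmetric
  and invertible, and that fusion satisfies Frobenius reciprocity.\<close>

locale modular_data =
  fixes I :: "'i set" and N :: "'i \<Rightarrow> 'i \<Rightarrow> 'i \<Rightarrow> nat" and u :: 'i and star :: "'i \<Rightarrow> 'i"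
    and d :: "'i \<Rightarrow> complex" and lam :: "'i \<Rightarrow> 'i \<Rightarrow> complex"
  assumes finite_I [simp]: "finite I" and u_I [simp]: "u \<in> I" and star_I [simp]: "K \<in> I \<Longrightarrow> star K \<in> I"
    and lam_mult: "\<lbrakk>A \<in> I; K \<in> I; L \<in> I\<rbrakk> \<Longrightarrow> lam A K * lam A L = (\<Sum>M\<in>I. of_nat (N K L M) * lam A M)"
    and S_sym: "\<lbrakk>A \<in> I; K \<in> I\<rbrakk> \<Longrightarrow> d A * lam A K = d K * lam K A"
    and S_inv: "invertible_on I (\<lambda>A K. d A * lam A K)"
    and N_frob: "\<lbrakk>K \<in> I; L \<in> I; M \<in> I\<rbrakk> \<Longrightarrow> N K L M = N (star K) M L"
    and N_unit: "\<lbrakk>K \<in> I; L \<in> I\<rbrakk> \<Longrightarrow> N K L u = of_bool (L = star K)"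
    and d_star: "K \<in> I \<Longrightarrow> d (star K) = d K" and d_u: "d u = 1"
begin

text \<open>The rows of an invertible matrix span all functions on $I$.\<close>

lemma separate:
  assumes "\<And>A. A \<in> I \<Longrightarrow> (\<Sum>K\<in>I. lam A K * f K) = 0" "K \<in> I"
  shows "f K = 0"
proof -
  obtain M where M: "\<And>i j. i \<in> I \<Longrightarrow> j \<in> I \<Longrightarrow> (\<Sum>k\<in>I. M i k * (d k * lam k j)) = of_bool (i = j)"
    using S_inv unfolding invertible_on_def by blast
  have "f K = (\<Sum>j\<in>I. of_bool (K = j) * f j)"
    using assms(2) by (simp add: if_distrib sum.delta cong: if_cong flip: of_bool_def)
  also have "\<dots> = (\<Sum>j\<in>I. (\<Sum>k\<in>I. M K k * (d k * lam k j)) * f j)"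
    using M assms(2) by (intro sum.cong) auto
  also have "\<dots> = (\<Sum>j\<in>I. \<Sum>k\<in>I. M K k * d k * (lam k j * f j))"
    by (simp add: sum_distrib_right mult.assoc)
  also have "\<dots> = (\<Sum>k\<in>I. M K k * d k * (\<Sum>j\<in>I. lam k j * f j))"
    by (subst sum.swap) (simp add: sum_distrib_left)
  also have "\<dots> = 0" using assms(1) by simp
  finally show ?thesis .
qed

lemma d_nonzero: "A \<in> I \<Longrightarrow> d A \<noteq> 0"
proof
  assume A: "A \<in> I" "d A = 0"
  obtain M where M: "\<And>i j. i \<in> I \<Longrightarrow> j \<in> I \<Longrightarrow> (\<Sum>k\<in>I. (d i * lam i k) * M k j) = of_bool (i = j)"
    using S_inv unfolding invertible_on_def by blast
  show False using M[OF A(1) A(1)] A(2) by simp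
qed

lemma lam_inj:
  assumes "A \<in> I" "B \<in> I" "\<And>K. K \<in> I \<Longrightarrow> lam A K = lam B K"
  shows "A = B"
proof (rule ccontr)
  assume ne: "A \<noteq> B"
  obtain M where M: "\<And>i j. i \<in> I \<Longrightarrow> j \<in> I \<Longrightarrow> (\<Sum>k\<in>I. (d i * lam i k) * M k j) = of_bool (i = j)"
    using S_inv unfolding invertible_on_def by blast
  have "d B * (\<Sum>k\<in>I. (d A * lam A k) * M k A) = d A * (\<Sum>k\<in>I. (d B * lam B k) * M k A)"
    using assms(3) by (simp add: sum_distrib_left mult.assoc mult.left_commute)
  then show False using M[OF assms(1,1)] M[OF assms(2,1)] ne d_nonzero[OF assms(2)] by simp
qed

text \<open>Like associativity below, this is inherited from the complex numbers: both sides have the same value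
  under every character $\lambda_A$.\<close>

lemma N_comm:
  assumes "K \<in> I" "L \<in> I" "M \<in> I"
  shows "N K L M = N L K M"
proof -
  have "(of_nat (N K L M) :: complex) - of_nat (N L K M) = 0"
  proof (rule separate[of "\<lambda>M. of_nat (N K L M) - of_nat (N L K M)", OF _ assms(3)])
    fix A assume A: "A \<in> I"
    show "(\<Sum>M\<in>I. lam A M * (of_nat (N K L M) - of_nat (N L K M))) = 0"
      using lam_mult[OF A assms(1,2)] lam_mult[OF A assms(2,1)]
      by (simp add: right_diff_distrib sum_subtractf mult.commute)
  qed
  then show ?thesis by simp
qed

lemma N_assoc:
  assumes "K \<in> I" "L \<in> I" "P \<in> I" "Q \<in> I"
  shows "(\<Sum>M\<in>I. N K L M * N M P Q) = (\<Sum>M\<in>I. N L P M * N K M Q)"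
proof -
  let ?a = "\<lambda>Q. (\<Sum>M\<in>I. of_nat (N K L M) * of_nat (N M P Q)) :: complex"
  let ?b = "\<lambda>Q. (\<Sum>M\<in>I. of_nat (N L P M) * of_nat (N K M Q)) :: complex"
  have "?a Q - ?b Q = 0"
  proof (rule separate[of "\<lambda>Q. ?a Q - ?b Q", OF _ assms(4)])
    fix A assume A: "A \<in> I"
    have "(\<Sum>Q\<in>I. lam A Q * ?a Q) = (\<Sum>M\<in>I. of_nat (N K L M) * (\<Sum>Q\<in>I. of_nat (N M P Q) * lam A Q))"
      unfolding sum_distrib_left by (subst sum.swap) (simp add: ac_simps)
    also have "\<dots> = (\<Sum>M\<in>I. of_nat (N K L M) * (lam A M * lam A P))"
      by (rule sum.cong[OF refl]) (simp add: lam_mult[OF A _ assms(3)])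
    also have "\<dots> = lam A K * lam A L * lam A P"
      unfolding lam_mult[OF A assms(1,2)] sum_distrib_right by (simp add: mult.assoc)
    finally have a: "(\<Sum>Q\<in>I. lam A Q * ?a Q) = lam A K * lam A L * lam A P" .
    have "(\<Sum>Q\<in>I. lam A Q * ?b Q) = (\<Sum>M\<in>I. of_nat (N L P M) * (\<Sum>Q\<in>I. of_nat (N K M Q) * lam A Q))"
      unfolding sum_distrib_left by (subst sum.swap) (simp add: ac_simps)
    also have "\<dots> = (\<Sum>M\<in>I. of_nat (N L P M) * (lam A K * lam A M))"
      by (rule sum.cong[OF refl]) (simp add: lam_mult[OF A assms(1)])
    also have "\<dots> = lam A K * (lam A L * lam A P)"
      unfolding lam_mult[OF A assms(2,3)] sum_distrib_left by (simp add: ac_simps)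
    finally show "(\<Sum>Q\<in>I. lam A Q * (?a Q - ?b Q)) = 0"
      using a by (simp add: right_diff_distrib sum_subtractf)
  qed
  then have "(of_nat (\<Sum>M\<in>I. N K L M * N M P Q) :: complex) = of_nat (\<Sum>M\<in>I. N L P M * N K M Q)"
    by simp
  then show ?thesis by (simp only: of_nat_eq_iff)
qed

lemma star_star:
  assumes K: "K \<in> I"
  shows "star (star K) = K"
proof -
  have "(1 :: nat) = N K (star K) u" using N_unit[OF K star_I[OF K]] by simp
  also have "\<dots> = N (star K) K u" using N_comm[OF K star_I[OF K] u_I] .
  also have "\<dots> = of_bool (K = star (star K))" using N_unit[OF star_I[OF K] K] .
  finally have "of_bool (K = star (star K)) = (1 :: nat)" by (rule sym)
  then have "K = star (star K)" by (simp only: of_bool_eq_1_iff)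
  then show ?thesis by (rule sym)
qed

lemma N_u:
  assumes "L \<in> I" "M \<in> I"
  shows "N u L M = of_bool (M = L)"
  using N_comm[OF u_I assms] N_frob[OF assms(1) u_I assms(2)] N_unit[of "star L" M] star_star assms by simp

lemma star_u: "star u = u"
proof -
  have "of_bool (u = star u) = N u u u" using N_unit[OF u_I u_I] by (rule sym)
  also have "\<dots> = 1" using N_u[OF u_I u_I] by simp
  finally have "u = star u" by (simp only: of_bool_eq_1_iff)
  then show ?thesis by (rule sym)
qed

lemma N_star:
  assumes "K \<in> I" "L \<in> I" "M \<in> I"
  shows "N K L M = N (star K) (star L) (star M)"
proof -
  have "N K L M = N (star K) M L" using assms by (rule N_frob)
  also have "\<dots> = N M (star K) L" using assms by (intro N_comm) auto
  also have "\<dots> = N (star M) L (star K)" using assms by (intro N_frob) auto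
  also have "\<dots> = N L (star M) (star K)" using assms by (intro N_comm) auto
  also have "\<dots> = N (star L) (star K) (star M)" using assms by (intro N_frob) auto
  also have "\<dots> = N (star K) (star L) (star M)" using assms by (intro N_comm) auto
  finally show ?thesis .
qed

text \<open>The character takes an idempotent value at the unit; it cannot be $0$, since then all of $\lambda_A$ and a
  row of $S$ would vanish.\<close>

lemma lam_u: "A \<in> I \<Longrightarrow> lam A u = 1"
proof (rule ccontr)
  assume A: "A \<in> I" and ne: "lam A u \<noteq> 1"
  have z: "lam A L = 0" if L: "L \<in> I" for L
  proof -
    have "lam A u * lam A L = (\<Sum>M\<in>I. of_nat (of_bool (M = L)) * lam A M)"
      unfolding lam_mult[OF A u_I L] using N_u[OF L] by (intro sum.cong) auto
    also have "\<dots> = lam A L" using L by (simp add: of_bool_def if_distrib if_distribR sum.delta cong: if_cong)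
    finally show ?thesis using ne by (simp add: mult_cancel_right1)
  qed
  obtain M where M: "\<And>i j. i \<in> I \<Longrightarrow> j \<in> I \<Longrightarrow> (\<Sum>k\<in>I. (d i * lam i k) * M k j) = of_bool (i = j)"
    using S_inv unfolding invertible_on_def by blast
  show False using M[OF A A] z by simp
qed

lemma lam_u_left: "K \<in> I \<Longrightarrow> lam u K = d K"
  using S_sym[of u K] lam_u[of K] d_u by simp

definition character :: "('i \<Rightarrow> complex) \<Rightarrow> bool" where
  "character \<chi> \<longleftrightarrow> (\<forall>K\<in>I. \<forall>L\<in>I. \<chi> K * \<chi> L = (\<Sum>M\<in>I. of_nat (N K L M) * \<chi> M))"

lemma character_lam: "A \<in> I \<Longrightarrow> character (lam A)"
  using lam_mult by (simp add: character_def)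

lemma sum_star: "(\<Sum>K\<in>I. f (star K)) = (\<Sum>K\<in>I. f K)"
  by (rule sum.reindex_bij_witness[of _ star star]) (auto simp: star_star)

definition pairing :: "('i \<Rightarrow> complex) \<Rightarrow> ('i \<Rightarrow> complex) \<Rightarrow> complex" where
  "pairing \<chi> \<chi>' = (\<Sum>Y\<in>I. \<chi> Y * \<chi>' (star Y))"

text \<open>The element $E = \sum_Y Y \otimes Y^*$ satisfies $(Z \otimes 1) E = (1 \otimes Z) E$ by Frobenius
  reciprocity; apply $\chi \otimes \chi'$.\<close>

lemma character_orthogonality:
  assumes \<chi>: "character \<chi>" and \<chi>': "character \<chi>'" and Z: "Z \<in> I"
  shows "\<chi> Z * pairing \<chi> \<chi>' = \<chi>' Z * pairing \<chi> \<chi>'"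
proof -
  have "\<chi> Z * pairing \<chi> \<chi>' = (\<Sum>Y\<in>I. (\<chi> Z * \<chi> Y) * \<chi>' (star Y))"
    by (simp add: pairing_def sum_distrib_left mult.assoc)
  also have "\<dots> = (\<Sum>Y\<in>I. \<Sum>W\<in>I. of_nat (N Z Y W) * \<chi> W * \<chi>' (star Y))"
    using \<chi> Z by (simp add: character_def sum_distrib_right)
  also have "\<dots> = (\<Sum>W\<in>I. \<Sum>Y\<in>I. of_nat (N Z (star W) (star Y)) * \<chi> W * \<chi>' (star Y))"
  proof (subst sum.swap, intro sum.cong refl)
    fix W Y assume WY: "W \<in> I" "Y \<in> I"
    have "N Z Y W = N (star Z) W Y" using Z WY by (intro N_frob)
    also have "\<dots> = N (star (star Z)) (star W) (star Y)" using Z WY by (intro N_star) auto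
    finally show "of_nat (N Z Y W) * \<chi> W * \<chi>' (star Y) = of_nat (N Z (star W) (star Y)) * \<chi> W * \<chi>' (star Y)"
      using star_star[OF Z] by simp
  qed
  also have "\<dots> = (\<Sum>W\<in>I. \<chi> W * (\<Sum>V\<in>I. of_nat (N Z (star W) V) * \<chi>' V))"
  proof (rule sum.cong[OF refl])
    fix W
    show "(\<Sum>Y\<in>I. of_nat (N Z (star W) (star Y)) * \<chi> W * \<chi>' (star Y)) = \<chi> W * (\<Sum>V\<in>I. of_nat (N Z (star W) V) * \<chi>' V)"
      using sum_star[of "\<lambda>V. of_nat (N Z (star W) V) * \<chi> W * \<chi>' V"] by (simp add: sum_distrib_left ac_simps)
  qed
  also have "\<dots> = (\<Sum>W\<in>I. \<chi> W * (\<chi>' Z * \<chi>' (star W)))"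
    using \<chi>' Z by (intro sum.cong refl) (simp add: character_def)
  also have "\<dots> = \<chi>' Z * pairing \<chi> \<chi>'"
    by (simp add: pairing_def sum_distrib_left ac_simps)
  finally show ?thesis .
qed

lemma pairing_zero:
  assumes "character \<chi>" "character \<chi>'" "Z \<in> I" "\<chi> Z \<noteq> \<chi>' Z"
  shows "pairing \<chi> \<chi>' = 0"
  using character_orthogonality[OF assms(1-3)] assms(4) by simp

text \<open>A further character would be orthogonal to every $\lambda_A$, hence zero.\<close>

lemma character_is_lam:
  assumes "character \<chi>" "\<chi> u = 1"
  shows "\<exists>A\<in>I. \<forall>K\<in>I. \<chi> K = lam A K"
proof (rule ccontr)
  assume none: "\<not> ?thesis"
  have "\<chi> (star u) = 0"
  proof (rule separate[of "\<lambda>K. \<chi> (star K)", OF _ u_I])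
    fix A assume A: "A \<in> I"
    then obtain K where "K \<in> I" "lam A K \<noteq> \<chi> K" using none by metis
    from pairing_zero[OF character_lam[OF A] assms(1) this] show "(\<Sum>K\<in>I. lam A K * \<chi> (star K)) = 0"
      by (simp add: pairing_def)
  qed
  then show False using assms(2) star_u by simp
qed

definition global :: complex where
  "global = (\<Sum>K\<in>I. (d K)\<^sup>2)"

text \<open>The vector $\lambda_B \circ {*}$ is mapped by $S$ to a multiple of the basis vector $B$, by orthogonality.
  So both sides are the value of the symmetric form $S$ at $\lambda_A \circ {*}$ and
  $\lambda_B \circ {*}$.\<close>

lemma pairing_lam_swap:
  assumes A: "A \<in> I" and B: "B \<in> I"
  shows "d B * pairing (lam B) (lam B) * lam A (star B) = d A * pairing (lam A) (lam A) * lam B (star A)"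
proof -
  have *: "(\<Sum>Y\<in>I. \<Sum>Z\<in>I. lam A (star Y) * (d Y * lam Y Z) * lam B (star Z)) =
    d B * pairing (lam B) (lam B) * lam A (star B)" if A: "A \<in> I" and B: "B \<in> I" for A B
  proof -
    have "(\<Sum>Y\<in>I. \<Sum>Z\<in>I. lam A (star Y) * (d Y * lam Y Z) * lam B (star Z)) =
      (\<Sum>Y\<in>I. lam A (star Y) * d Y * pairing (lam Y) (lam B))"
      by (simp add: pairing_def sum_distrib_left mult.assoc)
    also have "\<dots> = (\<Sum>Y\<in>I. if Y = B then lam A (star B) * d B * pairing (lam B) (lam B) else 0)"
    proof (intro sum.cong refl)
      fix Y assume Y: "Y \<in> I"
      show "lam A (star Y) * d Y * pairing (lam Y) (lam B) = (if Y = B then lam A (star B) * d B * pairing (lam B) (lam B) else 0)"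
      proof (cases "Y = B")
        case False
        then obtain K where "K \<in> I" "lam Y K \<noteq> lam B K" using lam_inj[OF Y B] by blast
        then show ?thesis using pairing_zero[OF character_lam[OF Y] character_lam[OF B]] False by simp
      qed simp
    qed
    also have "\<dots> = lam A (star B) * d B * pairing (lam B) (lam B)" using B by simp
    finally show ?thesis by (simp add: ac_simps)
  qed
  have "(\<Sum>Y\<in>I. \<Sum>Z\<in>I. lam A (star Y) * (d Y * lam Y Z) * lam B (star Z)) =
    (\<Sum>Z\<in>I. \<Sum>Y\<in>I. lam B (star Z) * (d Z * lam Z Y) * lam A (star Y))"
    by (subst sum.swap) (intro sum.cong refl, simp add: S_sym ac_simps)
  then show ?thesis using *[OF A B] *[OF B A] by simp
qed

text \<open>The previous lemma for $A$ the unit, where $\lambda_u = d$.\<close>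

lemma pairing_lam_self: "B \<in> I \<Longrightarrow> pairing (lam B) (lam B) * (d B)\<^sup>2 = global"
proof -
  assume B: "B \<in> I"
  have "pairing (lam u) (lam u) = global"
    unfolding pairing_def global_def by (intro sum.cong refl) (simp add: lam_u_left d_star power2_eq_square)
  then show ?thesis
    using pairing_lam_swap[OF u_I B] B by (simp add: lam_u_left d_star star_u lam_u d_u power2_eq_square ac_simps)
qed

lemma global_nonzero: "global \<noteq> 0"
proof
  assume "global = 0"
  then have z: "pairing (lam B) (lam B) = 0" if "B \<in> I" for B using pairing_lam_self[OF that] d_nonzero[OF that] by simp
  have "lam u (star u) = 0"
  proof (rule separate[of "\<lambda>K. lam u (star K)", OF _ u_I])
    fix A assume A: "A \<in> I"
    have "pairing (lam A) (lam u) = 0"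
    proof (cases "A = u")
      case True
      then show ?thesis using z[OF u_I] by simp
    next
      case False
      then obtain K where "K \<in> I" "lam A K \<noteq> lam u K" using lam_inj[OF A u_I] by blast
      then show ?thesis by (rule pairing_zero[OF character_lam[OF A] character_lam[OF u_I]])
    qed
    then show "(\<Sum>K\<in>I. lam A K * lam u (star K)) = 0" by (simp add: pairing_def)
  qed
  then show False using star_u lam_u[OF u_I] by simp
qed

text \<open>By \<open>pairing_lam_self\<close> the norm of $\lambda_A$ under the pairing is $D / d_A^2$ for one number $D \neq 0$, which
  cancels from \<open>pairing_lam_swap\<close>.  The statement is $S_{A,B^*} = S_{B,A^*}$.\<close>

lemma S_star:
  assumes A: "A \<in> I" and B: "B \<in> I"
  shows "d A * lam A (star B) = d B * lam B (star A)"
proof -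
  have "(d A * d B) * (d B * pairing (lam B) (lam B) * lam A (star B)) = (d A * d B) * (d A * pairing (lam A) (lam A) * lam B (star A))"
    using pairing_lam_swap[OF A B] by simp
  then have "(pairing (lam B) (lam B) * (d B)\<^sup>2) * (d A * lam A (star B)) = (pairing (lam A) (lam A) * (d A)\<^sup>2) * (d B * lam B (star A))"
    by (simp add: power2_eq_square ac_simps)
  then show ?thesis unfolding pairing_lam_self[OF A] pairing_lam_self[OF B] using global_nonzero by simp
qed

text \<open>The vector $(\lambda_x(K))_K$ is an eigenvector of multiplication by $\sum_{A \in R} A A^*$ on the fusion
  ring, and its entry at the unit is $1$.\<close>

lemma lam_algebraic:
  assumes x: "x \<in> I" and R: "R \<subseteq> I"
  shows "algebraic_int (\<Sum>A\<in>R. lam x A * lam x (star A))"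
proof (rule algebraic_int_eigenvalue[OF finite_I u_I, of "lam x" _ "\<lambda>K L. \<Sum>A\<in>R. \<Sum>M\<in>I. int (N A (star A) M * N M K L)"])
  show "lam x u \<noteq> 0" using lam_u[OF x] by simp
  fix K assume K: "K \<in> I"
  have "(\<Sum>A\<in>R. lam x A * lam x (star A)) * lam x K = (\<Sum>A\<in>R. \<Sum>M\<in>I. of_nat (N A (star A) M) * (lam x M * lam x K))"
    unfolding sum_distrib_right
  proof (rule sum.cong[OF refl])
    fix A assume "A \<in> R"
    then have A: "A \<in> I" using R by blast
    show "lam x A * lam x (star A) * lam x K = (\<Sum>M\<in>I. of_nat (N A (star A) M) * (lam x M * lam x K))"
      unfolding lam_mult[OF x A star_I[OF A]] sum_distrib_right mult.assoc ..
  qed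
  also have "\<dots> = (\<Sum>A\<in>R. \<Sum>M\<in>I. \<Sum>L\<in>I. of_nat (N A (star A) M) * of_nat (N M K L) * lam x L)"
    by (intro sum.cong refl) (simp add: lam_mult[OF x _ K] sum_distrib_left mult.assoc)
  also have "\<dots> = (\<Sum>A\<in>R. \<Sum>L\<in>I. \<Sum>M\<in>I. of_nat (N A (star A) M) * of_nat (N M K L) * lam x L)"
    by (intro sum.cong refl sum.swap)
  also have "\<dots> = (\<Sum>L\<in>I. \<Sum>A\<in>R. \<Sum>M\<in>I. of_nat (N A (star A) M) * of_nat (N M K L) * lam x L)"
    by (rule sum.swap)
  also have "\<dots> = (\<Sum>L\<in>I. of_int (\<Sum>A\<in>R. \<Sum>M\<in>I. int (N A (star A) M * N M K L)) * lam x L)"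
    by (simp add: sum_distrib_right)
  finally show "(\<Sum>A\<in>R. lam x A * lam x (star A)) * lam x K =
    (\<Sum>L\<in>I. of_int (\<Sum>A\<in>R. \<Sum>M\<in>I. int (N A (star A) M * N M K L)) * lam x L)" .
qed

text \<open>Twisting by $\zeta^{\deg}$ permutes the characters, and this permutation acts freely where
  $f(A) = \lambda_x(A)\,\lambda_x(A^*)$ is non-zero.\<close>

theorem grading_divides:
  fixes deg :: "'i \<Rightarrow> nat" and n :: nat
  assumes n: "0 < n" and x: "x \<in> I" and degx: "deg x mod n = 1 mod n"
    and deg: "\<And>K L M. \<lbrakk>K \<in> I; L \<in> I; M \<in> I; N K L M \<noteq> 0\<rbrakk> \<Longrightarrow> deg M mod n = (deg K + deg L) mod n"
  shows "algebraic_int (global / of_nat n / (d x)\<^sup>2)"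
proof -
  define \<zeta> where "\<zeta> = cis (2 * pi / of_nat n)"
  have \<zeta>n: "\<zeta> ^ n = 1" using n by (simp add: \<zeta>_def DeMoivre)
  have \<zeta>mod: "\<zeta> ^ k = \<zeta> ^ (k mod n)" for k
  proof -
    have "\<zeta> ^ k = \<zeta> ^ (n * (k div n) + k mod n)" by simp
    also have "\<dots> = \<zeta> ^ (k mod n)" by (simp only: power_add power_mult \<zeta>n power_one mult_1)
    finally show ?thesis .
  qed
  have \<zeta>prim: "\<zeta> ^ k \<noteq> 1" if "0 < k" "k < n" for k
  proof
    assume "\<zeta> ^ k = 1"
    then have "cis (real k * (2 * pi / of_nat n)) = 1" by (simp add: \<zeta>_def DeMoivre)
    then have "cos (real k * (2 * pi / of_nat n)) = 1" by (metis cis.sel(1) one_complex.sel(1))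
    then obtain m :: int where "real k * (2 * pi / of_nat n) = of_int m * 2 * pi"
      unfolding cos_one_2pi_int by blast
    then have "real k = of_int m * real n" using n pi_gt_zero by (simp add: field_simps)
    then have "int k = m * int n" by (metis of_int_eq_iff of_int_mult of_int_of_nat_eq)
    then show False using that by (metis dvd_triv_right int_dvd_int_iff nat_dvd_not_less)
  qed
  have \<zeta>0: "\<zeta> \<noteq> 0" by (simp add: \<zeta>_def)
  have degu: "\<zeta> ^ deg u = 1"
  proof -
    have "deg u mod n = (deg u + deg u) mod n" using deg[OF u_I u_I u_I] N_u[OF u_I u_I] by simp
    then have "\<zeta> ^ deg u = \<zeta> ^ (deg u + deg u)" using \<zeta>mod by metis
    then show ?thesis using \<zeta>0 by (simp add: power_add)
  qed
  have degstar: "\<zeta> ^ deg K * \<zeta> ^ deg (star K) = 1" if K: "K \<in> I" for K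
  proof -
    have "deg u mod n = (deg K + deg (star K)) mod n" using deg[OF K star_I[OF K] u_I] N_unit[OF K star_I[OF K]] by simp
    then have "\<zeta> ^ deg u = \<zeta> ^ (deg K + deg (star K))" using \<zeta>mod by metis
    then show ?thesis using degu by (simp add: power_add)
  qed
  have twist: "\<exists>B\<in>I. \<forall>K\<in>I. \<zeta> ^ deg K * lam A K = lam B K" if A: "A \<in> I" for A
  proof (rule character_is_lam)
    show "\<zeta> ^ deg u * lam A u = 1" using degu lam_u[OF A] by simp
    show "character (\<lambda>K. \<zeta> ^ deg K * lam A K)"
      unfolding character_def
    proof (intro ballI)
      fix K L assume KL: "K \<in> I" "L \<in> I"
      have "(\<zeta> ^ deg K * lam A K) * (\<zeta> ^ deg L * lam A L) = \<zeta> ^ (deg K + deg L) * (lam A K * lam A L)"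
        by (simp add: power_add)
      also have "\<dots> = (\<Sum>M\<in>I. \<zeta> ^ (deg K + deg L) * (of_nat (N K L M) * lam A M))"
        unfolding lam_mult[OF A KL] by (rule sum_distrib_left)
      also have "\<dots> = (\<Sum>M\<in>I. of_nat (N K L M) * (\<zeta> ^ deg M * lam A M))"
      proof (intro sum.cong refl)
        fix M assume M: "M \<in> I"
        show "\<zeta> ^ (deg K + deg L) * (of_nat (N K L M) * lam A M) = of_nat (N K L M) * (\<zeta> ^ deg M * lam A M)"
        proof (cases "N K L M = 0")
          case False
          then have "\<zeta> ^ deg M = \<zeta> ^ (deg K + deg L)" using deg[OF KL M] \<zeta>mod by metis
          then show ?thesis by simp
        qed simp
      qed
      finally show "(\<zeta> ^ deg K * lam A K) * (\<zeta> ^ deg L * lam A L) = (\<Sum>M\<in>I. of_nat (N K L M) * (\<zeta> ^ deg M * lam A M))" .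
    qed
  qed
  then have "\<forall>A\<in>I. \<exists>B. B \<in> I \<and> (\<forall>K\<in>I. \<zeta> ^ deg K * lam A K = lam B K)" by blast
  from bchoice[OF this] obtain \<sigma> where
    \<sigma>': "\<forall>A\<in>I. \<sigma> A \<in> I \<and> (\<forall>K\<in>I. \<zeta> ^ deg K * lam A K = lam (\<sigma> A) K)" by blast
  have \<sigma>I: "\<sigma> A \<in> I" if "A \<in> I" for A using \<sigma>' that by blast
  have \<sigma>: "lam (\<sigma> A) K = \<zeta> ^ deg K * lam A K" if "A \<in> I" "K \<in> I" for A K using \<sigma>' that by auto
  have itI: "(\<sigma> ^^ k) A \<in> I" if "A \<in> I" for k A using that \<sigma>I by (induct k) auto
  have it: "lam ((\<sigma> ^^ k) A) K = (\<zeta> ^ deg K) ^ k * lam A K" if "A \<in> I" "K \<in> I" for k A K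
    by (induct k) (use that \<sigma> itI in auto)
  define f where "f A = lam x A * lam x (star A)" for A
  \<comment> \<open>The symmetry of $S$ moves the variable of $f$ into the index of $\lambda$, where the twist multiplies the two factors by inverse roots of unity.\<close>
  have fA: "(d x)\<^sup>2 * f A = (d A)\<^sup>2 * (lam A x * lam A (star x))" if A: "A \<in> I" for A
  proof -
    have "(d x)\<^sup>2 * f A = (d x * lam x A) * (d x * lam x (star A))" by (simp add: f_def power2_eq_square ac_simps)
    also have "\<dots> = (d A * lam A x) * (d A * lam A (star x))" using S_sym[OF x A] S_star[OF x A] by simp
    finally show ?thesis by (simp add: power2_eq_square ac_simps)
  qed
  have dsq: "(d (\<sigma> A))\<^sup>2 = (d A)\<^sup>2" if A: "A \<in> I" for A
  proof -
    have "pairing (lam (\<sigma> A)) (lam (\<sigma> A)) = (\<Sum>K\<in>I. (\<zeta> ^ deg K * \<zeta> ^ deg (star K)) * (lam A K * lam A (star K)))"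
      unfolding pairing_def by (intro sum.cong refl) (simp add: \<sigma>[OF A] ac_simps)
    also have "\<dots> = pairing (lam A) (lam A)" unfolding pairing_def by (intro sum.cong refl) (simp add: degstar)
    finally have "pairing (lam A) (lam A) * (d (\<sigma> A))\<^sup>2 = pairing (lam A) (lam A) * (d A)\<^sup>2"
      using pairing_lam_self[OF A] pairing_lam_self[OF \<sigma>I[OF A]] by simp
    moreover have "pairing (lam A) (lam A) \<noteq> 0" using pairing_lam_self[OF A] global_nonzero by auto
    ultimately show ?thesis by simp
  qed
  have f\<sigma>: "f (\<sigma> A) = f A" if A: "A \<in> I" for A
  proof -
    have "(d x)\<^sup>2 * f (\<sigma> A) = (d A)\<^sup>2 * ((\<zeta> ^ deg x * \<zeta> ^ deg (star x)) * (lam A x * lam A (star x)))"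
      unfolding fA[OF \<sigma>I[OF A]] dsq[OF A] by (simp add: \<sigma>[OF A] x)
    also have "\<dots> = (d x)\<^sup>2 * f A" using fA[OF A] degstar[OF x] by simp
    finally show ?thesis using d_nonzero[OF x] by simp
  qed
  \<comment> \<open>A return after fewer than $n$ steps would make $\lambda_A(x)$, hence $f(A)$, vanish.\<close>
  define J where "J = {A \<in> I. f A \<noteq> 0}"
  have "\<exists>R\<subseteq>J. sum f J = of_nat n * sum f R"
  proof (rule sum_free_orbits[where \<sigma> = \<sigma>, OF _ _ _ _ _ n])
    show "finite J" by (simp add: J_def)
    show "\<sigma> A \<in> J" "f (\<sigma> A) = f A" if "A \<in> J" for A using that f\<sigma> \<sigma>I by (auto simp: J_def)
    show "(\<sigma> ^^ n) A = A" if "A \<in> J" for A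
    proof (rule lam_inj)
      show "(\<sigma> ^^ n) A \<in> I" "A \<in> I" using that itI by (auto simp: J_def)
      fix K assume "K \<in> I"
      then show "lam ((\<sigma> ^^ n) A) K = lam A K"
        using it[OF \<open>A \<in> I\<close>, of K n] \<zeta>n by (simp add: power_mult[symmetric] mult.commute[of "deg K"]) (simp add: power_mult)
    qed
    show "(\<sigma> ^^ k) A \<noteq> A" if "A \<in> J" "0 < k" "k < n" for A k
    proof
      assume eq: "(\<sigma> ^^ k) A = A"
      have A: "A \<in> I" "f A \<noteq> 0" using that by (auto simp: J_def)
      have "\<zeta> ^ deg x = \<zeta> ^ 1" using \<zeta>mod[of "deg x"] \<zeta>mod[of 1] degx by metis
      then have "lam A x = \<zeta> ^ k * lam A x" using it[OF A(1) x, of k] eq by simp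
      moreover have "lam A x \<noteq> 0" using fA[OF A(1)] A(2) d_nonzero[OF x] by auto
      ultimately show False using \<zeta>prim[OF that(2,3)] by simp
    qed
  qed
  then obtain R where R: "R \<subseteq> J" "sum f J = of_nat n * sum f R" by blast
  have "global / (d x)\<^sup>2 = pairing (lam x) (lam x)"
    using pairing_lam_self[OF x] d_nonzero[OF x] by (simp add: field_simps)
  also have "\<dots> = sum f I" by (simp add: pairing_def f_def)
  also have "\<dots> = sum f J" by (rule sum.mono_neutral_right) (auto simp: J_def)
  finally have "global / (d x)\<^sup>2 = of_nat n * sum f R" using R(2) by simp
  moreover have "global / of_nat n / (d x)\<^sup>2 = global / (d x)\<^sup>2 / of_nat n" by (simp add: mult.commute)
  ultimately have "global / of_nat n / (d x)\<^sup>2 = sum f R" using n by simp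
  moreover have "R \<subseteq> I" using R(1) by (auto simp: J_def)
  ultimately show ?thesis using lam_algebraic[OF x] by (simp add: f_def)
qed

end

section \<open>Grading by the powers of a generator\<close>

context modular_data
begin

text \<open>The simple constituents of products.  The grading depends on the fusion ring through such supports only.\<close>

definition set_prod :: "'i set \<Rightarrow> 'i set \<Rightarrow> 'i set" where
  "set_prod A B = {M \<in> I. \<exists>K\<in>A. \<exists>L\<in>B. N K L M \<noteq> 0}"

lemma set_prod_subset: "set_prod A B \<subseteq> I"
  by (auto simp: set_prod_def)

lemma set_prod_mono: "A \<subseteq> A' \<Longrightarrow> B \<subseteq> B' \<Longrightarrow> set_prod A B \<subseteq> set_prod A' B'"
  unfolding set_prod_def by blast

lemma in_set_prod: "\<lbrakk>K \<in> A; L \<in> B; M \<in> I; N K L M \<noteq> 0\<rbrakk> \<Longrightarrow> M \<in> set_prod A B"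
  by (auto simp: set_prod_def)

lemma set_prod_comm:
  assumes "A \<subseteq> I" "B \<subseteq> I"
  shows "set_prod A B = set_prod B A"
proof -
  have s: "set_prod A B \<subseteq> set_prod B A" if AB: "A \<subseteq> I" "B \<subseteq> I" for A B
  proof
    fix M assume "M \<in> set_prod A B"
    then obtain K L where KL: "K \<in> A" "L \<in> B" "M \<in> I" "N K L M \<noteq> 0" by (auto simp: set_prod_def)
    moreover have "K \<in> I" "L \<in> I" using KL(1,2) AB by blast+
    ultimately have "N L K M \<noteq> 0" using N_comm[of K L M] by simp
    then show "M \<in> set_prod B A" by (rule in_set_prod[OF KL(2,1,3)])
  qed
  show ?thesis by (rule subset_antisym[OF s[OF assms] s[OF assms(2,1)]])
qed

lemma set_prod_unit: "A \<subseteq> I \<Longrightarrow> set_prod {u} A = A"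
  unfolding set_prod_def by (auto simp: N_u subset_iff of_bool_def split: if_splits)

text \<open>Multiplicities are non-negative, so associativity of fusion passes to supports.\<close>

lemma set_prod_assoc:
  assumes "A \<subseteq> I" "B \<subseteq> I" "D \<subseteq> I"
  shows "set_prod (set_prod A B) D = set_prod A (set_prod B D)"
proof -
  have key: "(\<exists>M\<in>I. N K L M \<noteq> 0 \<and> N M P Q \<noteq> 0) \<longleftrightarrow> (\<exists>M\<in>I. N L P M \<noteq> 0 \<and> N K M Q \<noteq> 0)"
    if "K \<in> I" "L \<in> I" "P \<in> I" "Q \<in> I" for K L P Q
  proof -
    have "(\<exists>M\<in>I. N K L M \<noteq> 0 \<and> N M P Q \<noteq> 0) \<longleftrightarrow> (\<Sum>M\<in>I. N K L M * N M P Q) \<noteq> 0"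
      by (simp add: sum_eq_0_iff)
    also have "\<dots> \<longleftrightarrow> (\<exists>M\<in>I. N L P M \<noteq> 0 \<and> N K M Q \<noteq> 0)"
      unfolding N_assoc[OF that] by (simp add: sum_eq_0_iff)
    finally show ?thesis .
  qed
  have "Q \<in> set_prod (set_prod A B) D \<longleftrightarrow> Q \<in> set_prod A (set_prod B D)" for Q
  proof -
    have "Q \<in> set_prod (set_prod A B) D \<longleftrightarrow> Q \<in> I \<and> (\<exists>K\<in>A. \<exists>L\<in>B. \<exists>P\<in>D. \<exists>M\<in>I. N K L M \<noteq> 0 \<and> N M P Q \<noteq> 0)"
      unfolding set_prod_def by blast
    also have "\<dots> \<longleftrightarrow> Q \<in> I \<and> (\<exists>K\<in>A. \<exists>L\<in>B. \<exists>P\<in>D. \<exists>M\<in>I. N L P M \<noteq> 0 \<and> N K M Q \<noteq> 0)"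
    proof -
      have "(\<exists>M\<in>I. N K L M \<noteq> 0 \<and> N M P Q \<noteq> 0) \<longleftrightarrow> (\<exists>M\<in>I. N L P M \<noteq> 0 \<and> N K M Q \<noteq> 0)"
        if "Q \<in> I" "K \<in> A" "L \<in> B" "P \<in> D" for K L P
        by (rule key) (use that assms in blast)+
      then show ?thesis by (simp cong: conj_cong bex_cong)
    qed
    also have "\<dots> \<longleftrightarrow> Q \<in> set_prod A (set_prod B D)"
      unfolding set_prod_def by blast
    finally show ?thesis .
  qed
  then show ?thesis by blast
qed

lemma set_prod_nonempty:
  assumes "K \<in> I" "L \<in> I"
  shows "set_prod {K} {L} \<noteq> {}"
proof
  assume "set_prod {K} {L} = {}"
  then have z: "N K L M = 0" if "M \<in> I" for M using that by (auto simp: set_prod_def)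
  have "d K * d L = 0" using lam_mult[OF u_I assms] z by (simp add: lam_u_left assms)
  then show False using d_nonzero assms by simp
qed

lemma set_prod_star: "A \<subseteq> I \<Longrightarrow> B \<subseteq> I \<Longrightarrow> star ` set_prod A B \<subseteq> set_prod (star ` A) (star ` B)"
proof
  fix Q assume AB: "A \<subseteq> I" "B \<subseteq> I" and "Q \<in> star ` set_prod A B"
  then obtain M K L where "M \<in> I" "K \<in> A" "L \<in> B" "N K L M \<noteq> 0" "Q = star M" by (auto simp: set_prod_def)
  then show "Q \<in> set_prod (star ` A) (star ` B)"
    using AB N_star[of K L M] by (auto simp: set_prod_def subset_iff)
qed

lemma u_in_set_prod_star: "K \<in> I \<Longrightarrow> u \<in> set_prod {K} {star K}"
  by (simp add: set_prod_def N_unit)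

primrec gen_power :: "'i \<Rightarrow> nat \<Rightarrow> 'i set" where
  "gen_power x 0 = {u}"
| "gen_power x (Suc k) = set_prod {x} (gen_power x k)"

lemma gen_power_subset: "gen_power x k \<subseteq> I"
  by (cases k) (auto simp: set_prod_def)

lemma gen_power_add: "x \<in> I \<Longrightarrow> set_prod (gen_power x k) (gen_power x l) = gen_power x (k + l)"
  by (induct k) (simp_all add: set_prod_unit gen_power_subset set_prod_assoc)

end

locale generated_modular_data = modular_data +
  fixes x :: 'a
  assumes x_I [simp]: "x \<in> I" and generates: "K \<in> I \<Longrightarrow> \<exists>k. K \<in> gen_power x k"
begin

text \<open>The exponents $k$ for which $x^k$ contains the unit; they form a submonoid of the natural numbers.\<close>

definition returns :: "nat set" where
  "returns = {k. u \<in> gen_power x k}"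

lemma returns_add: "k \<in> returns \<Longrightarrow> l \<in> returns \<Longrightarrow> k + l \<in> returns"
  unfolding returns_def mem_Collect_eq gen_power_add[OF x_I, symmetric]
  by (rule in_set_prod[OF _ _ u_I]) (auto simp: N_u)

lemma returns_0: "0 \<in> returns"
  by (simp add: returns_def)

lemma returns_mult: "k \<in> returns \<Longrightarrow> j * k \<in> returns"
  by (induct j) (auto intro: returns_add returns_0)

lemma gen_power_add_mem: "\<lbrakk>K \<in> gen_power x k; L \<in> gen_power x l; M \<in> I; N K L M \<noteq> 0\<rbrakk> \<Longrightarrow> M \<in> gen_power x (k + l)"
  unfolding gen_power_add[OF x_I, symmetric] by (rule in_set_prod)

lemma gen_power_return: "K \<in> gen_power x k \<Longrightarrow> g \<in> returns \<Longrightarrow> K \<in> gen_power x (k + g)"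
proof -
  assume K: "K \<in> gen_power x k" and g: "g \<in> returns"
  have KI: "K \<in> I" using K gen_power_subset by blast
  have "K \<in> gen_power x (g + k)"
    by (rule gen_power_add_mem[of u]) (use K g KI in \<open>auto simp: returns_def N_u\<close>)
  then show ?thesis by (simp add: add.commute)
qed

text \<open>If $K^*$ lies in $x^m$, then $K$ can be completed to the unit with $m$ further factors, whatever power
  contained $K$.\<close>

lemma return_complement:
  assumes "K \<in> I"
  obtains m where "star K \<in> gen_power x m" "\<And>k. K \<in> gen_power x k \<Longrightarrow> k + m \<in> returns"
proof -
  obtain m where m: "star K \<in> gen_power x m" using generates[of "star K"] assms by auto
  have "k + m \<in> returns" if "K \<in> gen_power x k" for k
    unfolding returns_def mem_Collect_eq by (rule gen_power_add_mem[OF that m]) (simp_all add: N_unit assms)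
  then show ?thesis using that m by blast
qed

text \<open>This is the greatest common divisor of \<open>returns\<close>.  As a difference of two elements it is
  directly usable for lifting two powers with the same residue to a common one.\<close>

definition period :: nat where
  "period = (LEAST n. 0 < n \<and> (\<exists>g\<in>returns. g + n \<in> returns))"

lemma period: "0 < period" "\<exists>g\<in>returns. g + period \<in> returns"
proof -
  obtain m where m: "\<And>k. x \<in> gen_power x k \<Longrightarrow> k + m \<in> returns" using return_complement[OF x_I] by blast
  have "x \<in> gen_power x 1" using N_comm[OF x_I u_I x_I] by (simp add: set_prod_def N_u)
  from m[OF this] have "0 < 1 + m \<and> (\<exists>g\<in>returns. g + (1 + m) \<in> returns)"
    using returns_0 by (intro conjI bexI[of _ 0]) simp_all
  then have "0 < period \<and> (\<exists>g\<in>returns. g + period \<in> returns)" unfolding period_def by (rule LeastI)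
  then show "0 < period" "\<exists>g\<in>returns. g + period \<in> returns" by auto
qed

text \<open>With $g$ and $g + n$ both return exponents and $k = q n + r$, the exponents $q (g + n)$ and
  $q g + k$ differ by $r$; minimality of $n$ forces $r = 0$.\<close>

lemma period_dvd:
  assumes k: "k \<in> returns"
  shows "period dvd k"
proof -
  obtain g where g: "g \<in> returns" "g + period \<in> returns" using period(2) by blast
  let ?q = "k div period" and ?r = "k mod period"
  have "?q * (g + period) \<in> returns" by (rule returns_mult[OF g(2)])
  moreover have "?q * (g + period) + ?r = ?q * g + k" by (simp add: algebra_simps)
  moreover have "?q * g + k \<in> returns" by (intro returns_add returns_mult g k)
  ultimately have "\<exists>h\<in>returns. h + ?r \<in> returns" by (intro bexI[of _ "?q * (g + period)"]) auto
  moreover have "?r < period" using period(1) by simp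
  ultimately have "?r = 0" using not_less_Least[of ?r "\<lambda>n. 0 < n \<and> (\<exists>g\<in>returns. g + n \<in> returns)"]
    unfolding period_def[symmetric] by (cases "?r = 0") simp_all
  then show ?thesis by (simp add: dvd_eq_mod_eq_0)
qed

definition degree :: "'a \<Rightarrow> nat" where
  "degree K = (SOME k. K \<in> gen_power x k) mod period"

lemma gen_power_mod_unique:
  assumes "K \<in> gen_power x k" "K \<in> gen_power x l"
  shows "k mod period = l mod period"
proof -
  have "K \<in> I" using assms gen_power_subset by blast
  then obtain m where m: "\<And>k. K \<in> gen_power x k \<Longrightarrow> k + m \<in> returns" using return_complement by blast
  have "(k + m) mod period = (l + m) mod period"
    using period_dvd[OF m[OF assms(1)]] period_dvd[OF m[OF assms(2)]] by (simp add: dvd_eq_mod_eq_0)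
  then have "(int k + int m) mod int period = (int l + int m) mod int period"
    by (metis of_nat_add zmod_int)
  then have "int period dvd (int k + int m) - (int l + int m)" by (simp only: mod_eq_dvd_iff)
  then have "int k mod int period = int l mod int period" by (simp add: mod_eq_dvd_iff)
  then show ?thesis by (metis of_nat_eq_iff zmod_int)
qed

lemma degree_eq: "K \<in> gen_power x k \<Longrightarrow> degree K = k mod period"
  unfolding degree_def by (rule gen_power_mod_unique[OF someI])

lemma degree_less: "degree K < period"
  unfolding degree_def using period(1) by simp

lemma degree_add:
  assumes "K \<in> I" "L \<in> I" "M \<in> I" "N K L M \<noteq> 0"
  shows "degree M = (degree K + degree L) mod period"
proof -
  obtain k l where kl: "K \<in> gen_power x k" "L \<in> gen_power x l" using generates assms by blast
  from gen_power_add_mem[OF this assms(3,4)] have "degree M = (k + l) mod period" by (rule degree_eq)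
  then show ?thesis using degree_eq[OF kl(1)] degree_eq[OF kl(2)] by (simp add: mod_add_eq)
qed

lemma degree_surj:
  assumes "r < period"
  shows "\<exists>K\<in>I. degree K = r"
proof -
  have "gen_power x k \<noteq> {}" for k
  proof (induct k)
    case (Suc k)
    then obtain K where K: "K \<in> gen_power x k" by blast
    then have "set_prod {x} {K} \<noteq> {}" using set_prod_nonempty[OF x_I] gen_power_subset by blast
    moreover have "set_prod {x} {K} \<subseteq> set_prod {x} (gen_power x k)" using K by (intro set_prod_mono) auto
    ultimately show ?case by auto
  qed simp
  then obtain K where K: "K \<in> gen_power x r" by blast
  show ?thesis
    by (rule bexI[of _ K]) (use K gen_power_subset degree_eq[OF K] assms in auto)
qed

text \<open>If $l = k + j n$ and $g$, $g + n$ are return exponents, then $x^{k + j (g + n)}$ contains $x^k$ and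
  $x^{l + j g}$ contains $x^l$, and the two exponents agree.\<close>

lemma same_degree_power:
  assumes "K \<in> I" "L \<in> I" "degree K = degree L"
  shows "\<exists>m. K \<in> gen_power x m \<and> L \<in> gen_power x m"
proof -
  have main: "\<exists>m. K \<in> gen_power x m \<and> L \<in> gen_power x m"
    if KL: "K \<in> gen_power x k" "L \<in> gen_power x l" and kl: "k \<le> l" and m: "k mod period = l mod period" for K L k l
  proof -
    obtain j where j: "l = k + j * period"
      using m kl by (metis add.commute mod_eq_nat1E mult.commute)
    obtain g where g: "g \<in> returns" "g + period \<in> returns" using period(2) by blast
    have "K \<in> gen_power x (k + j * (g + period))" by (rule gen_power_return[OF KL(1) returns_mult[OF g(2)]])
    moreover have "L \<in> gen_power x (l + j * g)" by (rule gen_power_return[OF KL(2) returns_mult[OF g(1)]])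
    moreover have "l + j * g = k + j * (g + period)" using j by (simp add: algebra_simps)
    ultimately show ?thesis by auto
  qed
  obtain k l where kl: "K \<in> gen_power x k" "L \<in> gen_power x l" using generates assms by blast
  have m: "k mod period = l mod period" unfolding degree_eq[OF kl(1), symmetric] degree_eq[OF kl(2), symmetric] by (rule assms(3))
  show ?thesis
  proof (cases "k \<le> l")
    case True
    then show ?thesis by (rule main[OF kl _ m])
  next
    case False
    then have "l \<le> k" by simp
    from main[OF kl(2,1) this m[symmetric]] show ?thesis by blast
  qed
qed

lemma degree_u: "degree u = 0"
  using degree_eq[of u 0] by simp

lemma degree_x: "degree x mod period = 1 mod period"
proof -
  have "x \<in> gen_power x 1" using N_comm[OF x_I u_I x_I] by (simp add: set_prod_def N_u)
  from degree_eq[OF this] show ?thesis by simp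
qed

lemma degree_set_prod_star:
  assumes "K \<in> I" "M \<in> set_prod {K} {star K}"
  shows "degree M = 0"
proof -
  have "M \<in> I" "N K (star K) M \<noteq> 0" using assms by (auto simp: set_prod_def)
  then have "degree M = (degree K + degree (star K)) mod period" using assms by (intro degree_add) auto
  also have "\<dots> = degree u" using assms by (intro degree_add[symmetric]) (auto simp: N_unit)
  finally show ?thesis using degree_u by simp
qed

text \<open>The simple constituents of the powers of $x\,x^*$, which lie in the adjoint subcategory.\<close>

primrec adj :: "nat \<Rightarrow> 'a set" where
  "adj 0 = {u}"
| "adj (Suc j) = set_prod (set_prod {x} {star x}) (adj j)"

lemma gen_power_star_gen_power: "set_prod (gen_power x m) (star ` gen_power x m) \<subseteq> adj m"
proof (induct m)
  case 0
  then show ?case by (simp add: star_u set_prod_unit)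
next
  case (Suc m)
  let ?P = "gen_power x m" and ?X = "{x}" and ?Y = "{star x}"
  have sub: "?P \<subseteq> I" "star ` ?P \<subseteq> I" using gen_power_subset[of x m] by auto
  have "set_prod (gen_power x (Suc m)) (star ` gen_power x (Suc m)) \<subseteq> set_prod (set_prod ?X ?P) (set_prod ?Y (star ` ?P))"
    using set_prod_star[of ?X ?P] sub by (intro set_prod_mono) auto
  also have "\<dots> = set_prod (set_prod ?X (set_prod ?P ?Y)) (star ` ?P)"
    using sub set_prod_subset by (simp add: set_prod_assoc)
  also have "set_prod ?P ?Y = set_prod ?Y ?P" using sub by (intro set_prod_comm) auto
  also have "set_prod (set_prod ?X (set_prod ?Y ?P)) (star ` ?P) = set_prod (set_prod ?X ?Y) (set_prod ?P (star ` ?P))"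
    using sub set_prod_subset by (simp add: set_prod_assoc)
  also have "\<dots> \<subseteq> adj (Suc m)" unfolding adj.simps by (rule set_prod_mono[OF subset_refl Suc])
  finally show ?case .
qed

text \<open>If $K$ and $L$ both lie in $x^m$, then $K$ lies in $K L^* L$, and $K L^*$ in $x^m (x^*)^m = (x x^*)^m$.\<close>

lemma same_degree_adj:
  assumes "K \<in> I" "L \<in> I" "degree K = degree L"
  shows "\<exists>m. \<exists>A\<in>adj m. N A L K \<noteq> 0"
proof -
  obtain m where m: "K \<in> gen_power x m" "L \<in> gen_power x m" using same_degree_power[OF assms] by blast
  have "set_prod {K} (set_prod {star L} {L}) = set_prod (set_prod {K} {star L}) {L}" using assms by (intro set_prod_assoc[symmetric]) auto
  moreover have "set_prod {star L} {L} = set_prod {L} {star L}" using assms by (intro set_prod_comm) auto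
  moreover have "K \<in> set_prod {K} (set_prod {L} {star L})"
    by (rule in_set_prod[OF _ u_in_set_prod_star[OF assms(2)]]) (use assms N_comm[of K u K] in \<open>auto simp: N_u\<close>)
  ultimately have "K \<in> set_prod (set_prod {K} {star L}) {L}" by simp
  then obtain A where A: "A \<in> set_prod {K} {star L}" "N A L K \<noteq> 0" by (auto simp: set_prod_def)
  have "set_prod {K} {star L} \<subseteq> set_prod (gen_power x m) (star ` gen_power x m)" using m by (intro set_prod_mono) auto
  then show ?thesis using A gen_power_star_gen_power by blast
qed

end

section \<open>The fusion ring of a modular category\<close>

context modular_fusion_category
begin

definition iso_rel :: "('o \<times> 'o) set" where
  "iso_rel = {(X, Y). simple_obj C X \<and> simple_obj C Y \<and> isomorphic C X Y}"

definition iso_class :: "'o \<Rightarrow> 'o set" where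
  "iso_class X = iso_rel `` {X}"

lemma Irr_eq: "Irr C = Collect (simple_obj C) // iso_rel"
  by (simp add: Irr_def iso_rel_def)

lemma equiv_iso_rel: "equiv (Collect (simple_obj C)) iso_rel"
proof (rule equivI)
  show "iso_rel \<subseteq> Collect (simple_obj C) \<times> Collect (simple_obj C)" by (auto simp: iso_rel_def)
  show "refl_on (Collect (simple_obj C)) iso_rel" by (auto simp: iso_rel_def refl_on_def)
  show "sym iso_rel" by (auto simp: iso_rel_def sym_def isomorphic_sym)
  show "trans iso_rel" unfolding trans_def iso_rel_def using isomorphic_trans by blast
qed

lemma iso_class_Irr: "simple_obj C X \<Longrightarrow> iso_class X \<in> Irr C"
  by (auto simp: Irr_eq iso_class_def intro: quotientI)

lemma iso_class_eq_iff: "\<lbrakk>simple_obj C X; simple_obj C Y\<rbrakk> \<Longrightarrow> iso_class X = iso_class Y \<longleftrightarrow> isomorphic C X Y"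
  unfolding iso_class_def using eq_equiv_class_iff[OF equiv_iso_rel, of X Y] by (simp add: iso_rel_def)

lemma rep_in: "K \<in> Irr C \<Longrightarrow> rep K \<in> K"
  unfolding rep_def some_in_eq Irr_eq by (rule in_quotient_imp_non_empty[OF equiv_iso_rel])

lemma rep_simple:
  assumes "K \<in> Irr C"
  shows "simple_obj C (rep K)"
proof -
  have "K \<subseteq> Collect (simple_obj C)"
    using assms unfolding Irr_eq by (rule in_quotient_imp_subset[OF equiv_iso_rel])
  then show ?thesis using rep_in[OF assms] by blast
qed

lemma iso_class_rep: "K \<in> Irr C \<Longrightarrow> iso_class (rep K) = K"
proof -
  assume K: "K \<in> Irr C"
  then obtain Y where Y: "K = iso_rel `` {Y}" by (auto simp: Irr_eq quotient_def)
  have "(Y, rep K) \<in> iso_rel" using rep_in[OF K] Y by simp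
  then show ?thesis using equiv_class_eq[OF equiv_iso_rel, of Y "rep K"] Y by (simp add: iso_class_def)
qed

lemma rep_iso_class: "simple_obj C X \<Longrightarrow> isomorphic C (rep (iso_class X)) X"
  using iso_class_eq_iff[OF rep_simple[OF iso_class_Irr], of X X] iso_class_rep[OF iso_class_Irr] by simp

lemma isomorphic_ten:
  assumes "isomorphic C X X'" "isomorphic C Y Y'"
  shows "isomorphic C (X \<otimes>\<^sub>o Y) (X' \<otimes>\<^sub>o Y')"
proof -
  obtain f g where "f \<in> Hom C X X'" "iso_arrow C f" "g \<in> Hom C Y Y'" "iso_arrow C g"
    using assms by (auto simp: isomorphic_def)
  then show ?thesis unfolding isomorphic_def by (intro bexI[of _ "f \<otimes>\<^sub>m g"]) (auto simp: ten_Hom)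
qed

lemma isomorphic_ten_unit: "isomorphic C (X \<otimes>\<^sub>o \<one>\<^sub>o) X"
  unfolding isomorphic_def by (intro bexI[of _ "runit C X"]) (auto simp: runit_Hom)

lemma unit_simple: "simple_obj C \<one>\<^sub>o"
proof (rule simpleI_hom_dim)
  let ?i = "idm C \<one>\<^sub>o"
  have s: "scalar C (scale C a ?i) = a" for a
    using scale_inj[of ?i, OF _ scalar[of "scale C a ?i"]] unit_nonzero by (simp add: Hom_iff)
  have lf: "linfun \<one>\<^sub>o \<one>\<^sub>o (scalar C)"
    unfolding linfun_def
  proof (intro conjI ballI allI)
    fix f g assume f: "f \<in> Hom C \<one>\<^sub>o \<one>\<^sub>o" and g: "g \<in> Hom C \<one>\<^sub>o \<one>\<^sub>o"
    have "plusm C f g = plusm C (scale C (scalar C f) ?i) (scale C (scalar C g) ?i)"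
      by (rule arg_cong2[OF scalar[OF f] scalar[OF g]])
    then show "scalar C (plusm C f g) = scalar C f + scalar C g" by (simp add: scale_add[symmetric] s)
  next
    fix a f assume f: "f \<in> Hom C \<one>\<^sub>o \<one>\<^sub>o"
    have "scale C a f = scale C a (scale C (scalar C f) ?i)" by (rule arg_cong[OF scalar[OF f]])
    then show "scalar C (scale C a f) = a * scalar C f" by (simp add: s)
  qed
  have "hom_frame \<one>\<^sub>o \<one>\<^sub>o {0} (\<lambda>_. ?i) (\<lambda>_. scalar C)"
    unfolding hom_frame_def
  proof (intro conjI ballI allI impI)
    show "scalar C ?i = 1" using s[of 1] by simp
    fix \<psi> h assume \<psi>: "linfun \<one>\<^sub>o \<one>\<^sub>o \<psi>" and h: "h \<in> Hom C \<one>\<^sub>o \<one>\<^sub>o"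
    have "\<psi> h = \<psi> (scale C (scalar C h) ?i)" by (rule arg_cong[OF scalar[OF h]])
    also have "\<dots> = scalar C h * \<psi> ?i" by (rule linfun_scale[OF \<psi>]) (simp add: Hom_iff)
    finally show "\<psi> h = (\<Sum>j\<in>{0::nat}. scalar C h * \<psi> ?i)" by simp
  qed (use lf in \<open>simp_all add: Hom_iff\<close>)
  then show "hom_dim \<one>\<^sub>o \<one>\<^sub>o 1" unfolding hom_dim_def by (intro exI conjI) auto
qed

lemma hom_mult_unit_ten:
  assumes "simple_obj C X" "simple_obj C Y"
  shows "hom_mult \<one>\<^sub>o (X \<otimes>\<^sub>o Y) = of_bool (isomorphic C Y (dualO C X))"
proof -
  have "hom_mult \<one>\<^sub>o (X \<otimes>\<^sub>o Y) = hom_mult Y (dualO C X \<otimes>\<^sub>o \<one>\<^sub>o)" by (rule hom_mult_frobenius[OF unit_simple assms(2)])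
  also have "\<dots> = hom_mult Y (dualO C X)" by (rule hom_mult_isomorphic[OF assms(2) isomorphic_ten_unit])
  also have "\<dots> = of_bool (isomorphic C Y (dualO C X))" by (rule hom_mult_simple[OF assms(2) dual_simple[OF assms(1)]])
  finally show ?thesis .
qed

definition fusion_coeff :: "'o set \<Rightarrow> 'o set \<Rightarrow> 'o set \<Rightarrow> nat" where
  "fusion_coeff K L M = hom_mult (rep M) (rep K \<otimes>\<^sub>o rep L)"

text \<open>The loop coloured $Z$ is the sum of the loops coloured by the simple summands of $Z$.\<close>

lemma lam_multiplicities:
  assumes A: "simple_obj C A"
  shows "lam A Z = (\<Sum>M\<in>Irr C. of_nat (hom_mult (rep M) Z) * lam A (rep M))"
proof -
  obtain Ss where Ss: "\<forall>S\<in>set Ss. simple_obj C S" "direct_sum C Z Ss" using semisimple[of Z] by blast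
  let ?n = "length Ss"
  have S: "simple_obj C (Ss ! k)" if "k < ?n" for k using Ss(1) that by simp
  have "lam A Z = (\<Sum>k<?n. lam A (Ss ! k))" by (rule lam_direct_sum[OF A Ss(2)])
  also have "\<dots> = (\<Sum>M\<in>Irr C. \<Sum>k\<in>{k. k \<in> {..<?n} \<and> iso_class (Ss ! k) = M}. lam A (Ss ! k))"
    by (rule sum.group[symmetric]) (use finite_Irr S iso_class_Irr in auto)
  also have "\<dots> = (\<Sum>M\<in>Irr C. of_nat (hom_mult (rep M) Z) * lam A (rep M))"
  proof (rule sum.cong[OF refl])
    fix M assume M: "M \<in> Irr C"
    have iff: "iso_class (Ss ! k) = M \<longleftrightarrow> isomorphic C (rep M) (Ss ! k)" if "k < ?n" for k
      using iso_class_eq_iff[OF rep_simple[OF M] S[OF that]] iso_class_rep[OF M] by auto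
    have set: "{k. k \<in> {..<?n} \<and> iso_class (Ss ! k) = M} = {k. k < ?n \<and> isomorphic C (rep M) (Ss ! k)}"
      using iff by auto
    have "(\<Sum>k\<in>{k. k < ?n \<and> isomorphic C (rep M) (Ss ! k)}. lam A (Ss ! k)) =
      (\<Sum>k\<in>{k. k < ?n \<and> isomorphic C (rep M) (Ss ! k)}. lam A (rep M))"
      by (rule sum.cong[OF refl]) (auto intro: lam_isomorphic[OF A])
    then show "(\<Sum>k\<in>{k. k \<in> {..<?n} \<and> iso_class (Ss ! k) = M}. lam A (Ss ! k)) = of_nat (hom_mult (rep M) Z) * lam A (rep M)"
      unfolding set hom_mult_decomposition[OF rep_simple[OF M] Ss(2,1)] by simp
  qed
  finally show ?thesis .
qed

lemma S_matrix_lam: "K \<in> Irr C \<Longrightarrow> S_matrix C K L = qdim C (rep K) * lam (rep K) (rep L)"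
  unfolding S_matrix_def using qtrace_double_braid[OF rep_simple, of K "rep L"] by (simp add: double_braid_def mult.commute)

lemma invertible_on_cong:
  assumes "invertible_on I M" "\<And>i j. i \<in> I \<Longrightarrow> j \<in> I \<Longrightarrow> M i j = M' i j"
  shows "invertible_on I M'"
proof -
  obtain N where N: "\<forall>i\<in>I. \<forall>j\<in>I. (\<Sum>k\<in>I. M i k * N k j) = of_bool (i = j) \<and> (\<Sum>k\<in>I. N i k * M k j) = of_bool (i = j)"
    using assms(1) unfolding invertible_on_def by blast
  have "(\<Sum>k\<in>I. M' i k * N k j) = of_bool (i = j) \<and> (\<Sum>k\<in>I. N i k * M' k j) = of_bool (i = j)"
    if ij: "i \<in> I" "j \<in> I" for i j
  proof -
    have "(\<Sum>k\<in>I. M' i k * N k j) = (\<Sum>k\<in>I. M i k * N k j)" "(\<Sum>k\<in>I. N i k * M' k j) = (\<Sum>k\<in>I. N i k * M k j)"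
      by (rule sum.cong[OF refl], use ij assms(2) in simp)+
    then show ?thesis using N ij by simp
  qed
  then show ?thesis unfolding invertible_on_def by blast
qed

text \<open>The dimension of the unit is idempotent, and not zero since a row of the S-matrix would vanish.\<close>

lemma qdim_unit: "qdim C \<one>\<^sub>o = 1"
proof -
  let ?u = "iso_class \<one>\<^sub>o"
  have u: "?u \<in> Irr C" by (rule iso_class_Irr[OF unit_simple])
  obtain N where "\<forall>i\<in>Irr C. \<forall>j\<in>Irr C. (\<Sum>k\<in>Irr C. S_matrix C i k * N k j) = of_bool (i = j)"
    using S_nondegenerate unfolding invertible_on_def by blast
  then have "(\<Sum>k\<in>Irr C. S_matrix C ?u k * N k ?u) = 1" using u by simp
  then have "qdim C (rep ?u) \<noteq> 0" using S_matrix_lam[OF u] by auto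
  then have nz: "qdim C \<one>\<^sub>o \<noteq> 0" using qdim_isomorphic[OF rep_iso_class[OF unit_simple]] by simp
  have "qdim C \<one>\<^sub>o * qdim C \<one>\<^sub>o = qdim C \<one>\<^sub>o"
    using qdim_ten[of "\<one>\<^sub>o" "\<one>\<^sub>o"] qdim_isomorphic[OF isomorphic_ten_unit[of "\<one>\<^sub>o"]] by simp
  then show ?thesis using nz by simp
qed

sublocale md: modular_data "Irr C" fusion_coeff "iso_class \<one>\<^sub>o" "\<lambda>K. iso_class (dualO C (rep K))" "\<lambda>K. qdim C (rep K)" "\<lambda>K L. lam (rep K) (rep L)"
proof
  show "finite (Irr C)" by (rule finite_Irr)
  show "iso_class \<one>\<^sub>o \<in> Irr C" by (rule iso_class_Irr[OF unit_simple])
  show st: "iso_class (dualO C (rep K)) \<in> Irr C" if "K \<in> Irr C" for K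
    by (rule iso_class_Irr[OF dual_simple[OF rep_simple[OF that]]])
  show "lam (rep A) (rep K) * lam (rep A) (rep L) = (\<Sum>M\<in>Irr C. of_nat (fusion_coeff K L M) * lam (rep A) (rep M))"
    if "A \<in> Irr C" "K \<in> Irr C" "L \<in> Irr C" for A K L
    using lam_multiplicities[OF rep_simple[OF that(1)], of "rep K \<otimes>\<^sub>o rep L"] lam_ten[OF rep_simple[OF that(1)]]
    by (simp add: fusion_coeff_def)
  show "qdim C (rep A) * lam (rep A) (rep K) = qdim C (rep K) * lam (rep K) (rep A)"
    if "A \<in> Irr C" "K \<in> Irr C" for A K
    using qtrace_double_braid[OF rep_simple[OF that(1)], of "rep K"] qtrace_double_braid[OF rep_simple[OF that(2)], of "rep A"]
      qtrace_double_braid_sym[of "rep A" "rep K"] by (simp add: mult.commute)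
  show "invertible_on (Irr C) (\<lambda>A K. qdim C (rep A) * lam (rep A) (rep K))"
    by (rule invertible_on_cong[OF S_nondegenerate]) (simp add: S_matrix_lam)
  show "fusion_coeff K L M = fusion_coeff (iso_class (dualO C (rep K))) M L" if "K \<in> Irr C" "L \<in> Irr C" "M \<in> Irr C" for K L M
  proof -
    have "fusion_coeff K L M = hom_mult (rep L) (dualO C (rep K) \<otimes>\<^sub>o rep M)"
      unfolding fusion_coeff_def by (rule hom_mult_frobenius[OF rep_simple[OF that(3)] rep_simple[OF that(2)]])
    also have "\<dots> = hom_mult (rep L) (rep (iso_class (dualO C (rep K))) \<otimes>\<^sub>o rep M)"
      by (rule hom_mult_isomorphic[OF rep_simple[OF that(2)] isomorphic_ten[OF isomorphic_sym[OF rep_iso_class] isomorphic_refl]])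
        (rule dual_simple[OF rep_simple[OF that(1)]])
    finally show ?thesis unfolding fusion_coeff_def .
  qed
  show "fusion_coeff K L (iso_class \<one>\<^sub>o) = of_bool (L = iso_class (dualO C (rep K)))" if "K \<in> Irr C" "L \<in> Irr C" for K L
  proof -
    have "fusion_coeff K L (iso_class \<one>\<^sub>o) = hom_mult \<one>\<^sub>o (rep K \<otimes>\<^sub>o rep L)"
      unfolding fusion_coeff_def by (rule hom_mult_isomorphic_source[OF unit_simple rep_iso_class[OF unit_simple]])
    also have "\<dots> = of_bool (isomorphic C (rep L) (dualO C (rep K)))"
      by (rule hom_mult_unit_ten[OF rep_simple[OF that(1)] rep_simple[OF that(2)]])
    also have "isomorphic C (rep L) (dualO C (rep K)) \<longleftrightarrow> L = iso_class (dualO C (rep K))"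
      using iso_class_eq_iff[OF rep_simple[OF that(2)] dual_simple[OF rep_simple[OF that(1)]]] iso_class_rep[OF that(2)] by simp
    finally show ?thesis .
  qed
  show "qdim C (rep (iso_class (dualO C (rep K)))) = qdim C (rep K)" if "K \<in> Irr C" for K
    using qdim_isomorphic[OF rep_iso_class[OF dual_simple[OF rep_simple[OF that]]]] spherical[of "rep K"] by simp
  show "qdim C (rep (iso_class \<one>\<^sub>o)) = 1"
    using qdim_isomorphic[OF rep_iso_class[OF unit_simple]] qdim_unit by simp
qed

definition constituents :: "'o \<Rightarrow> 'o set set" where
  "constituents Y = {M \<in> Irr C. hom_mult (rep M) Y \<noteq> 0}"

text \<open>Both sides have the same value under every $\lambda_A$, since $\lambda_A(Y \otimes Z) = \lambda_A(Y)\,\lambda_A(Z)$.\<close>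

lemma hom_mult_ten:
  assumes "M \<in> Irr C"
  shows "hom_mult (rep M) (Y \<otimes>\<^sub>o Z) = (\<Sum>K\<in>Irr C. \<Sum>L\<in>Irr C. hom_mult (rep K) Y * hom_mult (rep L) Z * fusion_coeff K L M)"
proof -
  let ?m = "\<lambda>M. of_nat (hom_mult (rep M) (Y \<otimes>\<^sub>o Z)) :: complex"
  let ?s = "\<lambda>M. (\<Sum>K\<in>Irr C. \<Sum>L\<in>Irr C. of_nat (hom_mult (rep K) Y * hom_mult (rep L) Z * fusion_coeff K L M)) :: complex"
  have "?m M - ?s M = 0"
  proof (rule md.separate[of "\<lambda>M. ?m M - ?s M", OF _ assms])
    fix A assume A: "A \<in> Irr C"
    let ?l = "\<lambda>K. lam (rep A) (rep K)"
    have "(\<Sum>M\<in>Irr C. ?l M * ?m M) = lam (rep A) (Y \<otimes>\<^sub>o Z)"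
      using lam_multiplicities[OF rep_simple[OF A], of "Y \<otimes>\<^sub>o Z"] by (simp add: mult.commute)
    also have "\<dots> = (\<Sum>K\<in>Irr C. of_nat (hom_mult (rep K) Y) * ?l K) * (\<Sum>L\<in>Irr C. of_nat (hom_mult (rep L) Z) * ?l L)"
      unfolding lam_ten[OF rep_simple[OF A]] lam_multiplicities[OF rep_simple[OF A], of Y, symmetric]
        lam_multiplicities[OF rep_simple[OF A], of Z, symmetric] ..
    also have "\<dots> = (\<Sum>K\<in>Irr C. \<Sum>L\<in>Irr C. of_nat (hom_mult (rep K) Y) * of_nat (hom_mult (rep L) Z) * (?l K * ?l L))"
      unfolding sum_product by (simp add: ac_simps)
    also have "\<dots> = (\<Sum>K\<in>Irr C. \<Sum>L\<in>Irr C. \<Sum>M\<in>Irr C. ?l M * of_nat (hom_mult (rep K) Y * hom_mult (rep L) Z * fusion_coeff K L M))"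
      by (intro sum.cong refl) (simp add: md.lam_mult[OF A] sum_distrib_left ac_simps)
    also have "\<dots> = (\<Sum>K\<in>Irr C. \<Sum>M\<in>Irr C. \<Sum>L\<in>Irr C. ?l M * of_nat (hom_mult (rep K) Y * hom_mult (rep L) Z * fusion_coeff K L M))"
      by (intro sum.cong refl sum.swap)
    also have "\<dots> = (\<Sum>M\<in>Irr C. \<Sum>K\<in>Irr C. \<Sum>L\<in>Irr C. ?l M * of_nat (hom_mult (rep K) Y * hom_mult (rep L) Z * fusion_coeff K L M))"
      by (rule sum.swap)
    also have "\<dots> = (\<Sum>M\<in>Irr C. ?l M * ?s M)" by (simp only: sum_distrib_left)
    finally show "(\<Sum>M\<in>Irr C. ?l M * (?m M - ?s M)) = 0" by (simp add: right_diff_distrib sum_subtractf)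
  qed
  then have "?m M = of_nat (\<Sum>K\<in>Irr C. \<Sum>L\<in>Irr C. hom_mult (rep K) Y * hom_mult (rep L) Z * fusion_coeff K L M)" by simp
  then show ?thesis by (simp only: of_nat_eq_iff)
qed

lemma constituents_ten: "constituents (Y \<otimes>\<^sub>o Z) = md.set_prod (constituents Y) (constituents Z)"
proof -
  have "M \<in> constituents (Y \<otimes>\<^sub>o Z) \<longleftrightarrow> M \<in> md.set_prod (constituents Y) (constituents Z)" for M
  proof (cases "M \<in> Irr C")
    case True
    have "hom_mult (rep M) (Y \<otimes>\<^sub>o Z) \<noteq> 0 \<longleftrightarrow>
      (\<exists>K\<in>Irr C. \<exists>L\<in>Irr C. hom_mult (rep K) Y * hom_mult (rep L) Z * fusion_coeff K L M \<noteq> 0)"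
      unfolding hom_mult_ten[OF True] by (simp add: sum_eq_0_iff finite_Irr)
    then show ?thesis using True by (auto simp: constituents_def md.set_prod_def)
  qed (auto simp: constituents_def md.set_prod_def)
  then show ?thesis by blast
qed

lemma constituents_simple:
  assumes "simple_obj C Y"
  shows "constituents Y = {iso_class Y}"
proof -
  have "M \<in> constituents Y \<longleftrightarrow> M = iso_class Y" if M: "M \<in> Irr C" for M
    using hom_mult_simple[OF rep_simple[OF M] assms] iso_class_eq_iff[OF rep_simple[OF M] assms] iso_class_rep[OF M] M
    by (auto simp: constituents_def)
  then show ?thesis using iso_class_Irr[OF assms] by (auto simp: constituents_def)
qed

lemma constituents_subset: "constituents Y \<subseteq> Irr C"
  by (auto simp: constituents_def)

lemma constituent_constituents: "simple_obj C S \<Longrightarrow> constituent C S Z \<longleftrightarrow> iso_class S \<in> constituents Z"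
  using hom_mult_isomorphic_source[OF _ rep_iso_class, of S Z] iso_class_Irr by (simp add: constituent_iff constituents_def)

lemma constituents_direct_sum:
  assumes "direct_sum C Z Ss" "\<forall>S\<in>set Ss. simple_obj C S" "M \<in> constituents Z"
  shows "\<exists>S\<in>set Ss. M = iso_class S"
proof -
  have M: "M \<in> Irr C" using assms(3) by (simp add: constituents_def)
  have "hom_mult (rep M) Z \<noteq> 0" using assms(3) by (simp add: constituents_def)
  then have "{k. k < length Ss \<and> isomorphic C (rep M) (Ss ! k)} \<noteq> {}"
    unfolding hom_mult_decomposition[OF rep_simple[OF M] assms(1,2)] by (metis card.empty)
  then obtain k where k: "k < length Ss" "isomorphic C (rep M) (Ss ! k)" by blast
  have "simple_obj C (Ss ! k)" using assms(2) k(1) by simp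
  then have "M = iso_class (Ss ! k)" using iso_class_eq_iff[OF rep_simple[OF M]] k(2) iso_class_rep[OF M] by simp
  then show ?thesis using k(1) by auto
qed

lemma generated_constituents:
  assumes "Z \<in> generated C A" "M \<in> constituents Z"
  shows "\<exists>Xs. set Xs \<subseteq> A \<and> M \<in> constituents (tensor_list C Xs)"
proof -
  obtain Ss where Ss: "direct_sum C Z Ss" "\<forall>S\<in>set Ss. \<exists>Xs. set Xs \<subseteq> A \<and> constituent C S (tensor_list C Xs)"
    using assms(1) unfolding generated_def by blast
  have simple: "\<forall>S\<in>set Ss. simple_obj C S" using Ss(2) by (auto simp: constituent_def)
  from constituents_direct_sum[OF Ss(1) this assms(2)] obtain S where S: "S \<in> set Ss" "M = iso_class S" by blast
  then obtain Xs where Xs: "set Xs \<subseteq> A" "constituent C S (tensor_list C Xs)" using Ss(2) by blast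
  have "M \<in> constituents (tensor_list C Xs)" using constituent_constituents[of S] Xs(2) S simple by simp
  then show ?thesis using Xs(1) by blast
qed

lemma tensor_list_generated:
  assumes "set Xs \<subseteq> A"
  shows "tensor_list C Xs \<in> generated C A"
proof -
  obtain Ss where Ss: "\<forall>S\<in>set Ss. simple_obj C S" "direct_sum C (tensor_list C Xs) Ss"
    using semisimple[of "tensor_list C Xs"] by blast
  have "constituent C S (tensor_list C Xs)" if S_in: "S \<in> set Ss" for S
  proof -
    obtain k where k: "k < length Ss" "S = Ss ! k" using S_in by (auto simp: in_set_conv_nth)
    have S: "simple_obj C S" using Ss(1) S_in by blast
    have "k \<in> {k. k < length Ss \<and> isomorphic C S (Ss ! k)}" using k by simp
    then have "card {k. k < length Ss \<and> isomorphic C S (Ss ! k)} \<noteq> 0" by (auto simp: card_eq_0_iff)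
    then show ?thesis using hom_mult_decomposition[OF S Ss(2,1)] S by (simp add: constituent_iff)
  qed
  then show ?thesis using Ss(2) assms unfolding generated_def by blast
qed

lemma constituents_tensor_list: "constituents (tensor_list C (replicate k X)) = md.gen_power (iso_class X) k" if "simple_obj C X"
  by (induct k) (simp_all add: constituents_ten constituents_simple that unit_simple)

text \<open>The unit is a constituent of $S \otimes S^*$, which determines the class of $S^*$ from that of $S$.\<close>

lemma iso_class_dual:
  assumes "simple_obj C S"
  shows "iso_class (dualO C S) = iso_class (dualO C (rep (iso_class S)))"
proof -
  have "iso_class \<one>\<^sub>o \<in> constituents (S \<otimes>\<^sub>o dualO C S)"
    using hom_mult_unit_ten[OF assms dual_simple[OF assms]] constituent_constituents[OF unit_simple, of "S \<otimes>\<^sub>o dualO C S"] unit_simple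
    by (simp add: constituent_iff)
  then have "fusion_coeff (iso_class S) (iso_class (dualO C S)) (iso_class \<one>\<^sub>o) \<noteq> 0"
    unfolding constituents_ten constituents_simple[OF assms] constituents_simple[OF dual_simple[OF assms]] by (auto simp: md.set_prod_def)
  then show ?thesis
    using md.N_unit[OF iso_class_Irr[OF assms] iso_class_Irr[OF dual_simple[OF assms]]] by (simp add: of_bool_def split: if_splits)
qed

end

locale generated_modular_category = modular_fusion_category C
  for C :: "('o, 'm, 'z) braided_piv_cat_scheme" (structure) +
  fixes X :: 'o
  assumes X_simple: "simple_obj C X" and X_generates: "generated C {X} = UNIV"
begin

sublocale gen: generated_modular_data "Irr C" fusion_coeff "iso_class \<one>\<^sub>o" "\<lambda>K. iso_class (dualO C (rep K))" "\<lambda>K. qdim C (rep K)"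
  "\<lambda>K L. lam (rep K) (rep L)" "iso_class X"
proof
  show "iso_class X \<in> Irr C" by (rule iso_class_Irr[OF X_simple])
  fix K assume K: "K \<in> Irr C"
  have "K \<in> constituents (rep K)" using constituents_simple[OF rep_simple[OF K]] iso_class_rep[OF K] by simp
  then obtain Xs where Xs: "set Xs \<subseteq> {X}" "K \<in> constituents (tensor_list C Xs)"
    using generated_constituents[of "rep K" "{X}" K] X_generates by auto
  have "Xs = replicate (length Xs) X" using Xs(1) by (intro replicate_eqI) auto
  then have "constituents (tensor_list C Xs) = md.gen_power (iso_class X) (length Xs)"
    using constituents_tensor_list[OF X_simple, of "length Xs"] by simp
  then show "\<exists>k. K \<in> md.gen_power (iso_class X) k" using Xs(2) by blast
qed

text \<open>The unit is a constituent of $S \otimes S^*$ and has degree $0$, so all constituents of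
  $S \otimes S^*$ have.\<close>

lemma adjoint_degree:
  assumes "A \<in> adjoint_subcat C" "M \<in> constituents A"
  shows "gen.degree M = 0"
proof -
  obtain Xs where Xs: "set Xs \<subseteq> {S \<otimes>\<^sub>o dualO C S | S. simple_obj C S}" "M \<in> constituents (tensor_list C Xs)"
    using generated_constituents[OF assms(1)[unfolded adjoint_subcat_def] assms(2)] by blast
  then show ?thesis
  proof (induct Xs arbitrary: M)
    case Nil
    then show ?case using constituents_simple[OF unit_simple] gen.degree_u by simp
  next
    case (Cons Y Xs)
    obtain S where S: "Y = S \<otimes>\<^sub>o dualO C S" "simple_obj C S" using Cons(2) by auto
    obtain K L where KL: "K \<in> constituents Y" "L \<in> constituents (tensor_list C Xs)" "M \<in> Irr C" "fusion_coeff K L M \<noteq> 0"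
      using Cons(3) by (auto simp: constituents_ten md.set_prod_def)
    have "K \<in> md.set_prod {iso_class S} {iso_class (dualO C (rep (iso_class S)))}"
      using KL(1) unfolding S(1) constituents_ten constituents_simple[OF S(2)] constituents_simple[OF dual_simple[OF S(2)]] iso_class_dual[OF S(2)] .
    then have "gen.degree K = 0" by (rule gen.degree_set_prod_star[OF iso_class_Irr[OF S(2)]])
    moreover have "gen.degree L = 0" using Cons(1)[OF _ KL(2)] Cons(2) by simp
    moreover have "K \<in> Irr C" "L \<in> Irr C" using KL(1,2) constituents_subset by blast+
    ultimately show ?case using gen.degree_add[OF _ _ KL(3,4)] by simp
  qed
qed

definition adj_power :: "nat \<Rightarrow> 'o" where
  "adj_power m = tensor_list C (replicate m (X \<otimes>\<^sub>o dualO C X))"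

lemma adj_power_adjoint: "adj_power m \<in> adjoint_subcat C"
  unfolding adj_power_def adjoint_subcat_def using X_simple by (intro tensor_list_generated) auto

lemma constituents_adj_power: "constituents (adj_power m) = gen.adj m"
  unfolding adj_power_def
  by (induct m) (simp_all add: constituents_ten constituents_simple unit_simple X_simple dual_simple iso_class_dual)

text \<open>Tensoring with the adjoint subcategory on either side keeps the degree.  Conversely the power of
  $X \otimes X^*$ found by \<open>same_degree_adj\<close> links two simple objects of the same degree.\<close>

lemma same_component_iff:
  "(Y, Z) \<in> same_component C \<longleftrightarrow> simple_obj C Y \<and> simple_obj C Z \<and> gen.degree (iso_class Y) = gen.degree (iso_class Z)"
proof
  assume "(Y, Z) \<in> same_component C"
  then obtain A B where Y: "simple_obj C Y" and AB: "A \<in> adjoint_subcat C" "B \<in> adjoint_subcat C"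
    and c: "constituent C Z ((A \<otimes>\<^sub>o Y) \<otimes>\<^sub>o B)" unfolding same_component_def by blast
  have Z: "simple_obj C Z" using c by (simp add: constituent_def)
  have "iso_class Z \<in> md.set_prod (md.set_prod (constituents A) {iso_class Y}) (constituents B)"
    using c constituent_constituents[OF Z] by (simp add: constituents_ten constituents_simple[OF Y])
  then obtain K L M where K: "K \<in> Irr C" "M \<in> constituents A" "fusion_coeff M (iso_class Y) K \<noteq> 0"
    and L: "L \<in> constituents B" "fusion_coeff K L (iso_class Z) \<noteq> 0" by (auto simp: md.set_prod_def)
  have I: "M \<in> Irr C" "L \<in> Irr C" using K(2) L(1) constituents_subset by blast+
  have "gen.degree K = gen.degree (iso_class Y) mod gen.period"
    using gen.degree_add[OF I(1) iso_class_Irr[OF Y] K(1,3)] adjoint_degree[OF AB(1) K(2)] by simp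
  moreover have "gen.degree (iso_class Z) = gen.degree K mod gen.period"
    using gen.degree_add[OF K(1) I(2) iso_class_Irr[OF Z] L(2)] adjoint_degree[OF AB(2) L(1)] by simp
  ultimately show "simple_obj C Y \<and> simple_obj C Z \<and> gen.degree (iso_class Y) = gen.degree (iso_class Z)"
    using Y Z gen.degree_less[of "iso_class Y"] by simp
next
  assume a: "simple_obj C Y \<and> simple_obj C Z \<and> gen.degree (iso_class Y) = gen.degree (iso_class Z)"
  then have Y: "simple_obj C Y" and Z: "simple_obj C Z" by auto
  obtain m A where A: "A \<in> gen.adj m" "fusion_coeff A (iso_class Y) (iso_class Z) \<noteq> 0"
    using gen.same_degree_adj[OF iso_class_Irr[OF Z] iso_class_Irr[OF Y]] a by auto
  have "iso_class Z \<in> constituents ((adj_power m \<otimes>\<^sub>o Y) \<otimes>\<^sub>o adj_power 0)"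
  proof -
    have 1: "iso_class Z \<in> md.set_prod (constituents (adj_power m)) {iso_class Y}"
      by (rule md.in_set_prod[OF _ _ iso_class_Irr[OF Z] A(2)]) (use A(1) in \<open>simp_all add: constituents_adj_power\<close>)
    have "fusion_coeff (iso_class Z) (iso_class \<one>\<^sub>o) (iso_class Z) \<noteq> 0"
      using md.N_comm[OF iso_class_Irr[OF Z] md.u_I iso_class_Irr[OF Z]] md.N_u[OF iso_class_Irr[OF Z] iso_class_Irr[OF Z]] by simp
    from md.in_set_prod[OF 1 _ iso_class_Irr[OF Z] this, of "{iso_class \<one>\<^sub>o}"] show ?thesis
      by (simp add: constituents_ten constituents_simple[OF Y] constituents_adj_power[of 0])
  qed
  then have c: "constituent C Z ((adj_power m \<otimes>\<^sub>o Y) \<otimes>\<^sub>o adj_power 0)" using constituent_constituents[OF Z] by simp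
  have "\<exists>A\<in>adjoint_subcat C. \<exists>B\<in>adjoint_subcat C. constituent C Z ((A \<otimes>\<^sub>o Y) \<otimes>\<^sub>o B)"
  proof (rule bexI)
    show "\<exists>B\<in>adjoint_subcat C. constituent C Z ((adj_power m \<otimes>\<^sub>o Y) \<otimes>\<^sub>o B)"
      using c by (rule bexI) (rule adj_power_adjoint)
  qed (rule adj_power_adjoint)
  then show "(Y, Z) \<in> same_component C" using Y by (simp add: same_component_def)
qed

text \<open>The components are the non-empty fibres of the degree, and every residue is a degree.\<close>

lemma order_universal_grading_group: "Coset.order (universal_grading_group C) = gen.period"
proof -
  let ?F = "\<lambda>r. {Z. simple_obj C Z \<and> gen.degree (iso_class Z) = r}"
  have img: "same_component C `` {Y} = ?F (gen.degree (iso_class Y))" if "simple_obj C Y" for Y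
    using that by (auto simp: same_component_iff)
  have ex: "\<exists>Z. simple_obj C Z \<and> gen.degree (iso_class Z) = r" if r: "r < gen.period" for r
  proof -
    obtain K where K: "K \<in> Irr C" "gen.degree K = r" using gen.degree_surj[OF r] by blast
    then show ?thesis using rep_simple[OF K(1)] iso_class_rep[OF K(1)] by (intro exI[of _ "rep K"]) simp
  qed
  have "Collect (simple_obj C) // same_component C = ?F ` {..<gen.period}"
  proof (intro subset_antisym subsetI)
    fix K assume "K \<in> Collect (simple_obj C) // same_component C"
    then obtain Y where Y: "simple_obj C Y" "K = same_component C `` {Y}" by (auto simp: quotient_def)
    then have "K = ?F (gen.degree (iso_class Y))" using img by simp
    then show "K \<in> ?F ` {..<gen.period}" using gen.degree_less[of "iso_class Y"] by blast
  next
    fix K assume "K \<in> ?F ` {..<gen.period}"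
    then obtain r where r: "r < gen.period" "K = ?F r" by auto
    obtain Z where Z: "simple_obj C Z" "gen.degree (iso_class Z) = r" using ex[OF r(1)] by blast
    then have "K = same_component C `` {Z}" using img[OF Z(1)] r(2) by simp
    then show "K \<in> Collect (simple_obj C) // same_component C" using Z(1) by (auto intro: quotientI)
  qed
  moreover have "inj_on ?F {..<gen.period}"
  proof (rule inj_onI)
    fix r s assume r: "r \<in> {..<gen.period}" and eq: "?F r = ?F s"
    obtain Z where "simple_obj C Z" "gen.degree (iso_class Z) = r" using ex r by auto
    then have "Z \<in> ?F s" using eq by blast
    then show "r = s" using \<open>gen.degree (iso_class Z) = r\<close> by simp
  qed
  ultimately show ?thesis
    by (simp add: Coset.order_def universal_grading_group_def card_image)
qed

theorem dimension_divides: "alg_dvd ((qdim C X)\<^sup>2) (global_dim C / of_nat (Coset.order (universal_grading_group C)))"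
proof -
  have d: "qdim C (rep (iso_class X)) = qdim C X" by (rule qdim_isomorphic[OF rep_iso_class[OF X_simple]])
  have "algebraic_int (md.global / of_nat gen.period / (qdim C (rep (iso_class X)))\<^sup>2)"
    by (rule md.grading_divides[where deg = gen.degree, OF gen.period(1) gen.x_I gen.degree_x])
      (simp add: gen.degree_add)
  moreover have "md.global = global_dim C" by (simp add: md.global_def global_dim_def)
  moreover have "qdim C X \<noteq> 0" using md.d_nonzero[OF iso_class_Irr[OF X_simple]] d by simp
  ultimately show ?thesis by (simp add: alg_dvd_def order_universal_grading_group d)
qed

end

theorem theorem1p2:
  fixes C :: "('o, 'm) braided_piv_cat" and X :: 'o
  assumes "modular_fusion_category C"
    and "simple_obj C X"
    and "generated C {X} = UNIV"
  shows "alg_dvd ((qdim C X)\<^sup>2)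
           (global_dim C / of_nat (Coset.order (universal_grading_group C)))"
proof -
  interpret generated_modular_category C X
    using assms by (simp add: generated_modular_category_def generated_modular_category_axioms_def)
  show ?thesis by (rule dimension_divides)
qed

end
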